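(* Let $\mathbb{K}$ be a field with $\mathrm{char}(\mathbb{K})\nmid n!$ (including $\mathrm{char}(\mathbb{K})=0$), and let $\mathbb{L}$ be an arbitrary field. We have the following lower bounds: $$\mathrm{gap}_{\mathbb{K}}(Ro_n^{\leq k,<l})\geq\mathrm{gap}_{\mathbb{K}}(pRo_n^{\leq k,<l}),$$ $$\mathrm{ssgap}_{\mathbb{L}}(Ro_n^{\leq k,<l})=\mathrm{ssgap}_{\mathbb{L}}(pRo_n^{\leq k,<l}),\qquad \mathrm{faith}_{\mathbb{L}}(Ro_n^{\leq k,<l})\geq\mathrm{faith}_{\mathbb{L}}(pRo_n^{\leq k,<l}),$$ $$\mathrm{ssgap}_{\mathbb{L}}(RoBr_n^{\leq k})\geq\begin{cases}\mathrm{ssgap}_{\mathbb{L}}(Mo_n^{\leq k})&\text{always},\\ \sum_{t=0}^{n}\binom{n}{2t}(2t-1)!!&\text{if } n\gg 0,\ 0\leq k\leq 2\sqrt n,\end{cases}$$ $$\mathrm{faith}_{\mathbb{L}}(RoBr_n^{\leq k})\geq\mathrm{faith}_{\mathbb{L}}(Mo_n^{\leq k}),$$ $$\mathrm{ssgap}_{\mathbb{L}}(Pa_n^{\leq k})\geq\begin{cases}\mathrm{ssgap}_{\mathbb{L}}(pPa_n^{\leq k})&\text{always},\\ \sum_{t=0}^{n}\left\{{n\atop t}\right\}&\text{if } n\gg 0,\ 0\leq k\leq 2\sqrt n,\end{cases}$$ $$\mathrm{faith}_{\mathbb{L}}(Pa_n^{\leq k})\geq\mathrm{faith}_{\mathbb{L}}(pPa_n^{\leq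 k}).$$ Here $\left\{{n\atop t}\right\}$ is the Stirling number of the second kind, $!!$ is the double factorial, and $n\gg 0$ means $n$ sufficiently large.
   Context: Cells: for a finite monoid $S$ put $a\leq_l b\Leftrightarrow b\in Sa$, $a\leq_r b\Leftrightarrow b\in aS$, $a\leq_{lr}b\Leftrightarrow b\in SaS$; the equivalence classes are the left, right and two-sided cells ($J$-cells), and $H$-cells are the nonempty intersections of a left and a right cell. The preorder $\leq_{lr}$ induces an order on the $J$-cells. Diagram monoids: the partition monoid $Pa_n$ consists of all set partitions of the $2n$-element set of $n$ bottom and $n$ top points. The product $ab$ is obtained by stacking $a$ on top of $b$, merging blocks along the middle points, and deleting the middle points (and components consisting only of middle points). A through strand is a block containing both a bottom and a top point. Submonoids: the rook-Brauer monoid $RoBr_n$ (all blocks of size $1$ or $2$); the rook monoid $Ro_n$ (all blocks are of size $1$ or of the form $\{\text{bottom point},\text{top point}\}$). Planar versions (diagrams that can be drawn without crossings inside the strip): the planar partition monoid $pPa_n\subset Pa_n$, the Motzkin monoid $Mo_n\subset RoBr_n$, the planar rook monoid $pRo_n\subset Ro_n$. In each of these monoids the $J$-cells are the sets $J_k$ of diagrams with exactly $k$ through strands, and the $J$-cells increase in the order $\leq_{lr}$ as the number of through strands decreases. Truncations: for $X_n$ one of these monoids, $X_n^{\leq k}=(X_n)_{\geq J_k}$ is the submonoid consisting of all elements in $J$-cells $\geq_{lr}J_k$ (the diagrams with at most $k$ through strands) together with the identity $1$. For $X_n$ one of $Ro_n,pRo_n$ and $k\leq l$, $X_n^{\leq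 k,<l}=(X_n)_{\geq J_k}/(>J_l)$ is the Rees factor of $(X_n)_{\geq J_k}$ by the two-sided ideal of its elements lying in $J$-cells strictly bigger than $J_l$ in the order $\leq_{lr}$; that is, all elements of this ideal are identified to a single zero element. Representations are finite-dimensional left representations over the indicated field $F$. Let $S$ be a finite monoid with group of units $G$. Trivial representations: $1_b\colon S\to F$ sends $s$ to $1$ if $s\in G$ and to $0$ otherwise; $1_t\colon S\to F$ sends every $s$ to $1$. Representation gap: $(S,F)$ is $m$-trivial if every representation $M$ with $\dim_F M\leq m$ is a direct sum of $\dim_F M$ representations each isomorphic to $1_b$ or $1_t$. If $S$ is neither the one-element monoid nor $\{1,a\}$ with $aa=a$, then $\mathrm{gap}_F(S)$ is the maximal $m$ such that $(S,F)$ is $(m-1)$-trivial (it is $0$ by convention for these two monoids). Semisimple gap: within one $J$-cell all left cells have the same size $|\mathcal{L}|$ and all $H$-cells the same size $|\mathcal{H}|$. If a $J$-cell contains an idempotent $e$, its $H$-cell $H(e)$ is a group. By the Clifford--Munn--Ponizovskii theorem, simple $S$-representations up to isomorphism are in bijection with pairs of a $J$-cell containing an idempotent and a simple representation $V$ of the group $H(e)$ for a chosen idempotent $e$ in it; write $L_V$ for the corresponding simple $S$-representation. Its semisimple dimension is $\mathrm{ssdim}_F(L_V)=\frac{|\mathcal{L}|}{|\mathcal{H}|}\dim_F V$, and $\mathrm{ssgap}_F(S)$ is the minimum of $\mathrm{ssdim}_F(L)$ over simple $S$-representations $L\not\cong 1_b,1_t$. Faithfulness: a representation is faithful if distinct elements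 of $S$ act by distinct linear maps; $\mathrm{faith}_F(S)$ is the minimal dimension of a faithful $S$-representation over $F$.
   Formalization: The gap and ssgap comparisons are stated for k < n only: for k = n the truncation is all of X_n and they fail, e.g. for n = k = 2, l = 0, char ≠ 2 the sign representation of S_2 gives ssgap(Ro_2) = 1 but ssgap(pRo_2) = 2. *)

theory Defs
  imports
    "HOL-Library.Disjoint_Sets"
    "HOL-Library.Extended_Real"
    "HOL-Algebra.Group"
    "HOL-Combinatorics.Stirling"
    "Jordan_Normal_Form.VS_Connect"
begin

section \<open>Cells of a monoid\<close>

definition le_l :: "'s monoid \<Rightarrow> 's \<Rightarrow> 's \<Rightarrow> bool" where
  "le_l S a b \<longleftrightarrow> (\<exists>s\<in>carrier S. b = s \<otimes>\<^bsub>S\<^esub> a)"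

definition le_r :: "'s monoid \<Rightarrow> 's \<Rightarrow> 's \<Rightarrow> bool" where
  "le_r S a b \<longleftrightarrow> (\<exists>s\<in>carrier S. b = a \<otimes>\<^bsub>S\<^esub> s)"

definition le_lr :: "'s monoid \<Rightarrow> 's \<Rightarrow> 's \<Rightarrow> bool" where
  "le_lr S a b \<longleftrightarrow> (\<exists>s\<in>carrier S. \<exists>t\<in>carrier S. b = s \<otimes>\<^bsub>S\<^esub> a \<otimes>\<^bsub>S\<^esub> t)"

definition l_cell :: "'s monoid \<Rightarrow> 's \<Rightarrow> 's set" where
  "l_cell S a = {b \<in> carrier S. le_l S a b \<and> le_l S b a}"

definition r_cell :: "'s monoid \<Rightarrow> 's \<Rightarrow> 's set" where
  "r_cell S a = {b \<in> carrier S. le_r S a b \<and> le_r S b a}"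

definition h_cell :: "'s monoid \<Rightarrow> 's \<Rightarrow> 's set" where
  "h_cell S a = l_cell S a \<inter> r_cell S a"

text \<open>For an idempotent \<open>e\<close> this is the group \<open>H(e)\<close>, whose neutral element is \<open>e\<close>.\<close>

definition h_group :: "'s monoid \<Rightarrow> 's \<Rightarrow> 's monoid" where
  "h_group S e = S\<lparr>carrier := h_cell S e, one := e\<rparr>"

text \<open>Rees factor by a two-sided ideal \<open>I\<close>: all elements of \<open>I\<close> are identified. If \<open>I\<close> is empty,
  nothing is identified (and no zero is added).\<close>

definition rees_rel :: "'s monoid \<Rightarrow> 's set \<Rightarrow> ('s \<times> 's) set" where
  "rees_rel S I = Id_on (carrier S) \<union> I \<times> I"

definition rees_factor :: "'s monoid \<Rightarrow> 's set \<Rightarrow> 's set monoid" where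
  "rees_factor S I =
    \<lparr>carrier = carrier S // rees_rel S I,
     mult = (\<lambda>X Y. \<Union>x\<in>X. \<Union>y\<in>Y. rees_rel S I `` {x \<otimes>\<^bsub>S\<^esub> y}),
     one = rees_rel S I `` {\<one>\<^bsub>S\<^esub>}\<rparr>"

section \<open>Finite-dimensional representations\<close>

text \<open>A \<open>d\<close>-dimensional left representation, after a choice of basis, is a homomorphism to the
  \<open>d \<times> d\<close> matrices acting on column vectors. Only the values on the carrier matter.\<close>

definition is_rep :: "'s monoid \<Rightarrow> nat \<Rightarrow> ('s \<Rightarrow> 'f::field mat) \<Rightarrow> bool" where
  "is_rep S d \<rho> \<longleftrightarrow>
     (\<forall>s\<in>carrier S. \<rho> s \<in> carrier_mat d d) \<and> \<rho> \<one>\<^bsub>S\<^esub> = 1\<^sub>m d \<and>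
     (\<forall>s\<in>carrier S. \<forall>t\<in>carrier S. \<rho> (s \<otimes>\<^bsub>S\<^esub> t) = \<rho> s * \<rho> t)"

definition rep_iso ::
  "'s monoid \<Rightarrow> nat \<Rightarrow> ('s \<Rightarrow> 'f::field mat) \<Rightarrow> nat \<Rightarrow> ('s \<Rightarrow> 'f mat) \<Rightarrow> bool" where
  "rep_iso S d \<rho> d' \<rho>' \<longleftrightarrow>
     (\<exists>P\<in>carrier_mat d' d. \<exists>Q\<in>carrier_mat d d'. P * Q = 1\<^sub>m d' \<and> Q * P = 1\<^sub>m d \<and>
        (\<forall>s\<in>carrier S. P * \<rho> s = \<rho>' s * P))"

definition rep_direct_sum :: "('s \<Rightarrow> 'f::field mat) list \<Rightarrow> 's \<Rightarrow> 'f mat" where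
  "rep_direct_sum \<sigma>s = (\<lambda>s. diag_block_mat (map (\<lambda>\<sigma>. \<sigma> s) \<sigma>s))"

definition simple_rep :: "'s monoid \<Rightarrow> nat \<Rightarrow> ('s \<Rightarrow> 'f::field mat) \<Rightarrow> bool" where
  "simple_rep S d \<rho> \<longleftrightarrow> is_rep S d \<rho> \<and> d \<noteq> 0 \<and>
     (\<forall>W. subspace class_ring W (module_vec TYPE('f) d) \<and>
          (\<forall>s\<in>carrier S. \<forall>w\<in>W. \<rho> s *\<^sub>v w \<in> W) \<longrightarrow>
        W = {0\<^sub>v d} \<or> W = carrier_vec d)"

definition triv_b :: "'s monoid \<Rightarrow> 's \<Rightarrow> 'f::field mat" where
  "triv_b S s = (if s \<in> Units S then 1\<^sub>m 1 else 0\<^sub>m 1 1)"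

definition triv_t :: "'s \<Rightarrow> 'f::field mat" where
  "triv_t s = 1\<^sub>m 1"

section \<open>Representation gap\<close>

definition m_trivial :: "'f::field itself \<Rightarrow> 's monoid \<Rightarrow> nat \<Rightarrow> bool" where
  "m_trivial F S m \<longleftrightarrow>
     (\<forall>d\<le>m. \<forall>\<rho> :: 's \<Rightarrow> 'f mat. is_rep S d \<rho> \<longrightarrow>
        (\<exists>\<sigma>s. length \<sigma>s = d \<and>
           (\<forall>\<sigma>\<in>set \<sigma>s. is_rep S 1 \<sigma> \<and> (rep_iso S 1 \<sigma> 1 (triv_b S) \<or> rep_iso S 1 \<sigma> 1 triv_t)) \<and>
           rep_iso S d \<rho> d (rep_direct_sum \<sigma>s)))"

text \<open>For every finite monoid outside the two exceptional cases the maximum exists, since the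
  regular representation is faithful.\<close>

definition rep_gap :: "'f::field itself \<Rightarrow> 's monoid \<Rightarrow> nat" where
  "rep_gap F S =
     (if carrier S = {\<one>\<^bsub>S\<^esub>} \<or> (\<exists>a. a \<noteq> \<one>\<^bsub>S\<^esub> \<and> carrier S = {\<one>\<^bsub>S\<^esub>, a} \<and> a \<otimes>\<^bsub>S\<^esub> a = a) then 0
      else (GREATEST m. 1 \<le> m \<and> m_trivial F S (m - 1)))"

section \<open>Semisimple gap\<close>

text \<open>The \<open>J\<close>-cell of \<open>e\<close> is the apex of \<open>\<rho>\<close>: it does not annihilate the representation, whereas
  every element not below it does. As \<open>\<le>\<^sub>l\<^sub>r\<close> is reversed inclusion of principal ideals, these
  are the \<open>s\<close> with \<open>e \<notin> SsS\<close>.\<close>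

definition has_apex :: "'s monoid \<Rightarrow> nat \<Rightarrow> ('s \<Rightarrow> 'f::field mat) \<Rightarrow> 's \<Rightarrow> bool" where
  "has_apex S d \<rho> e \<longleftrightarrow>
     \<rho> e \<noteq> 0\<^sub>m d d \<and> (\<forall>s\<in>carrier S. \<not> le_lr S s e \<longrightarrow> \<rho> s = 0\<^sub>m d d)"

text \<open>The Clifford--Munn--Ponizovskii correspondence: for an idempotent \<open>e\<close> and a simple
  representation \<open>V\<close> of \<open>H(e)\<close> (given by \<open>c\<close> and \<open>\<sigma>\<close>), the simple representation \<open>L\<^sub>V\<close> (given by
  \<open>d\<close> and \<open>\<rho>\<close>) is the one with apex the \<open>J\<close>-cell of \<open>e\<close> and with \<open>e L\<^sub>V\<close>, the image of \<open>\<rho> e\<close>,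
  isomorphic to \<open>V\<close> over \<open>H(e)\<close>. The matrix \<open>A\<close> is such an isomorphism, composed with the
  inclusion of \<open>e L\<^sub>V\<close> in \<open>L\<^sub>V\<close>.\<close>

definition is_L_V ::
  "'s monoid \<Rightarrow> 's \<Rightarrow> nat \<Rightarrow> ('s \<Rightarrow> 'f::field mat) \<Rightarrow> nat \<Rightarrow> ('s \<Rightarrow> 'f mat) \<Rightarrow> bool" where
  "is_L_V S e c \<sigma> d \<rho> \<longleftrightarrow>
     e \<in> carrier S \<and> e \<otimes>\<^bsub>S\<^esub> e = e \<and> simple_rep (h_group S e) c \<sigma> \<and>
     simple_rep S d \<rho> \<and> has_apex S d \<rho> e \<and>
     (\<exists>A\<in>carrier_mat d c.
        bij_betw (\<lambda>v. A *\<^sub>v v) (carrier_vec c) ((\<lambda>w. \<rho> e *\<^sub>v w) ` carrier_vec d) \<and>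
        (\<forall>h\<in>h_cell S e. \<rho> h * A = A * \<sigma> h))"

definition ssdim :: "'s monoid \<Rightarrow> 's \<Rightarrow> nat \<Rightarrow> real" where
  "ssdim S e c = real (card (l_cell S e)) / real (card (h_cell S e)) * real c"

text \<open>The minimum over the empty set is \<open>\<infinity>\<close>.\<close>

definition ssgap :: "'f::field itself \<Rightarrow> 's monoid \<Rightarrow> ereal" where
  "ssgap F S = Inf {ereal (ssdim S e c) | e c (\<sigma> :: 's \<Rightarrow> 'f mat) d (\<rho> :: 's \<Rightarrow> 'f mat).
     is_L_V S e c \<sigma> d \<rho> \<and>
     \<not> rep_iso S d \<rho> 1 (triv_b S) \<and> \<not> rep_iso S d \<rho> 1 triv_t}"

section \<open>Faithfulness\<close>

definition faith :: "'f::field itself \<Rightarrow> 's monoid \<Rightarrow> nat" where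
  "faith F S = (LEAST d. \<exists>\<rho> :: 's \<Rightarrow> 'f mat. is_rep S d \<rho> \<and> inj_on \<rho> (carrier S))"

section \<open>Diagram monoids\<close>

datatype point = Bot nat | Top nat

definition points :: "nat \<Rightarrow> point set" where
  "points n = Bot ` {1..n} \<union> Top ` {1..n}"

text \<open>In a stack the bottom points of the upper diagram and the top points of the lower diagram
  both become the middle points.\<close>

datatype stack_point = Lower nat | Middle nat | Upper nat

fun in_upper :: "point \<Rightarrow> stack_point" where
  "in_upper (Top i) = Upper i"
| "in_upper (Bot i) = Middle i"

fun in_lower :: "point \<Rightarrow> stack_point" where
  "in_lower (Top i) = Middle i"
| "in_lower (Bot i) = Lower i"

fun outer :: "point \<Rightarrow> stack_point" where
  "outer (Top i) = Upper i"
| "outer (Bot i) = Lower i"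

definition stack_graph :: "point set set \<Rightarrow> point set set \<Rightarrow> (stack_point \<times> stack_point) set" where
  "stack_graph a b =
     (\<Union>A\<in>a. in_upper ` A \<times> in_upper ` A) \<union> (\<Union>B\<in>b. in_lower ` B \<times> in_lower ` B)"

definition stack :: "nat \<Rightarrow> point set set \<Rightarrow> point set set \<Rightarrow> point set set" where
  "stack n a b =
     points n // {(x, y). x \<in> points n \<and> y \<in> points n \<and> (outer x, outer y) \<in> (stack_graph a b)\<^sup>*}"

definition Pa :: "nat \<Rightarrow> point set set monoid" where
  "Pa n = \<lparr>carrier = {d. partition_on (points n) d}, mult = stack n,
           one = (\<lambda>i. {Bot i, Top i}) ` {1..n}\<rparr>"

definition RoBr :: "nat \<Rightarrow> point set set monoid" where
  "RoBr n = (Pa n)\<lparr>carrier := {d \<in> carrier (Pa n). \<forall>B\<in>d. card B = 1 \<or> card B = 2}\<rparr>"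

definition Ro :: "nat \<Rightarrow> point set set monoid" where
  "Ro n = (Pa n)\<lparr>carrier :=
     {d \<in> carrier (Pa n). \<forall>B\<in>d. card B = 1 \<or> (\<exists>i j. B = {Bot i, Top j})}\<rparr>"

text \<open>Position of a point when walking around the boundary of the strip: the bottom points from
  left to right, then the top points from right to left. A diagram can be drawn without crossings
  if and only if no two distinct blocks interleave in this order.\<close>

fun boundary_pos :: "nat \<Rightarrow> point \<Rightarrow> nat" where
  "boundary_pos n (Bot i) = i"
| "boundary_pos n (Top i) = 2 * n + 1 - i"

definition planar :: "nat \<Rightarrow> point set set \<Rightarrow> bool" where
  "planar n d \<longleftrightarrow>
     \<not> (\<exists>A\<in>d. \<exists>B\<in>d. A \<noteq> B \<and> (\<exists>w\<in>A. \<exists>x\<in>B. \<exists>y\<in>A. \<exists>z\<in>B.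
          boundary_pos n w < boundary_pos n x \<and> boundary_pos n x < boundary_pos n y \<and>
          boundary_pos n y < boundary_pos n z))"

definition pPa :: "nat \<Rightarrow> point set set monoid" where
  "pPa n = (Pa n)\<lparr>carrier := {d \<in> carrier (Pa n). planar n d}\<rparr>"

definition Mo :: "nat \<Rightarrow> point set set monoid" where
  "Mo n = (RoBr n)\<lparr>carrier := {d \<in> carrier (RoBr n). planar n d}\<rparr>"

definition pRo :: "nat \<Rightarrow> point set set monoid" where
  "pRo n = (Ro n)\<lparr>carrier := {d \<in> carrier (Ro n). planar n d}\<rparr>"

definition through_strands :: "point set set \<Rightarrow> nat" where
  "through_strands d = card {B \<in> d. (\<exists>i. Bot i \<in> B) \<and> (\<exists>j. Top j \<in> B)}"

definition J :: "point set set monoid \<Rightarrow> nat \<Rightarrow> point set set set" where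
  "J X k = {d \<in> carrier X. through_strands d = k}"

section \<open>Truncations\<close>

text \<open>\<open>trunc X k\<close> is \<open>X\<^bsub>\<ge>J\<^sub>k\<^esub>\<close>, and \<open>trunc2 X k l\<close> is its Rees factor by the elements in \<open>J\<close>-cells
  strictly bigger than \<open>J\<^sub>l\<close>. Cells increase as the number of through strands decreases.\<close>

definition trunc :: "point set set monoid \<Rightarrow> nat \<Rightarrow> point set set monoid" where
  "trunc X k = X\<lparr>carrier := {s \<in> carrier X. \<exists>a\<in>J X k. le_lr X a s} \<union> {\<one>\<^bsub>X\<^esub>}\<rparr>"

definition trunc2 :: "point set set monoid \<Rightarrow> nat \<Rightarrow> nat \<Rightarrow> point set set set monoid" where
  "trunc2 X k l = rees_factor (trunc X k)
     {s \<in> carrier (trunc X k). \<exists>a\<in>J X l. le_lr X a s \<and> \<not> le_lr X s a}"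

section \<open>Double factorial\<close>

text \<open>The value at \<open>t\<close> is \<open>(2t-1)!!\<close>, with the convention \<open>(-1)!! = 1\<close>.\<close>

definition odd_double_fact :: "nat \<Rightarrow> nat" where
  "odd_double_fact t = (\<Prod>i=1..t. 2 * i - 1)"

end

theory Submission
  imports Defs "HOL-Library.Function_Algebras"
begin

text \<open>The semisimple gap is governed by one number. For an idempotent \<open>e\<close> let \<open>r(e)\<close> be the
  number of right cells that meet the left cell of \<open>e\<close>. Inside this left cell every H-cell has
  the size of \<open>H(e)\<close>, so \<open>r(e) = |L|/|H|\<close> and the semisimple dimension of \<open>L\<^sub>V\<close> is \<open>r(e) * dim
  V\<close>. Over any field there is a simple representation with apex \<open>e\<close> and \<open>V\<close> trivial
  (\<open>L_trivial_exists\<close>), and such a \<open>V\<close> makes the dimension smallest. In the truncated monoids one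
  obtains \<open>1\<^sub>b\<close> at the identity, \<open>1\<^sub>t\<close> at an idempotent with \<open>e S e = {e}\<close>, and a nontrivial
  representation at any other idempotent; so the semisimple gap is the minimum of \<open>r(e)\<close> over the
  other idempotents (\<open>ssgap_le\<close>, \<open>le_ssgap\<close>).

  This minimum is monotone under passing to planar diagrams for two reasons. First, \<open>r(e)\<close> can
  only grow when a monoid \<open>T\<close> containing \<open>e\<close> is enlarged to \<open>S\<close>, because regular elements of \<open>T\<close>
  that are R-related in \<open>S\<close> are R-related in \<open>T\<close> (\<open>num_r_cells_mono\<close>). Second, \<open>r\<close> takes the same
  value at conjugate idempotents \<open>p q\<close> and \<open>q p\<close>, and every idempotent diagram with \<open>j\<close> through
  strands is conjugate to the partial identity \<open>eps n j\<close>, which is planar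
  (\<open>idempotent_conjugate_eps\<close>). For rook diagrams the order-preserving partial bijections already
  meet every right cell, whence equality.

  Faithful representations restrict along an embedding. For the representation gap of rook
  monoids, suppose that a representation becomes a sum of trivial ones on the planar part. Then
  all nonidentity idempotents act as the zero of the monoid does. Every nonidentity element \<open>s\<close>
  has a planar idempotent \<open>f\<close> with \<open>s f = s\<close>, so it acts as the zero too, and the decomposition
  extends (\<open>rep_gap_mono\<close>).

  For large \<open>n\<close>, \<open>r(eps n j)\<close> is at least the number of half diagrams, that is, of partitions of
  the \<open>n\<close> top points with \<open>j\<close> marked blocks (\<open>card_le_num_r_cells_eps\<close>). For blocks of size at
  most two this is \<open>(n choose j) * I(n - j)\<close> with \<open>I\<close> the number of involutions; for arbitrary
  blocks it is the sum over \<open>t\<close> of \<open>Stirling n t * (t choose j)\<close>. Elementary estimates show that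
  for \<open>1 \<le> j \<le> 2 * sqrt n\<close> both are at least their value at \<open>j = 0\<close>, which is the claimed bound.

  Two devices keep the diagram calculus short. A diagram is determined by the set of
  two-colourings of its points that are constant on blocks, and stacking becomes composition of
  relations between colourings of the top and of the bottom (\<open>compat_stack\<close>). That stacking
  preserves planarity is shown by gluing the middle points one pair at a time, in an order in
  which the two points to be glued are always neighbours (\<open>noncrossing_merge_adjacent\<close>).\<close>

section \<open>Right cells meeting a left cell\<close>

locale fin_monoid = monoid S for S :: "'s monoid" (structure) +
  assumes fin: "finite (carrier S)"

text \<open>For an idempotent \<open>e\<close> this is the ratio of the sizes of its left cell and its H-cell.\<close>

definition num_r_cells :: "'s monoid \<Rightarrow> 's \<Rightarrow> nat" where
  "num_r_cells S e = card (r_cell S ` l_cell S e)"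

lemma card_image_le_if_determined:
  assumes "finite A" and "\<And>x y. x \<in> A \<Longrightarrow> y \<in> A \<Longrightarrow> g x = g y \<Longrightarrow> f x = f y"
  shows "card (f ` A) \<le> card (g ` A)"
proof -
  have "f ` A \<subseteq> (\<lambda>z. f (inv_into A g z)) ` g ` A"
  proof
    fix y assume "y \<in> f ` A"
    then obtain x where x: "x \<in> A" "y = f x" by auto
    have "f (inv_into A g (g x)) = f x"
      using assms(2) x(1) by (metis f_inv_into_f imageI inv_into_into)
    then show "y \<in> (\<lambda>z. f (inv_into A g z)) ` g ` A" using x by force
  qed
  then show ?thesis
    by (meson assms(1) card_image_le finite_imageI card_mono order_trans)
qed

lemma l_cellD:
  assumes "x \<in> l_cell S e"
  obtains s t where "x \<in> carrier S" "s \<in> carrier S" "t \<in> carrier S"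
    "x = s \<otimes>\<^bsub>S\<^esub> e" "e = t \<otimes>\<^bsub>S\<^esub> x"
  using assms unfolding l_cell_def le_l_def by blast

lemma l_cellI:
  assumes "x \<in> carrier S" "s \<in> carrier S" "t \<in> carrier S"
    "x = s \<otimes>\<^bsub>S\<^esub> e" "e = t \<otimes>\<^bsub>S\<^esub> x"
  shows "x \<in> l_cell S e"
  using assms unfolding l_cell_def le_l_def by blast

lemma r_cellD:
  assumes "x \<in> r_cell S e"
  obtains s t where "x \<in> carrier S" "s \<in> carrier S" "t \<in> carrier S"
    "x = e \<otimes>\<^bsub>S\<^esub> s" "e = x \<otimes>\<^bsub>S\<^esub> t"
  using assms unfolding r_cell_def le_r_def by blast

lemma r_cellI:
  assumes "x \<in> carrier S" "s \<in> carrier S" "t \<in> carrier S"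
    "x = e \<otimes>\<^bsub>S\<^esub> s" "e = x \<otimes>\<^bsub>S\<^esub> t"
  shows "x \<in> r_cell S e"
  using assms unfolding r_cell_def le_r_def by blast

context fin_monoid
begin

lemma finite_l_cell [simp]: "finite (l_cell S e)"
  using fin unfolding l_cell_def by auto

lemma finite_h_cell [simp]: "finite (h_cell S e)"
  unfolding h_cell_def by auto

lemma self_l_cell: "x \<in> carrier S \<Longrightarrow> x \<in> l_cell S x"
  by (rule l_cellI[where s=\<one> and t=\<one>]) auto

lemma self_r_cell: "x \<in> carrier S \<Longrightarrow> x \<in> r_cell S x"
  by (rule r_cellI[where s=\<one> and t=\<one>]) auto

lemma self_h_cell: "x \<in> carrier S \<Longrightarrow> x \<in> h_cell S x"
  by (simp add: h_cell_def self_l_cell self_r_cell)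

lemma le_r_trans: "a \<in> carrier S \<Longrightarrow> le_r S a b \<Longrightarrow> le_r S b c \<Longrightarrow> le_r S a c"
  unfolding le_r_def by (metis m_assoc m_closed)

lemma r_cell_eq_iff:
  assumes "x \<in> carrier S" "y \<in> carrier S"
  shows "r_cell S x = r_cell S y \<longleftrightarrow> le_r S x y \<and> le_r S y x"
proof
  assume "r_cell S x = r_cell S y"
  then have "x \<in> r_cell S y" using self_r_cell[OF assms(1)] by simp
  then show "le_r S x y \<and> le_r S y x" unfolding r_cell_def by auto
next
  assume "le_r S x y \<and> le_r S y x"
  then show "r_cell S x = r_cell S y"
    unfolding r_cell_def using le_r_trans assms by blast
qed

lemma r_cell_eqI:
  assumes "x \<in> carrier S" "y \<in> carrier S" "s \<in> carrier S" "t \<in> carrier S"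
    and "y = x \<otimes> s" "x = y \<otimes> t"
  shows "r_cell S x = r_cell S y"
  using assms r_cell_eq_iff unfolding le_r_def by blast

lemma card_h_cell_pos: "e \<in> carrier S \<Longrightarrow> card (h_cell S e) > 0"
  using self_h_cell card_gt_0_iff finite_h_cell by blast

lemma l_cell_idem:
  assumes "e \<in> carrier S" "e \<otimes> e = e" "x \<in> l_cell S e"
  shows "x \<otimes> e = x"
  using assms by (metis l_cellD m_assoc)

text \<open>Green's lemma: if \<open>t x = e\<close>, then left multiplication by \<open>t\<close> inverts \<open>h \<mapsto> x h\<close>, so each
  H-cell in the left cell of \<open>e\<close> is a copy of \<open>H(e)\<close>.\<close>

lemma h_cell_fibre_bij:
  assumes e: "e \<in> carrier S" "e \<otimes> e = e" and x: "x \<in> l_cell S e"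
  shows "bij_betw (\<lambda>h. x \<otimes> h) (h_cell S e) {y \<in> l_cell S e. r_cell S y = r_cell S x}"
proof -
  obtain t where xc: "x \<in> carrier S" and t: "t \<in> carrier S" "e = t \<otimes> x"
    using x by (auto elim: l_cellD)
  have xe: "x \<otimes> e = x" using l_cell_idem e x by auto
  have eh: "e \<otimes> h = h \<and> h \<otimes> e = h \<and> h \<in> carrier S" if h: "h \<in> h_cell S e" for h
  proof -
    obtain s t where "h \<in> carrier S" "s \<in> carrier S" "h = s \<otimes> e"
      using h unfolding h_cell_def by (auto elim: l_cellD)
    moreover obtain s' where "s' \<in> carrier S" "h = e \<otimes> s'"
      using h unfolding h_cell_def by (auto elim: r_cellD)
    ultimately show ?thesis using e by (metis m_assoc)
  qed
  show ?thesis
  proof (rule bij_betw_byWitness[where f'="\<lambda>y. t \<otimes> y"])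
    show "\<forall>h\<in>h_cell S e. t \<otimes> (x \<otimes> h) = h"
    proof
      fix h assume "h \<in> h_cell S e"
      then show "t \<otimes> (x \<otimes> h) = h" using eh t xc by (metis m_assoc)
    qed
    have key: "x \<otimes> (t \<otimes> y) = y \<and> t \<otimes> y \<in> h_cell S e"
      if y: "y \<in> l_cell S e" "r_cell S y = r_cell S x" for y
    proof -
      have yc: "y \<in> carrier S" using y(1) by (auto elim: l_cellD)
      obtain s s' where s: "s \<in> carrier S" "s' \<in> carrier S" "y = x \<otimes> s" "x = y \<otimes> s'"
        using self_r_cell[OF yc] y(2) by (auto elim: r_cellD)
      have xty: "x \<otimes> (t \<otimes> y) = y"
      proof -
        have "x \<otimes> (t \<otimes> y) = (x \<otimes> (t \<otimes> x)) \<otimes> s" using s xc t by (simp add: m_assoc)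
        then show ?thesis using t(2) xe s by metis
      qed
      obtain u v where u: "u \<in> carrier S" "y = u \<otimes> e" and v: "v \<in> carrier S" "e = v \<otimes> y"
        using y(1) by (auto elim: l_cellD)
      have "t \<otimes> y \<in> l_cell S e"
      proof (rule l_cellI[where s="t \<otimes> u" and t="v \<otimes> x"])
        show "t \<otimes> y = t \<otimes> u \<otimes> e" using u t e by (simp add: m_assoc)
        show "e = v \<otimes> x \<otimes> (t \<otimes> y)" using v xty xc t yc by (simp add: m_assoc)
      qed (use t(1) u(1) v(1) xc yc in auto)
      moreover have "t \<otimes> y \<in> r_cell S e"
      proof (rule r_cellI[where s=s and t=s'])
        show "t \<otimes> y = e \<otimes> s" using s t xc by (metis m_assoc)
        show "e = t \<otimes> y \<otimes> s'" using s t yc by (metis m_assoc)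
      qed (use t(1) s(1,2) yc in auto)
      ultimately show ?thesis using xty unfolding h_cell_def by auto
    qed
    show "\<forall>y\<in>{y \<in> l_cell S e. r_cell S y = r_cell S x}. x \<otimes> (t \<otimes> y) = y" using key by auto
    show "(\<lambda>y. t \<otimes> y) ` {y \<in> l_cell S e. r_cell S y = r_cell S x} \<subseteq> h_cell S e" using key by auto
    show "(\<lambda>h. x \<otimes> h) ` h_cell S e \<subseteq> {y \<in> l_cell S e. r_cell S y = r_cell S x}"
    proof (clarify)
      fix h assume h: "h \<in> h_cell S e"
      note hh = eh[OF h]
      obtain s where s: "s \<in> carrier S" "e = s \<otimes> h"
        using h unfolding h_cell_def by (auto elim: l_cellD)
      obtain r where r: "r \<in> carrier S" "e = h \<otimes> r"
        using h unfolding h_cell_def by (auto elim: r_cellD)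
      have "x \<otimes> h \<in> l_cell S e"
      proof (rule l_cellI[where s="x \<otimes> h" and t="s \<otimes> t"])
        show "x \<otimes> h = x \<otimes> h \<otimes> e" using hh xc e by (simp add: m_assoc)
        have "s \<otimes> t \<otimes> (x \<otimes> h) = s \<otimes> ((t \<otimes> x) \<otimes> h)" using s(1) t(1) xc hh by (simp add: m_assoc)
        then show "e = s \<otimes> t \<otimes> (x \<otimes> h)" using t hh s by metis
      qed (use xc hh s(1) t(1) in auto)
      moreover have "r_cell S x = r_cell S (x \<otimes> h)"
      proof (rule r_cell_eqI[where s=h and t=r])
        show "x = x \<otimes> h \<otimes> r" using r xc hh xe by (metis m_assoc)
      qed (use xc hh r(1) in auto)
      ultimately show "x \<otimes> h \<in> l_cell S e \<and> r_cell S (x \<otimes> h) = r_cell S x" by simp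
    qed
  qed
qed

text \<open>The left cell of \<open>e\<close> is the disjoint union of its H-cells, one for each right cell that
  it meets.\<close>

theorem card_l_cell:
  assumes "e \<in> carrier S" "e \<otimes> e = e"
  shows "card (l_cell S e) = num_r_cells S e * card (h_cell S e)"
proof -
  have "card (l_cell S e) = (\<Sum>c\<in>r_cell S ` l_cell S e. card {y \<in> l_cell S e. r_cell S y = c})"
    using sum.group[of "l_cell S e" "r_cell S ` l_cell S e" "r_cell S" "\<lambda>_. 1::nat"] by simp
  also have "\<dots> = (\<Sum>c\<in>r_cell S ` l_cell S e. card (h_cell S e))"
  proof (rule sum.cong[OF refl], elim imageE)
    fix c x assume "c = r_cell S x" "x \<in> l_cell S e"
    then show "card {y \<in> l_cell S e. r_cell S y = c} = card (h_cell S e)"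
      using bij_betw_same_card[OF h_cell_fibre_bij[OF assms]] by simp
  qed
  finally show ?thesis by (simp add: num_r_cells_def)
qed

lemma cell_ratio:
  assumes "e \<in> carrier S" "e \<otimes> e = e"
  shows "real (card (l_cell S e)) / real (card (h_cell S e)) = real (num_r_cells S e)"
  using card_l_cell[OF assms] card_h_cell_pos[OF assms(1)] by (auto simp del: card_0_eq)

text \<open>Right multiplication by \<open>p\<close> carries the left cell of \<open>p q\<close> into that of \<open>q p\<close> and stays
  in the same right cell, because multiplication by \<open>q\<close> brings every element back.\<close>

lemma num_r_cells_le_conjugate:
  assumes c: "p \<in> carrier S" "q \<in> carrier S" and "p \<otimes> q = e" "q \<otimes> p = e'"
    and "e \<otimes> e = e" and ee': "e' \<otimes> e' = e'"
  shows "num_r_cells S e \<le> num_r_cells S e'"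
proof -
  have e: "e \<in> carrier S" and e': "e' \<in> carrier S" using assms by auto
  have "r_cell S ` l_cell S e \<subseteq> r_cell S ` l_cell S e'"
  proof clarify
    fix u assume u: "u \<in> l_cell S e"
    then obtain t where t: "u \<in> carrier S" "t \<in> carrier S" "e = t \<otimes> u" by (auto elim: l_cellD)
    have ue: "u \<otimes> e = u" using l_cell_idem e u assms by auto
    have upq: "u \<otimes> p \<otimes> q = u" using ue assms t by (simp add: m_assoc)
    have "u \<otimes> p \<in> l_cell S e'"
    proof (rule l_cellI[where s="u \<otimes> p" and t="q \<otimes> t"])
      show "u \<otimes> p = u \<otimes> p \<otimes> e'" using upq assms t by (metis m_assoc m_closed)
      have "q \<otimes> t \<otimes> (u \<otimes> p) = q \<otimes> (t \<otimes> u) \<otimes> p" using t c by (simp add: m_assoc)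
      also have "\<dots> = q \<otimes> p \<otimes> (q \<otimes> p)" using t(3) assms(3) c by (metis m_assoc m_closed)
      finally show "e' = q \<otimes> t \<otimes> (u \<otimes> p)" using assms(4) ee' by simp
    qed (use t(1,2) c in auto)
    moreover have "r_cell S u = r_cell S (u \<otimes> p)"
      by (rule r_cell_eqI[where s=p and t=q]) (use t c upq in auto)
    ultimately show "r_cell S u \<in> r_cell S ` l_cell S e'" by auto
  qed
  then show ?thesis unfolding num_r_cells_def by (intro card_mono) auto
qed

lemma num_r_cells_conjugate:
  assumes "p \<in> carrier S" "q \<in> carrier S" and "p \<otimes> q = e" "q \<otimes> p = e'"
    and "e \<otimes> e = e" "e' \<otimes> e' = e'"
  shows "num_r_cells S e = num_r_cells S e'"
  using num_r_cells_le_conjugate assms by (metis le_antisym)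

end

text \<open>Rees factors of a submonoid and of the whole monoid live on different classes of
  elements, so an embedding is needed rather than an inclusion.\<close>

locale monoid_embedding = T: fin_monoid T + S: fin_monoid S
  for T :: "'t monoid" and S :: "'s monoid" +
  fixes \<phi> :: "'t \<Rightarrow> 's"
  assumes hom_closed: "t \<in> carrier T \<Longrightarrow> \<phi> t \<in> carrier S"
    and hom_mult: "t \<in> carrier T \<Longrightarrow> u \<in> carrier T \<Longrightarrow> \<phi> (t \<otimes>\<^bsub>T\<^esub> u) = \<phi> t \<otimes>\<^bsub>S\<^esub> \<phi> u"
    and hom_one: "\<phi> \<one>\<^bsub>T\<^esub> = \<one>\<^bsub>S\<^esub>"
    and inj: "inj_on \<phi> (carrier T)"
begin

lemma hom_l_cell: "x \<in> l_cell T e \<Longrightarrow> \<phi> x \<in> l_cell S (\<phi> e)" if "e \<in> carrier T"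
  by (elim l_cellD) (metis l_cellI hom_closed hom_mult that)

text \<open>If \<open>t u = e\<close> then \<open>u t u = u\<close>, so \<open>v = u s\<close> with \<open>s\<close> in the large monoid gives \<open>v = u (t
  v)\<close> with \<open>t v\<close> in the small one.\<close>

lemma r_cell_regular_iff:
  assumes e: "e \<in> carrier T" "e \<otimes>\<^bsub>T\<^esub> e = e" and x: "x \<in> l_cell T e" and y: "y \<in> l_cell T e"
  shows "r_cell S (\<phi> x) = r_cell S (\<phi> y) \<longleftrightarrow> r_cell T x = r_cell T y"
proof -
  have c: "x \<in> carrier T" "y \<in> carrier T" using x y by (auto elim: l_cellD)
  have key: "le_r T u v" if u: "u \<in> l_cell T e" "v \<in> carrier T" and uv: "le_r S (\<phi> u) (\<phi> v)" for u v
  proof -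
    obtain t where t: "t \<in> carrier T" "e = t \<otimes>\<^bsub>T\<^esub> u" "u \<in> carrier T" using u by (auto elim: l_cellD)
    have utu: "u \<otimes>\<^bsub>T\<^esub> t \<otimes>\<^bsub>T\<^esub> u = u"
      using T.l_cell_idem[OF e u(1)] t by (simp add: T.m_assoc)
    obtain s where s: "s \<in> carrier S" "\<phi> v = \<phi> u \<otimes>\<^bsub>S\<^esub> s" using uv unfolding le_r_def by blast
    have "\<phi> (u \<otimes>\<^bsub>T\<^esub> (t \<otimes>\<^bsub>T\<^esub> v)) = \<phi> (u \<otimes>\<^bsub>T\<^esub> t \<otimes>\<^bsub>T\<^esub> u) \<otimes>\<^bsub>S\<^esub> s"
      using t u s by (simp add: hom_mult hom_closed S.m_assoc)
    then have "\<phi> (u \<otimes>\<^bsub>T\<^esub> (t \<otimes>\<^bsub>T\<^esub> v)) = \<phi> v" using utu s by simp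
    then have "v = u \<otimes>\<^bsub>T\<^esub> (t \<otimes>\<^bsub>T\<^esub> v)" using inj t u by (auto simp: inj_on_def)
    then show ?thesis unfolding le_r_def using t u by blast
  qed
  have "le_r S (\<phi> u) (\<phi> v)" if "u \<in> carrier T" "le_r T u v" for u v
    using that unfolding le_r_def by (metis hom_closed hom_mult)
  then show ?thesis
    using key x y c by (auto simp: T.r_cell_eq_iff S.r_cell_eq_iff hom_closed)
qed

theorem num_r_cells_mono:
  assumes e: "e \<in> carrier T" "e \<otimes>\<^bsub>T\<^esub> e = e"
  shows "num_r_cells T e \<le> num_r_cells S (\<phi> e)"
proof -
  have "card (r_cell T ` l_cell T e) \<le> card ((\<lambda>x. r_cell S (\<phi> x)) ` l_cell T e)"
    using r_cell_regular_iff[OF e] by (intro card_image_le_if_determined) auto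
  also have "\<dots> \<le> card (r_cell S ` l_cell S (\<phi> e))"
    using hom_l_cell[OF e(1)] by (intro card_mono) auto
  finally show ?thesis unfolding num_r_cells_def .
qed

lemma num_r_cells_eq:
  assumes e: "e \<in> carrier T" "e \<otimes>\<^bsub>T\<^esub> e = e"
    and meet: "\<And>u. u \<in> l_cell S (\<phi> e) \<Longrightarrow> \<exists>v\<in>l_cell T e. r_cell S (\<phi> v) = r_cell S u"
  shows "num_r_cells T e = num_r_cells S (\<phi> e)"
proof (rule antisym[OF num_r_cells_mono[OF e]])
  have "r_cell S ` l_cell S (\<phi> e) \<subseteq> (\<lambda>x. r_cell S (\<phi> x)) ` l_cell T e"
    using meet by (force simp: image_iff)
  then have "card (r_cell S ` l_cell S (\<phi> e)) \<le> card ((\<lambda>x. r_cell S (\<phi> x)) ` l_cell T e)"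
    by (intro card_mono) auto
  also have "\<dots> \<le> card (r_cell T ` l_cell T e)"
    using r_cell_regular_iff[OF e] by (intro card_image_le_if_determined) auto
  finally show "num_r_cells S (\<phi> e) \<le> num_r_cells T e" unfolding num_r_cells_def .
qed

end

section \<open>Representations on function spaces and faithfulness\<close>

lemma subspace_vec_iff:
  "VectorSpace.subspace class_ring W (module_vec TYPE('f::field) d) \<longleftrightarrow>
    W \<subseteq> carrier_vec d \<and> 0\<^sub>v d \<in> W \<and> (\<forall>u\<in>W. \<forall>v\<in>W. u + v \<in> W) \<and> (\<forall>a. \<forall>v\<in>W. a \<cdot>\<^sub>v v \<in> W)"
proof -
  have "vectorspace class_ring (module_vec TYPE('f) d)" by (rule vec_vs)
  moreover from this have "Module.module class_ring (module_vec TYPE('f) d)"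
    by (simp add: vectorspace_def)
  ultimately show ?thesis
    by (auto simp: VectorSpace.subspace_def submodule_def module_vec_simps)
qed

text \<open>Two distinct unit vectors cannot be multiples of one vector.\<close>

lemma dim_one_if_line:
  fixes v :: "'f::field vec"
  assumes v: "v \<in> carrier_vec d" and d: "d \<noteq> 0"
    and line: "carrier_vec d \<subseteq> range (\<lambda>a. a \<cdot>\<^sub>v v)"
  shows "d = 1"
proof (rule ccontr)
  assume "d \<noteq> 1"
  then have d2: "0 < d" "1 < d" using d by auto
  obtain a where a: "unit_vec d 0 = a \<cdot>\<^sub>v v" using line by (metis imageE subsetD unit_vec_carrier)
  obtain b where b: "unit_vec d 1 = b \<cdot>\<^sub>v v" using line by (metis imageE subsetD unit_vec_carrier)
  have "a * v $ 0 = 1" "a * v $ 1 = 0"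
    using arg_cong[OF a, of "\<lambda>w. w $ 0"] arg_cong[OF a, of "\<lambda>w. w $ 1"] d2 v by auto
  moreover have "b * v $ 1 = 1" using arg_cong[OF b, of "\<lambda>w. w $ 1"] d2 v by auto
  ultimately show False by auto
qed

lemma mat_eq_if_mult_vec_eq:
  fixes A :: "'f::field mat"
  assumes A: "A \<in> carrier_mat m d" and B: "B \<in> carrier_mat m d"
    and eq: "\<And>v. v \<in> carrier_vec d \<Longrightarrow> A *\<^sub>v v = B *\<^sub>v v"
  shows "A = B"
proof (rule eq_matI)
  fix i j assume ij: "i < dim_row B" "j < dim_col B"
  have "(A *\<^sub>v unit_vec d j) $ i = (B *\<^sub>v unit_vec d j) $ i" using eq by simp
  then show "A $$ (i, j) = B $$ (i, j)" using ij A B by auto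
qed (use A B in auto)

text \<open>The function with coordinate vector \<open>v\<close> with respect to the family \<open>\<beta>\<close>.\<close>

definition comb :: "nat \<Rightarrow> (nat \<Rightarrow> 's \<Rightarrow> 'f::field) \<Rightarrow> 'f vec \<Rightarrow> 's \<Rightarrow> 'f" where
  "comb d \<beta> v r = (\<Sum>j<d. v $ j * \<beta> j r)"

lemma comb_unit: "j < d \<Longrightarrow> comb d \<beta> (unit_vec d j) r = \<beta> j r"
  unfolding comb_def by (simp add: unit_vec_def if_distrib[of "\<lambda>x. x * _"] cong: if_cong)

lemma comb_smult: "v \<in> carrier_vec d \<Longrightarrow> comb d \<beta> (a \<cdot>\<^sub>v v) r = a * comb d \<beta> v r"
  unfolding comb_def by (simp add: sum_distrib_left mult.assoc)

lemma comb_diff: "v \<in> carrier_vec d \<Longrightarrow> w \<in> carrier_vec d \<Longrightarrow>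
    comb d \<beta> (v - w) r = comb d \<beta> v r - comb d \<beta> w r"
  unfolding comb_def by (simp add: sum_subtractf left_diff_distrib)

text \<open>A finite family of functions contains a basis of its span; the basis is enumerated so
  that coordinates are vectors.\<close>

lemma finite_family_basis:
  fixes G :: "('s \<Rightarrow> 'f::field) set"
  assumes "finite G"
  shows "\<exists>d \<beta>. \<beta> ` {..<d} \<subseteq> G \<and>
    (\<forall>v\<in>carrier_vec d. (\<forall>r. comb d \<beta> v r = 0) \<longrightarrow> v = 0\<^sub>v d) \<and>
    (\<forall>g\<in>G. \<exists>v\<in>carrier_vec d. \<forall>r. g r = comb d \<beta> v r)"
proof -
  interpret V: vector_space "\<lambda>(c::'f) (f::'s \<Rightarrow> 'f) r. c * f r"
    by unfold_locales (auto simp: fun_eq_iff algebra_simps)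
  obtain B where B: "B \<subseteq> G" "V.independent B" "G \<subseteq> V.span B"
    using V.maximal_independent_subset by blast
  have finB: "finite B" using B(1) assms finite_subset by blast
  obtain \<beta> where \<beta>: "bij_betw \<beta> {..<card B} B"
    using ex_bij_betw_nat_finite[OF finB] by (auto simp: atLeast0LessThan)
  have sum_B: "(\<Sum>b\<in>B. u b * b r) = (\<Sum>j<card B. u (\<beta> j) * \<beta> j r)" for u r
    using sum.reindex_bij_betw[OF \<beta>, of "\<lambda>b. u b * b r"] by simp
  have fun_sum: "(\<Sum>b\<in>B. (\<lambda>r. u b * b r)) = (\<lambda>r. \<Sum>b\<in>B. u b * b r)" for u :: "_ \<Rightarrow> 'f"
  proof -
    have "(\<Sum>b\<in>C. (\<lambda>r. u b * b r)) r = (\<Sum>b\<in>C. u b * b r)" for C r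
      by (induction C rule: infinite_finite_induct) auto
    then show ?thesis by (auto simp: fun_eq_iff)
  qed
  show ?thesis
  proof (intro exI conjI ballI impI)
    show "\<beta> ` {..<card B} \<subseteq> G" using \<beta> B(1) by (auto simp: bij_betw_def)
  next
    fix v :: "'f vec" assume v: "v \<in> carrier_vec (card B)" "\<forall>r. comb (card B) \<beta> v r = 0"
    define u where "u b = v $ inv_into {..<card B} \<beta> b" for b
    have u: "u (\<beta> j) = v $ j" if "j < card B" for j
      using \<beta> that unfolding u_def bij_betw_def by (simp add: inv_into_f_f)
    have "(\<Sum>b\<in>B. u b * b r) = comb (card B) \<beta> v r" for r
      unfolding sum_B comb_def by (rule sum.cong) (auto simp: u)
    then have "(\<Sum>b\<in>B. (\<lambda>r. u b * b r)) = 0" using v by (auto simp: fun_sum fun_eq_iff)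
    then have "u b = 0" if "b \<in> B" for b
      using V.independentD[OF B(2) finB order_refl, of u b] that by simp
    then have "v $ j = 0" if "j < card B" for j
      using u[OF that] \<beta> that by (metis bij_betwE lessThan_iff)
    then show "v = 0\<^sub>v (card B)" using v(1) by (auto intro!: eq_vecI)
  next
    fix g assume "g \<in> G"
    then have g: "g \<in> V.span B" using B by auto
    have "(\<lambda>r. \<Sum>b\<in>B. V.representation B g b * b r) = g"
      using V.sum_representation_eq[OF B(2) g finB order_refl] unfolding fun_sum .
    then have "g r = (\<Sum>j<card B. V.representation B g (\<beta> j) * \<beta> j r)" for r
      unfolding sum_B by (metis (no_types))
    then show "\<exists>v\<in>carrier_vec (card B). \<forall>r. g r = comb (card B) \<beta> v r"
      by (intro bexI[of _ "vec (card B) (\<lambda>j. V.representation B g (\<beta> j))"]) (auto simp: comb_def)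
  qed
qed

text \<open>Right translation of functions, which is a left action of the monoid; functions are kept
  zero outside the carrier so that they are determined by their values on it.\<close>

definition translate :: "'s monoid \<Rightarrow> 's \<Rightarrow> ('s \<Rightarrow> 'f) \<Rightarrow> 's \<Rightarrow> 'f::zero" where
  "translate S s g r = (if r \<in> carrier S then g (r \<otimes>\<^bsub>S\<^esub> s) else 0)"

text \<open>The matrices \<open>\<rho>\<close> describe the translation action on the span of \<open>G\<close> in the coordinates of
  the basis \<open>\<beta>\<close>, which consists of members of \<open>G\<close>.\<close>

definition realizes ::
  "'s monoid \<Rightarrow> ('s \<Rightarrow> 'f::field) set \<Rightarrow> nat \<Rightarrow> ('s \<Rightarrow> 'f mat) \<Rightarrow> (nat \<Rightarrow> 's \<Rightarrow> 'f) \<Rightarrow> bool" where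
  "realizes S G d \<rho> \<beta> \<longleftrightarrow> is_rep S d \<rho> \<and> (\<forall>j<d. \<beta> j \<in> G) \<and>
    (\<forall>v\<in>carrier_vec d. \<forall>w\<in>carrier_vec d.
      (\<forall>r\<in>carrier S. comb d \<beta> v r = comb d \<beta> w r) \<longrightarrow> v = w) \<and>
    (\<forall>g\<in>G. \<exists>v\<in>carrier_vec d. \<forall>r. g r = comb d \<beta> v r) \<and>
    (\<forall>s\<in>carrier S. \<forall>v\<in>carrier_vec d. \<forall>r\<in>carrier S.
      comb d \<beta> (\<rho> s *\<^sub>v v) r = comb d \<beta> v (r \<otimes>\<^bsub>S\<^esub> s))"

lemma (in fin_monoid) translation_rep:
  fixes G :: "('s \<Rightarrow> 'f::field) set"
  assumes G: "finite G" and supp: "\<And>g r. g \<in> G \<Longrightarrow> r \<notin> carrier S \<Longrightarrow> g r = 0"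
    and closed: "\<And>g s. g \<in> G \<Longrightarrow> s \<in> carrier S \<Longrightarrow> translate S s g \<in> G"
  shows "\<exists>d \<rho> \<beta>. realizes S G d \<rho> \<beta>"
proof -
  obtain d \<beta> where \<beta>G: "\<beta> ` {..<d} \<subseteq> G"
    and indep: "\<And>v. v \<in> carrier_vec d \<Longrightarrow> (\<forall>r. comb d \<beta> v r = 0) \<Longrightarrow> v = 0\<^sub>v d"
    and gen: "\<And>g. g \<in> G \<Longrightarrow> \<exists>v\<in>carrier_vec d. \<forall>r. g r = comb d \<beta> v r"
    using finite_family_basis[OF G] by metis
  have \<beta>: "\<beta> j \<in> G" if "j < d" for j using \<beta>G that by auto
  have inj: "v = w" if v: "v \<in> carrier_vec d" and w: "w \<in> carrier_vec d"
    and eq: "\<And>r. r \<in> carrier S \<Longrightarrow> comb d \<beta> v r = comb d \<beta> w r" for v w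
  proof -
    have "comb d \<beta> (v - w) r = 0" for r
    proof (cases "r \<in> carrier S")
      case True then show ?thesis using eq v w by (simp add: comb_diff)
    next
      case False then show ?thesis using supp \<beta> by (auto simp: comb_def intro: sum.neutral)
    qed
    then have "v - w = 0\<^sub>v d" using indep[of "v - w"] v w by auto
    then have "(v - w) $ i = 0" if "i < d" for i using that by simp
    then show ?thesis using v w by (intro eq_vecI) auto
  qed
  define col' where "col' s j = (SOME v. v \<in> carrier_vec d \<and> (\<forall>r. translate S s (\<beta> j) r = comb d \<beta> v r))" for s j
  have col': "col' s j \<in> carrier_vec d \<and> (\<forall>r. translate S s (\<beta> j) r = comb d \<beta> (col' s j) r)"
    if "s \<in> carrier S" "j < d" for s j
    unfolding col'_def by (rule someI_ex) (use gen[OF closed[OF \<beta>[OF that(2)] that(1)]] in blast)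
  define \<rho> where "\<rho> s = mat d d (\<lambda>(i, j). col' s j $ i)" for s
  have act: "comb d \<beta> (\<rho> s *\<^sub>v v) r = comb d \<beta> v (r \<otimes> s)"
    if s: "s \<in> carrier S" and v: "v \<in> carrier_vec d" and r: "r \<in> carrier S" for s v r
  proof -
    have "comb d \<beta> (\<rho> s *\<^sub>v v) r = (\<Sum>i<d. (\<Sum>j<d. col' s j $ i * v $ j) * \<beta> i r)"
      using v unfolding comb_def \<rho>_def
      by (intro sum.cong refl) (auto simp: scalar_prod_def row_def atLeast0LessThan)
    also have "\<dots> = (\<Sum>i<d. \<Sum>j<d. v $ j * (col' s j $ i * \<beta> i r))"
      by (simp add: sum_distrib_right sum_distrib_left algebra_simps)
    also have "\<dots> = (\<Sum>j<d. \<Sum>i<d. v $ j * (col' s j $ i * \<beta> i r))" by (rule sum.swap)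
    also have "\<dots> = (\<Sum>j<d. v $ j * comb d \<beta> (col' s j) r)"
      by (simp add: comb_def sum_distrib_left)
    also have "\<dots> = (\<Sum>j<d. v $ j * \<beta> j (r \<otimes> s))"
    proof (rule sum.cong)
      fix j assume "j \<in> {..<d}"
      then have "comb d \<beta> (col' s j) r = translate S s (\<beta> j) r" using col'[of s j] s by simp
      then show "v $ j * comb d \<beta> (col' s j) r = v $ j * \<beta> j (r \<otimes> s)"
        using r by (simp add: translate_def)
    qed simp
    finally show ?thesis by (simp add: comb_def)
  qed
  have carr: "\<rho> s \<in> carrier_mat d d" for s by (simp add: \<rho>_def)
  have "is_rep S d \<rho>" unfolding is_rep_def
  proof (intro conjI ballI)
    show "\<rho> \<one> = 1\<^sub>m d"
    proof (rule mat_eq_if_mult_vec_eq[OF carr one_carrier_mat])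
      fix v :: "'f vec" assume v: "v \<in> carrier_vec d"
      have "\<rho> \<one> *\<^sub>v v = v"
        by (rule inj) (use v carr act in \<open>auto intro: mult_mat_vec_carrier\<close>)
      then show "\<rho> \<one> *\<^sub>v v = 1\<^sub>m d *\<^sub>v v" using v by simp
    qed
    fix s t assume st: "s \<in> carrier S" "t \<in> carrier S"
    show "\<rho> (s \<otimes> t) = \<rho> s * \<rho> t"
    proof (rule mat_eq_if_mult_vec_eq[OF carr mult_carrier_mat[OF carr carr]])
      fix v :: "'f vec" assume v: "v \<in> carrier_vec d"
      have tv: "\<rho> t *\<^sub>v v \<in> carrier_vec d" by (rule mult_mat_vec_carrier[OF carr v])
      have "\<rho> (s \<otimes> t) *\<^sub>v v = \<rho> s *\<^sub>v (\<rho> t *\<^sub>v v)"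
      proof (rule inj)
        fix r assume r: "r \<in> carrier S"
        show "comb d \<beta> (\<rho> (s \<otimes> t) *\<^sub>v v) r = comb d \<beta> (\<rho> s *\<^sub>v (\<rho> t *\<^sub>v v)) r"
          using act[OF _ v r] act[OF st(1) tv r] act[OF st(2) v] st r by (simp add: m_assoc)
      qed (use v tv carr in \<open>auto intro: mult_mat_vec_carrier\<close>)
      then show "\<rho> (s \<otimes> t) *\<^sub>v v = \<rho> s * \<rho> t *\<^sub>v v"
        using v by (simp add: assoc_mult_mat_vec[OF carr carr])
    qed
  qed (use carr in auto)
  then have "realizes S G d \<rho> \<beta>"
    unfolding realizes_def by (intro conjI ballI allI impI) (simp_all add: \<beta> gen act inj)
  then show ?thesis by blast
qed

text \<open>The indicator functions of all subsets are mapped to one another by translations, and the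
  value at the identity of a translated indicator function recovers the translating element.\<close>

lemma (in fin_monoid) faithful_rep_exists:
  "\<exists>d (\<rho> :: 's \<Rightarrow> 'f::field mat). is_rep S d \<rho> \<and> inj_on \<rho> (carrier S)"
proof -
  define G :: "('s \<Rightarrow> 'f) set" where "G = (\<lambda>A r. if r \<in> A then 1 else 0) ` Pow (carrier S)"
  have 1: "finite G" unfolding G_def using fin by auto
  have 2: "g r = 0" if "g \<in> G" "r \<notin> carrier S" for g r using that by (auto simp: G_def)
  have 3: "translate S s g \<in> G" if gs: "g \<in> G" "s \<in> carrier S" for g s
  proof -
    obtain A where A: "A \<subseteq> carrier S" "g = (\<lambda>r. if r \<in> A then 1 else 0)" using gs by (auto simp: G_def)
    have "translate S s g = (\<lambda>r. if r \<in> {r \<in> carrier S. r \<otimes> s \<in> A} then 1 else 0)"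
      unfolding A by (auto simp: translate_def)
    then show ?thesis unfolding G_def by blast
  qed
  obtain d \<beta> and \<rho> :: "'s \<Rightarrow> 'f mat" where real: "realizes S G d \<rho> \<beta>"
    using translation_rep[of G] 1 2 3 by blast
  have rep: "is_rep S d \<rho>" using real by (simp add: realizes_def)
  have gen: "\<exists>v\<in>carrier_vec d. \<forall>r. g r = comb d \<beta> v r" if "g \<in> G" for g
    using real that by (simp add: realizes_def)
  have act: "comb d \<beta> (\<rho> s *\<^sub>v v) r = comb d \<beta> v (r \<otimes> s)"
    if "s \<in> carrier S" "v \<in> carrier_vec d" "r \<in> carrier S" for s v r
    using real that by (simp add: realizes_def)
  have "inj_on \<rho> (carrier S)"
  proof (rule inj_onI)
    fix s t assume st: "s \<in> carrier S" "t \<in> carrier S" "\<rho> s = \<rho> t"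
    have "(\<lambda>r. if r \<in> {s} then 1 else 0) \<in> G" unfolding G_def using st by blast
    then obtain v where v: "v \<in> carrier_vec d" "\<And>r. (if r \<in> {s} then 1 else 0) = comb d \<beta> v r"
      using gen by blast
    have "comb d \<beta> v s = comb d \<beta> v t"
      using act[OF st(1) v(1) one_closed] act[OF st(2) v(1) one_closed] st by simp
    then show "s = t" using v(2)[of s] v(2)[of t] by (auto split: if_splits)
  qed
  then show ?thesis using rep by blast
qed

text \<open>The minimal dimension for the large monoid is attained by some faithful representation,
  whose restriction is faithful.\<close>

theorem (in monoid_embedding) faith_mono: "faith (F :: 'f::field itself) T \<le> faith F S"
proof -
  let ?P = "\<lambda>d. \<exists>\<rho> :: 's \<Rightarrow> 'f mat. is_rep S d \<rho> \<and> inj_on \<rho> (carrier S)"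
  have "?P (faith F S)" unfolding faith_def
    by (rule LeastI_ex) (rule S.faithful_rep_exists)
  then obtain \<rho> :: "'s \<Rightarrow> 'f mat" where \<rho>: "is_rep S (faith F S) \<rho>" "inj_on \<rho> (carrier S)" by blast
  have "is_rep T (faith F S) (\<rho> \<circ> \<phi>)"
    using \<rho>(1) hom_closed hom_mult hom_one unfolding is_rep_def by simp
  moreover have "inj_on (\<rho> \<circ> \<phi>) (carrier T)"
    using inj \<rho>(2) hom_closed by (auto simp: inj_on_def)
  ultimately show ?thesis
    unfolding faith_def[of F T] by (intro Least_le) blast
qed

section \<open>The simple representation attached to a trivial representation\<close>

context fin_monoid
begin

lemma h_cell_idem_iff:
  assumes e: "e \<in> carrier S" "e \<otimes> e = e"
  shows "h \<in> h_cell S e \<longleftrightarrow> h \<in> carrier S \<and> e \<otimes> h = h \<and> h \<otimes> e = h \<and>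
    (\<exists>x\<in>carrier S. x \<otimes> h = e) \<and> (\<exists>y\<in>carrier S. h \<otimes> y = e)"
proof
  assume h: "h \<in> h_cell S e"
  obtain s x where s: "h \<in> carrier S" "s \<in> carrier S" "h = s \<otimes> e" and x: "x \<in> carrier S" "e = x \<otimes> h"
    using h unfolding h_cell_def by (blast elim: l_cellD)
  obtain t y where t: "t \<in> carrier S" "h = e \<otimes> t" and y: "y \<in> carrier S" "e = h \<otimes> y"
    using h unfolding h_cell_def by (auto elim: r_cellD)
  have "e \<otimes> h = h" using t e by (metis m_assoc)
  moreover have "h \<otimes> e = h" using s e by (metis m_assoc)
  ultimately show "h \<in> carrier S \<and> e \<otimes> h = h \<and> h \<otimes> e = h \<and>
    (\<exists>x\<in>carrier S. x \<otimes> h = e) \<and> (\<exists>y\<in>carrier S. h \<otimes> y = e)"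
    using s(1) x y by metis
next
  assume h: "h \<in> carrier S \<and> e \<otimes> h = h \<and> h \<otimes> e = h \<and>
    (\<exists>x\<in>carrier S. x \<otimes> h = e) \<and> (\<exists>y\<in>carrier S. h \<otimes> y = e)"
  then obtain x y where "x \<in> carrier S" "x \<otimes> h = e" "y \<in> carrier S" "h \<otimes> y = e" by blast
  with h show "h \<in> h_cell S e"
    unfolding h_cell_def by (metis IntI l_cellI r_cellI)
qed

text \<open>By finiteness a one-sided inverse in the local monoid \<open>e S e\<close> is two-sided:
  multiplication by an element with a one-sided inverse is injective, hence surjective, on \<open>e S
  e\<close>. So both factors of a unit are units.\<close>

lemma h_cell_mult_iff:
  assumes e: "e \<in> carrier S" "e \<otimes> e = e"
    and a: "a \<in> carrier S" "e \<otimes> a = a" "a \<otimes> e = a"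
    and b: "b \<in> carrier S" "e \<otimes> b = b" "b \<otimes> e = b"
  shows "a \<otimes> b \<in> h_cell S e \<longleftrightarrow> a \<in> h_cell S e \<and> b \<in> h_cell S e"
proof
  let ?C = "{z \<in> carrier S. e \<otimes> z = z \<and> z \<otimes> e = z}"
  have finC: "finite ?C" using fin by auto
  assume ab: "a \<otimes> b \<in> h_cell S e"
  obtain x y where x: "x \<in> carrier S" "x \<otimes> (a \<otimes> b) = e" and y: "y \<in> carrier S" "a \<otimes> b \<otimes> y = e"
    using ab unfolding h_cell_idem_iff[OF e] by auto
  have xa: "x \<otimes> a \<in> carrier S" "(x \<otimes> a) \<otimes> b = e" using x a b by (simp_all add: m_assoc)
  have yb: "b \<otimes> y \<in> carrier S" "a \<otimes> (b \<otimes> y) = e" using y a b by (simp_all add: m_assoc)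
  have "inj_on (\<lambda>z. b \<otimes> z) ?C"
  proof (rule inj_onI)
    fix z z' assume z: "z \<in> ?C" "z' \<in> ?C" "b \<otimes> z = b \<otimes> z'"
    then have "(x \<otimes> a) \<otimes> (b \<otimes> z) = (x \<otimes> a) \<otimes> (b \<otimes> z')" by simp
    then have "(x \<otimes> a) \<otimes> b \<otimes> z = (x \<otimes> a) \<otimes> b \<otimes> z'"
      using z m_assoc[OF xa(1) b(1)] by auto
    then show "z = z'" using z xa by simp
  qed
  moreover have "(\<lambda>z. b \<otimes> z) ` ?C \<subseteq> ?C"
    using b e by (auto simp: m_assoc) (metis m_assoc)
  ultimately have "e \<in> (\<lambda>z. b \<otimes> z) ` ?C"
    using endo_inj_surj[OF finC] e by blast
  then obtain z where z: "z \<in> carrier S" "b \<otimes> z = e" by auto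
  then have bH: "b \<in> h_cell S e" unfolding h_cell_idem_iff[OF e] using b xa by blast
  have "inj_on (\<lambda>z. z \<otimes> a) ?C"
  proof (rule inj_onI)
    fix z z' assume z: "z \<in> ?C" "z' \<in> ?C" "z \<otimes> a = z' \<otimes> a"
    then have "z \<otimes> (a \<otimes> (b \<otimes> y)) = z' \<otimes> (a \<otimes> (b \<otimes> y))"
      using yb(1) a by (metis (no_types, lifting) m_assoc mem_Collect_eq)
    then show "z = z'" using z yb by simp
  qed
  moreover have "(\<lambda>z. z \<otimes> a) ` ?C \<subseteq> ?C"
    using a e by (auto simp: m_assoc) (metis m_assoc)
  ultimately have "e \<in> (\<lambda>z. z \<otimes> a) ` ?C"
    using endo_inj_surj[OF finC] e by blast
  then obtain z' where z': "z' \<in> carrier S" "z' \<otimes> a = e" by auto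
  then have "a \<in> h_cell S e" unfolding h_cell_idem_iff[OF e] using a yb by blast
  with bH show "a \<in> h_cell S e \<and> b \<in> h_cell S e" by blast
next
  assume "a \<in> h_cell S e \<and> b \<in> h_cell S e"
  then obtain x y x' y' where x: "x \<in> carrier S" "x \<otimes> a = e" and y: "y \<in> carrier S" "a \<otimes> y = e"
    and x': "x' \<in> carrier S" "x' \<otimes> b = e" and y': "y' \<in> carrier S" "b \<otimes> y' = e"
    unfolding h_cell_idem_iff[OF e] by blast
  have "x \<otimes> (a \<otimes> b) = b" using m_assoc[OF x(1) a(1) b(1)] x b by simp
  then have 1: "(x' \<otimes> x) \<otimes> (a \<otimes> b) = e"
    using m_assoc[OF x'(1) x(1), of "a \<otimes> b"] x' a b by simp
  have "(a \<otimes> b) \<otimes> y' = a" using m_assoc[OF a(1) b(1) y'(1)] y' a by simp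
  then have 2: "(a \<otimes> b) \<otimes> (y' \<otimes> y) = e"
    using m_assoc[of "a \<otimes> b", OF _ y'(1) y(1)] y a b by simp
  have 3: "e \<otimes> (a \<otimes> b) = a \<otimes> b" "a \<otimes> b \<otimes> e = a \<otimes> b"
    using a b e by (metis m_assoc, metis m_assoc)
  show "a \<otimes> b \<in> h_cell S e" unfolding h_cell_idem_iff[OF e]
    using 1 2 3 a b m_closed[OF x'(1) x(1)] m_closed[OF y'(1) y(1)] m_closed[OF a(1) b(1)] by blast
qed

end

lemma zero_mult_mat_vec: "v \<in> carrier_vec d \<Longrightarrow> 0\<^sub>m m d *\<^sub>v v = (0\<^sub>v m :: 'f::field vec)"
  by (intro eq_vecI) auto

lemma vec_one_smult: "(v :: 'f::field vec) \<in> carrier_vec 1 \<Longrightarrow> v = v $ 0 \<cdot>\<^sub>v unit_vec 1 0"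
  by (intro eq_vecI) auto

lemma trivial_rep_simple:
  "simple_rep G 1 (\<lambda>_. 1\<^sub>m 1 :: 'f::field mat)"
  unfolding simple_rep_def
proof (intro conjI allI impI)
  show "is_rep G 1 (\<lambda>_. 1\<^sub>m 1 :: 'f mat)" unfolding is_rep_def by auto
  fix W :: "'f vec set"
  assume "VectorSpace.subspace class_ring W (module_vec TYPE('f) 1) \<and>
    (\<forall>s\<in>carrier G. \<forall>w\<in>W. (1\<^sub>m 1 :: 'f mat) *\<^sub>v w \<in> W)"
  then have W: "W \<subseteq> carrier_vec 1" "0\<^sub>v 1 \<in> W" "\<And>a v. v \<in> W \<Longrightarrow> a \<cdot>\<^sub>v v \<in> W"
    unfolding subspace_vec_iff by auto
  show "W = {0\<^sub>v 1} \<or> W = carrier_vec 1"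
  proof (cases "W = {0\<^sub>v 1}")
    case False
    then obtain w where w: "w \<in> W" "w \<noteq> 0\<^sub>v 1" using W by blast
    have wc: "w \<in> carrier_vec 1" using w W by auto
    have "w $ 0 \<noteq> 0" using w vec_one_smult[OF wc] by force
    have "v \<in> W" if v: "v \<in> carrier_vec 1" for v
    proof -
      have "v = (v $ 0 / w $ 0) \<cdot>\<^sub>v w"
        using v wc \<open>w $ 0 \<noteq> 0\<close> by (intro eq_vecI) auto
      then show ?thesis using W(3)[OF w(1)] by metis
    qed
    then show ?thesis using W by auto
  qed simp
qed simp

text \<open>Consider the functions \<open>f s\<close> on the monoid given by \<open>f s r = 1\<close> if \<open>e r s e\<close> lies in
  \<open>H(e)\<close> and \<open>0\<close> otherwise. Translation by \<open>s\<close> maps \<open>f t\<close> to \<open>f (s t)\<close>, so their span \<open>L\<close> is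
  generated by \<open>f e\<close>. A product of two elements of \<open>e S e\<close> lies in \<open>H(e)\<close> if and only if both
  factors do; hence translation by \<open>e r\<close> sends each \<open>w\<close> in \<open>L\<close> to the multiple \<open>w r\<close> of \<open>f e\<close>. As
  some value \<open>w r\<close> is nonzero when \<open>w\<close> is, every nonzero subrepresentation contains the
  generator. So \<open>L\<close> is simple, and \<open>e L\<close> is the line through \<open>f e\<close>, fixed by \<open>H(e)\<close>.\<close>

theorem (in fin_monoid) L_trivial_exists:
  assumes e: "e \<in> carrier S" "e \<otimes> e = e"
  shows "\<exists>d (\<rho> :: 's \<Rightarrow> 'f::field mat). is_L_V S e 1 (\<lambda>_. 1\<^sub>m 1) d \<rho>"
proof -
  define f :: "'s \<Rightarrow> 's \<Rightarrow> 'f" where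
    "f s r = (if r \<in> carrier S \<and> e \<otimes> r \<otimes> s \<otimes> e \<in> h_cell S e then 1 else 0)" for s r
  have tr: "translate S s (f t) = f (s \<otimes> t)" if "s \<in> carrier S" "t \<in> carrier S" for s t
    unfolding translate_def f_def using that e by (auto simp: fun_eq_iff m_assoc)
  have "\<exists>d \<rho> \<beta>. realizes S (f ` carrier S) d \<rho> \<beta>"
  proof (rule translation_rep)
    show "finite (f ` carrier S)" using fin by simp
    show "g r = 0" if "g \<in> f ` carrier S" "r \<notin> carrier S" for g r using that by (auto simp: f_def)
    show "translate S s g \<in> f ` carrier S" if "g \<in> f ` carrier S" "s \<in> carrier S" for g s
      using that tr by auto
  qed
  then obtain d \<rho> \<beta> where R: "realizes S (f ` carrier S) d \<rho> \<beta>" by blast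
  have rep: "is_rep S d \<rho>" and \<beta>: "\<And>j. j < d \<Longrightarrow> \<exists>s\<in>carrier S. \<beta> j = f s"
    and gen: "\<And>s. s \<in> carrier S \<Longrightarrow> \<exists>v\<in>carrier_vec d. \<forall>r. f s r = comb d \<beta> v r"
    using R by (auto simp: realizes_def)
  have inj: "v = w" if "v \<in> carrier_vec d" "w \<in> carrier_vec d"
    "\<And>r. r \<in> carrier S \<Longrightarrow> comb d \<beta> v r = comb d \<beta> w r" for v w
    using R that by (simp add: realizes_def)
  have act: "comb d \<beta> (\<rho> s *\<^sub>v v) r = comb d \<beta> v (r \<otimes> s)"
    if "s \<in> carrier S" "v \<in> carrier_vec d" "r \<in> carrier S" for s v r
    using R that by (simp add: realizes_def)
  have carr: "\<rho> s \<in> carrier_mat d d" if "s \<in> carrier S" for s using rep that by (simp add: is_rep_def)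
  have carrv: "\<rho> s *\<^sub>v v \<in> carrier_vec d" if "s \<in> carrier S" "v \<in> carrier_vec d" for s v
    using mult_mat_vec_carrier carr that by blast
  obtain u where u: "u \<in> carrier_vec d" "\<And>r. comb d \<beta> u r = f e r" using gen e(1) by metis
  have su: "comb d \<beta> (\<rho> s *\<^sub>v u) r = f s r" if "s \<in> carrier S" "r \<in> carrier S" for s r
    using that act[OF that(1) u(1) that(2)] u(2) e by (simp add: f_def m_assoc)
  have ee: "e \<in> h_cell S e" using self_h_cell e by simp
  have eel: "e \<otimes> (e \<otimes> x) = e \<otimes> x" if "x \<in> carrier S" for x
    using that e by (metis m_assoc)
  have fmult: "f s (r' \<otimes> (e \<otimes> r)) = f e r' * f s r"
    if c: "s \<in> carrier S" "r \<in> carrier S" "r' \<in> carrier S" for s r r'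
  proof -
    have eq: "e \<otimes> (r' \<otimes> (e \<otimes> r)) \<otimes> s \<otimes> e = (e \<otimes> r' \<otimes> e \<otimes> e) \<otimes> (e \<otimes> r \<otimes> s \<otimes> e)"
    proof -
      have "(e \<otimes> r' \<otimes> e \<otimes> e) \<otimes> (e \<otimes> r \<otimes> s \<otimes> e) = e \<otimes> r' \<otimes> (e \<otimes> e \<otimes> e) \<otimes> r \<otimes> s \<otimes> e"
        using c e(1) by (simp add: m_assoc)
      then show ?thesis using c e by (simp add: m_assoc)
    qed
    have "e \<otimes> (e \<otimes> r' \<otimes> e \<otimes> e) = e \<otimes> r' \<otimes> e \<otimes> e" "e \<otimes> r' \<otimes> e \<otimes> e \<otimes> e = e \<otimes> r' \<otimes> e \<otimes> e"
      "e \<otimes> (e \<otimes> r \<otimes> s \<otimes> e) = e \<otimes> r \<otimes> s \<otimes> e" "e \<otimes> r \<otimes> s \<otimes> e \<otimes> e = e \<otimes> r \<otimes> s \<otimes> e"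
      using c e eel by (simp_all add: m_assoc)
    then have "(e \<otimes> r' \<otimes> e \<otimes> e) \<otimes> (e \<otimes> r \<otimes> s \<otimes> e) \<in> h_cell S e \<longleftrightarrow>
      e \<otimes> r' \<otimes> e \<otimes> e \<in> h_cell S e \<and> e \<otimes> r \<otimes> s \<otimes> e \<in> h_cell S e"
      using c e by (intro h_cell_mult_iff) auto
    then show ?thesis unfolding f_def eq using c e(1) by auto
  qed
  (* Translation by e r is the functional 'value at r' followed by the generator u. *)
  have ker: "\<rho> (e \<otimes> r) *\<^sub>v w = comb d \<beta> w r \<cdot>\<^sub>v u" if w: "w \<in> carrier_vec d" and r: "r \<in> carrier S" for w r
  proof (rule inj)
    fix r' assume r': "r' \<in> carrier S"
    have "comb d \<beta> (\<rho> (e \<otimes> r) *\<^sub>v w) r' = comb d \<beta> w (r' \<otimes> (e \<otimes> r))"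
      using act w r r' e by simp
    also have "\<dots> = (\<Sum>j<d. w $ j * (f e r' * \<beta> j r))"
      unfolding comb_def using \<beta> fmult r r' by (intro sum.cong refl) (metis lessThan_iff)
    also have "\<dots> = comb d \<beta> w r * f e r'"
      by (simp add: comb_def sum_distrib_left sum_distrib_right algebra_simps)
    finally show "comb d \<beta> (\<rho> (e \<otimes> r) *\<^sub>v w) r' = comb d \<beta> (comb d \<beta> w r \<cdot>\<^sub>v u) r'"
      using u by (simp add: comb_smult)
  qed (use u w r e carrv in auto)
  have \<rho>e: "\<rho> e *\<^sub>v w = comb d \<beta> w \<one> \<cdot>\<^sub>v u" if "w \<in> carrier_vec d" for w
    using ker[OF that one_closed] e by simp
  have "comb d \<beta> u \<one> = 1" using u(2)[of \<one>] ee e by (simp add: f_def)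
  then have u0: "u \<noteq> 0\<^sub>v d" by (auto simp: comb_def)
  have \<rho>eu: "\<rho> e *\<^sub>v u = u" using \<rho>e[OF u(1)] \<open>comb d \<beta> u \<one> = 1\<close> u(1) by simp
  have simple: "simple_rep S d \<rho>" unfolding simple_rep_def
  proof (intro conjI allI impI)
    show "d \<noteq> 0" using u u0 by auto
    fix W assume "VectorSpace.subspace class_ring W (module_vec TYPE('f) d) \<and>
      (\<forall>s\<in>carrier S. \<forall>w\<in>W. \<rho> s *\<^sub>v w \<in> W)"
    then have W: "W \<subseteq> carrier_vec d" "0\<^sub>v d \<in> W" "\<And>a v. v \<in> W \<Longrightarrow> a \<cdot>\<^sub>v v \<in> W"
      "\<And>v w. v \<in> W \<Longrightarrow> w \<in> W \<Longrightarrow> v + w \<in> W" and inv: "\<And>s w. s \<in> carrier S \<Longrightarrow> w \<in> W \<Longrightarrow> \<rho> s *\<^sub>v w \<in> W"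
      unfolding subspace_vec_iff by auto
    show "W = {0\<^sub>v d} \<or> W = carrier_vec d"
    proof (cases "W = {0\<^sub>v d}")
      case False
      then obtain w where w: "w \<in> W" "w \<noteq> 0\<^sub>v d" using W by blast
      have wc: "w \<in> carrier_vec d" using w W by auto
      obtain r where r: "r \<in> carrier S" "comb d \<beta> w r \<noteq> 0"
        using inj[OF wc zero_carrier_vec] w(2) by (auto simp: comb_def)
      let ?c = "comb d \<beta> w r"
      have "?c \<cdot>\<^sub>v u \<in> W" using inv[OF _ w(1), of "e \<otimes> r"] ker[OF wc r(1)] e r by simp
      then have "(1 / ?c) \<cdot>\<^sub>v (?c \<cdot>\<^sub>v u) \<in> W" by (rule W(3))
      then have uW: "u \<in> W" using r(2) by (simp add: smult_smult_assoc)
      have unitW: "unit_vec d j \<in> W" if j: "j < d" for j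
      proof -
        obtain s where s: "s \<in> carrier S" "\<beta> j = f s" using \<beta>[OF j] by auto
        have "unit_vec d j = \<rho> s *\<^sub>v u"
          by (rule inj) (use s su j u carrv comb_unit[OF j, of \<beta>] in auto)
        then show ?thesis using inv[OF s(1) uW] by simp
      qed
      have "x \<in> W" if x: "x \<in> carrier_vec d" for x
      proof -
        have "vec d (\<lambda>i. if i < k then x $ i else 0) \<in> W" if "k \<le> d" for k using that
        proof (induction k)
          case 0
          have "vec d (\<lambda>i. if i < 0 then x $ i else 0) = 0\<^sub>v d" by (intro eq_vecI) auto
          then show ?case using W by simp
        next
          case (Suc k)
          have "vec d (\<lambda>i. if i < Suc k then x $ i else 0) =
            vec d (\<lambda>i. if i < k then x $ i else 0) + x $ k \<cdot>\<^sub>v unit_vec d k"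
            using Suc.prems by (intro eq_vecI) (auto simp: less_Suc_eq)
          then show ?case using Suc W(3)[OF unitW] W(4) by simp
        qed
        moreover have "vec d (\<lambda>i. if i < d then x $ i else 0) = x" using x by (intro eq_vecI) auto
        ultimately show ?thesis by (metis order_refl)
      qed
      then show ?thesis using W by auto
    qed simp
  qed (rule rep)
  have apex: "has_apex S d \<rho> e" unfolding has_apex_def
  proof (intro conjI ballI impI)
    show "\<rho> e \<noteq> 0\<^sub>m d d" using \<rho>eu u0 u(1) zero_mult_mat_vec by metis
    fix s assume s: "s \<in> carrier S" "\<not> le_lr S s e"
    have z: "f t (r \<otimes> s) = 0" if c: "t \<in> carrier S" "r \<in> carrier S" for t r
    proof (rule ccontr)
      assume "f t (r \<otimes> s) \<noteq> 0"
      then have "e \<otimes> (r \<otimes> s) \<otimes> t \<otimes> e \<in> h_cell S e" by (auto simp: f_def split: if_splits)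
      then obtain x where x: "x \<in> carrier S" "x \<otimes> (e \<otimes> (r \<otimes> s) \<otimes> t \<otimes> e) = e"
        unfolding h_cell_idem_iff[OF e] by auto
      have "e = (x \<otimes> e \<otimes> r) \<otimes> s \<otimes> (t \<otimes> e)"
        using x c s(1) e(1) by (simp add: m_assoc)
      then show False using s(2) x c e(1) unfolding le_lr_def by (metis m_closed)
    qed
    show "\<rho> s = 0\<^sub>m d d"
    proof (rule mat_eq_if_mult_vec_eq[OF carr[OF s(1)] zero_carrier_mat])
      fix v :: "'f vec" assume v: "v \<in> carrier_vec d"
      have "\<rho> s *\<^sub>v v = 0\<^sub>v d"
      proof (rule inj)
        fix r assume r: "r \<in> carrier S"
        have "\<beta> j (r \<otimes> s) = 0" if "j < d" for j using \<beta>[OF that] z r by auto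
        then show "comb d \<beta> (\<rho> s *\<^sub>v v) r = comb d \<beta> (0\<^sub>v d) r"
          using act[OF s(1) v r] by (simp add: comb_def)
      qed (use carrv s v in auto)
      then show "\<rho> s *\<^sub>v v = 0\<^sub>m d d *\<^sub>v v" using v by (simp add: zero_mult_mat_vec)
    qed
  qed
  define A where "A = mat d 1 (\<lambda>(i, j). u $ i)"
  have A: "A \<in> carrier_mat d 1" by (simp add: A_def)
  have Av: "A *\<^sub>v v = v $ 0 \<cdot>\<^sub>v u" if "v \<in> carrier_vec 1" for v
    using that u(1) by (intro eq_vecI) (auto simp: A_def scalar_prod_def)
  have "bij_betw (\<lambda>v. A *\<^sub>v v) (carrier_vec 1) ((\<lambda>w. \<rho> e *\<^sub>v w) ` carrier_vec d)"
    unfolding bij_betw_def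
  proof
    show "inj_on (\<lambda>v. A *\<^sub>v v) (carrier_vec 1)"
    proof (rule inj_onI)
      fix v w :: "'f vec" assume vw: "v \<in> carrier_vec 1" "w \<in> carrier_vec 1" "A *\<^sub>v v = A *\<^sub>v w"
      have "comb d \<beta> (A *\<^sub>v v) \<one> = v $ 0" "comb d \<beta> (A *\<^sub>v w) \<one> = w $ 0"
        using \<open>comb d \<beta> u \<one> = 1\<close>
        by (simp_all add: Av[OF vw(1)] Av[OF vw(2)] comb_smult[OF u(1)])
      then have "v $ 0 = w $ 0" using vw by simp
      then show "v = w" using vw by (intro eq_vecI) auto
    qed
    show "(\<lambda>v. A *\<^sub>v v) ` carrier_vec 1 = (\<lambda>w. \<rho> e *\<^sub>v w) ` carrier_vec d"
    proof
      show "(\<lambda>v. A *\<^sub>v v) ` carrier_vec 1 \<subseteq> (\<lambda>w. \<rho> e *\<^sub>v w) ` carrier_vec d"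
      proof
        fix y assume "y \<in> (\<lambda>v. A *\<^sub>v v) ` carrier_vec 1"
        then obtain a where y: "y = a \<cdot>\<^sub>v u" using Av by blast
        have "\<rho> e *\<^sub>v (a \<cdot>\<^sub>v u) = a \<cdot>\<^sub>v u"
          using \<rho>eu mult_mat_vec[OF carr[OF e(1)] u(1)] by simp
        then show "y \<in> (\<lambda>w. \<rho> e *\<^sub>v w) ` carrier_vec d"
          using y u(1) by (metis imageI smult_carrier_vec)
      qed
      show "(\<lambda>w. \<rho> e *\<^sub>v w) ` carrier_vec d \<subseteq> (\<lambda>v. A *\<^sub>v v) ` carrier_vec 1"
      proof clarify
        fix w :: "'f vec" assume "w \<in> carrier_vec d"
        then have "\<rho> e *\<^sub>v w = A *\<^sub>v (vec 1 (\<lambda>_. comb d \<beta> w \<one>))" using \<rho>e Av by simp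
        then show "\<rho> e *\<^sub>v w \<in> (\<lambda>v. A *\<^sub>v v) ` carrier_vec 1" by (metis imageI vec_carrier)
      qed
    qed
  qed
  moreover have "\<rho> h * A = A * 1\<^sub>m 1" if h: "h \<in> h_cell S e" for h
  proof -
    have hc: "h \<in> carrier S" "e \<otimes> h = h" "h \<otimes> e = h" using h h_cell_idem_iff[OF e] by auto
    have "\<rho> h *\<^sub>v u = u"
    proof (rule inj)
      fix r assume r: "r \<in> carrier S"
      have "(e \<otimes> r \<otimes> e) \<otimes> h \<in> h_cell S e \<longleftrightarrow> e \<otimes> r \<otimes> e \<in> h_cell S e \<and> h \<in> h_cell S e"
        using hc r e eel by (intro h_cell_mult_iff) (simp_all add: m_assoc)
      moreover have "(e \<otimes> r \<otimes> e) \<otimes> h = e \<otimes> r \<otimes> h \<otimes> e" "e \<otimes> r \<otimes> e \<otimes> e = e \<otimes> r \<otimes> e"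
        using hc r e by (simp_all add: m_assoc)
      ultimately have "f h r = f e r" using h by (auto simp: f_def)
      then show "comb d \<beta> (\<rho> h *\<^sub>v u) r = comb d \<beta> u r" using su[OF hc(1) r] u(2) by simp
    qed (use u carrv hc in auto)
    then have "\<rho> h *\<^sub>v (A *\<^sub>v v) = A *\<^sub>v v" if "v \<in> carrier_vec 1" for v
      using Av[OF that] mult_mat_vec[OF carr[OF hc(1)] u(1)] by simp
    then show ?thesis
      using A carr[OF hc(1)]
      by (intro mat_eq_if_mult_vec_eq[where m=d and d=1]) (auto simp: assoc_mult_mat_vec)
  qed
  ultimately have "is_L_V S e 1 (\<lambda>_. 1\<^sub>m 1) d \<rho>"
    unfolding is_L_V_def using e simple apex A trivial_rep_simple by blast
  then show ?thesis by blast
qed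

section \<open>The semisimple gap as a minimum over idempotents\<close>

lemma mult_mat_zero_vec: "A \<in> carrier_mat m d \<Longrightarrow> A *\<^sub>v 0\<^sub>v d = (0\<^sub>v m :: 'f::field vec)"
  by (intro eq_vecI) auto

lemma simple_rep_line_invariant:
  fixes \<rho> :: "'s \<Rightarrow> 'f::field mat"
  assumes simple: "simple_rep S d \<rho>" and v: "v \<in> carrier_vec d" "v \<noteq> 0\<^sub>v d"
    and inv: "\<And>s. s \<in> carrier S \<Longrightarrow> \<exists>c. \<rho> s *\<^sub>v v = c \<cdot>\<^sub>v v"
  shows "d = 1" and "carrier_vec d = range (\<lambda>a. a \<cdot>\<^sub>v v)"
proof -
  let ?W = "range (\<lambda>a. a \<cdot>\<^sub>v v)"
  have rep: "is_rep S d \<rho>" and d: "d \<noteq> 0" using simple by (auto simp: simple_rep_def)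
  have "VectorSpace.subspace class_ring ?W (module_vec TYPE('f) d)"
    unfolding subspace_vec_iff
  proof (intro conjI ballI allI)
    show "?W \<subseteq> carrier_vec d" using v by auto
    have "0\<^sub>v d = 0 \<cdot>\<^sub>v v" using v by (intro eq_vecI) auto
    then show "0\<^sub>v d \<in> ?W" by blast
    show "x + y \<in> ?W" if xy: "x \<in> ?W" "y \<in> ?W" for x y
    proof -
      obtain a b where "x = a \<cdot>\<^sub>v v" "y = b \<cdot>\<^sub>v v" using xy by auto
      then have "x + y = (a + b) \<cdot>\<^sub>v v" by (simp add: add_smult_distrib_vec)
      then show ?thesis by blast
    qed
    show "a \<cdot>\<^sub>v x \<in> ?W" if x: "x \<in> ?W" for a x
    proof -
      obtain b where "x = b \<cdot>\<^sub>v v" using x by auto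
      then have "a \<cdot>\<^sub>v x = (a * b) \<cdot>\<^sub>v v" by (simp add: smult_smult_assoc)
      then show ?thesis by blast
    qed
  qed
  moreover have "\<rho> s *\<^sub>v w \<in> ?W" if s: "s \<in> carrier S" and w: "w \<in> ?W" for s w
  proof -
    obtain a where a: "w = a \<cdot>\<^sub>v v" using w by auto
    obtain c where c: "\<rho> s *\<^sub>v v = c \<cdot>\<^sub>v v" using inv[OF s] by auto
    have "\<rho> s \<in> carrier_mat d d" using rep s by (simp add: is_rep_def)
    then have "\<rho> s *\<^sub>v w = (a * c) \<cdot>\<^sub>v v"
      using a c v mult_mat_vec by (simp add: mult_mat_vec smult_smult_assoc)
    then show ?thesis by blast
  qed
  ultimately have "?W = {0\<^sub>v d} \<or> ?W = carrier_vec d"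
    using simple unfolding simple_rep_def by blast
  moreover have "v \<in> ?W" by (rule range_eqI[of _ _ 1]) (use v in auto)
  ultimately show line: "carrier_vec d = ?W" using v by auto
  show "d = 1" by (rule dim_one_if_line[OF v(1) d]) (use line in auto)
qed

lemma rep_iso_if_eq:
  assumes "is_rep S d \<rho>" "\<And>s. s \<in> carrier S \<Longrightarrow> \<rho> s = \<sigma> s"
  shows "rep_iso S d \<rho> d \<sigma>"
  unfolding rep_iso_def
proof (rule bexI[of _ "1\<^sub>m d"], rule bexI[of _ "1\<^sub>m d"], intro conjI ballI)
  fix s assume "s \<in> carrier S"
  then have "\<rho> s \<in> carrier_mat d d" "\<sigma> s = \<rho> s" using assms by (auto simp: is_rep_def)
  then show "1\<^sub>m d * \<rho> s = \<sigma> s * 1\<^sub>m d" by simp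
qed auto

text \<open>Let \<open>v = e v\<close> be nonzero. The vectors \<open>x\<close> with \<open>e s x = 0\<close> for all \<open>s\<close> form a proper
  subrepresentation, so they vanish. Since \<open>e t (s v - v) = (e t s e) v - (e t e) v = 0\<close>, the
  vector \<open>v\<close> is fixed by the whole monoid and spans the simple representation.\<close>

lemma (in fin_monoid) simple_rep_at_zero_like_idempotent:
  fixes \<rho> :: "'s \<Rightarrow> 'f::field mat"
  assumes e: "e \<in> carrier S" and zero: "\<And>s. s \<in> carrier S \<Longrightarrow> e \<otimes> s \<otimes> e = e"
    and simple: "simple_rep S d \<rho>" and ne: "\<rho> e \<noteq> 0\<^sub>m d d"
  shows "rep_iso S d \<rho> 1 triv_t"
proof -
  have rep: "is_rep S d \<rho>" using simple by (auto simp: simple_rep_def)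
  have carr: "\<rho> s \<in> carrier_mat d d" if "s \<in> carrier S" for s using rep that by (simp add: is_rep_def)
  have mult: "\<rho> (s \<otimes> t) = \<rho> s * \<rho> t" if "s \<in> carrier S" "t \<in> carrier S" for s t
    using rep that by (simp add: is_rep_def)
  have multv: "\<rho> (s \<otimes> t) *\<^sub>v w = \<rho> s *\<^sub>v (\<rho> t *\<^sub>v w)"
    if "s \<in> carrier S" "t \<in> carrier S" "w \<in> carrier_vec d" for s t w
    using that by (simp add: mult assoc_mult_mat_vec[OF carr carr])
  have carrv: "\<rho> s *\<^sub>v w \<in> carrier_vec d" if "s \<in> carrier S" "w \<in> carrier_vec d" for s w
    using mult_mat_vec_carrier carr that by blast
  have ee: "e \<otimes> e = e" using zero[of \<one>] e by simp
  obtain w where w: "w \<in> carrier_vec d" "\<rho> e *\<^sub>v w \<noteq> 0\<^sub>v d"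
  proof (rule ccontr)
    assume "\<not> thesis"
    then have all: "\<And>w. w \<in> carrier_vec d \<Longrightarrow> \<rho> e *\<^sub>v w = 0\<^sub>v d" using that by blast
    have "\<rho> e = 0\<^sub>m d d"
    proof (rule mat_eq_if_mult_vec_eq[OF carr[OF e] zero_carrier_mat])
      fix v :: "'f vec" assume "v \<in> carrier_vec d"
      then show "\<rho> e *\<^sub>v v = 0\<^sub>m d d *\<^sub>v v" using all[of v] by (simp add: zero_mult_mat_vec)
    qed
    then show False using ne by simp
  qed
  define v where "v = \<rho> e *\<^sub>v w"
  have v: "v \<in> carrier_vec d" "v \<noteq> 0\<^sub>v d" "\<rho> e *\<^sub>v v = v"
    using w carrv[OF e w(1)] multv[OF e e w(1)] ee by (auto simp: v_def)
  (* The largest subrepresentation annihilated by e. *)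
  let ?N = "{x \<in> carrier_vec d. \<forall>s\<in>carrier S. \<rho> (e \<otimes> s) *\<^sub>v x = 0\<^sub>v d}"
  have es: "\<rho> (e \<otimes> s) \<in> carrier_mat d d" if "s \<in> carrier S" for s using carr e that by simp
  have "VectorSpace.subspace class_ring ?N (module_vec TYPE('f) d)"
    unfolding subspace_vec_iff
  proof (intro conjI ballI allI)
    show "0\<^sub>v d \<in> ?N" using es mult_mat_zero_vec by auto
    show "x + y \<in> ?N" if "x \<in> ?N" "y \<in> ?N" for x y
      using that by (auto simp: mult_add_distrib_mat_vec[OF es])
    show "a \<cdot>\<^sub>v x \<in> ?N" if "x \<in> ?N" for a x
      using that by (auto simp: mult_mat_vec[OF es] intro!: eq_vecI)
  qed auto
  moreover have "\<rho> s *\<^sub>v x \<in> ?N" if s: "s \<in> carrier S" and x: "x \<in> ?N" for s x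
  proof -
    have "\<rho> (e \<otimes> t) *\<^sub>v (\<rho> s *\<^sub>v x) = 0\<^sub>v d" if t: "t \<in> carrier S" for t
    proof -
      have "\<rho> (e \<otimes> t) *\<^sub>v (\<rho> s *\<^sub>v x) = \<rho> (e \<otimes> (t \<otimes> s)) *\<^sub>v x"
        using multv[of "e \<otimes> t" s x] s t e x by (simp add: m_assoc)
      then show ?thesis using x s t by simp
    qed
    then show ?thesis using carrv s x by auto
  qed
  ultimately have "?N = {0\<^sub>v d} \<or> ?N = carrier_vec d"
    using simple unfolding simple_rep_def by blast
  moreover have "v \<notin> ?N"
  proof
    assume "v \<in> ?N"
    then have "\<rho> (e \<otimes> \<one>) *\<^sub>v v = 0\<^sub>v d" using one_closed by blast
    then show False using v e by simp
  qed
  ultimately have N: "?N = {0\<^sub>v d}" using v(1) by blast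
  have fixv: "\<rho> s *\<^sub>v v = v" if s: "s \<in> carrier S" for s
  proof -
    have sv: "\<rho> s *\<^sub>v v \<in> carrier_vec d" using carrv s v by auto
    have "\<rho> (e \<otimes> t) *\<^sub>v (\<rho> s *\<^sub>v v - v) = 0\<^sub>v d" if t: "t \<in> carrier S" for t
    proof -
      have "\<rho> (e \<otimes> t) *\<^sub>v (\<rho> s *\<^sub>v v) = \<rho> (e \<otimes> t) *\<^sub>v (\<rho> (s \<otimes> e) *\<^sub>v v)"
        using multv[OF s e v(1)] v(3) by simp
      also have "\<dots> = \<rho> (e \<otimes> (t \<otimes> s) \<otimes> e) *\<^sub>v v"
        using multv[of "e \<otimes> t" "s \<otimes> e" v] s t e v by (simp add: m_assoc)
      also have "\<dots> = v" using zero[of "t \<otimes> s"] s t v by simp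
      finally have 1: "\<rho> (e \<otimes> t) *\<^sub>v (\<rho> s *\<^sub>v v) = v" .
      have "\<rho> (e \<otimes> t) *\<^sub>v v = \<rho> (e \<otimes> t) *\<^sub>v (\<rho> e *\<^sub>v v)" using v by simp
      also have "\<dots> = \<rho> (e \<otimes> t \<otimes> e) *\<^sub>v v" using multv[of "e \<otimes> t" e v] t e v by simp
      also have "\<dots> = v" using zero[of t] t v by simp
      finally have 2: "\<rho> (e \<otimes> t) *\<^sub>v v = v" .
      have "\<rho> (e \<otimes> t) *\<^sub>v (\<rho> s *\<^sub>v v - v) = \<rho> (e \<otimes> t) *\<^sub>v (\<rho> s *\<^sub>v v) - \<rho> (e \<otimes> t) *\<^sub>v v"
        by (rule mult_minus_distrib_mat_vec[OF es[OF t] sv v(1)])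
      then show ?thesis using 1 2 v by simp
    qed
    then have "\<rho> s *\<^sub>v v - v \<in> ?N" using sv v(1) by simp
    then have "\<rho> s *\<^sub>v v - v = 0\<^sub>v d" using N by blast
    then have "(\<rho> s *\<^sub>v v - v) $ i = 0" if "i < d" for i using that by simp
    then show ?thesis using carrier_vecD[OF sv] carrier_vecD[OF v(1)] by (intro eq_vecI) (simp_all del: dim_mult_mat_vec)
  qed
  have line: "d = 1" "carrier_vec d = range (\<lambda>a. a \<cdot>\<^sub>v v)"
    using simple_rep_line_invariant[OF simple v(1,2)] fixv
    by (metis one_smult_vec)+
  have "\<rho> s = 1\<^sub>m d" if s: "s \<in> carrier S" for s
  proof (rule mat_eq_if_mult_vec_eq[OF carr[OF s] one_carrier_mat])
    fix x :: "'f vec" assume x: "x \<in> carrier_vec d"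
    then obtain a where "x = a \<cdot>\<^sub>v v" using line by auto
    then have "\<rho> s *\<^sub>v x = x" using mult_mat_vec[OF carr[OF s] v(1)] fixv[OF s] by simp
    then show "\<rho> s *\<^sub>v x = 1\<^sub>m d *\<^sub>v x" using x by simp
  qed
  then have "rep_iso S d \<rho> d triv_t"
    using line(1) by (intro rep_iso_if_eq[OF rep]) (metis triv_t_def)
  with line(1) show ?thesis by metis
qed

text \<open>The nonidentity elements form an ideal. All truncations by fewer strands than points have
  this property.\<close>

locale conical_monoid = fin_monoid S for S :: "'s monoid" (structure) +
  assumes conical: "s \<in> carrier S \<Longrightarrow> t \<in> carrier S \<Longrightarrow> s \<otimes> t = \<one> \<Longrightarrow> s = \<one>"
begin

lemma conical_right: "s \<in> carrier S \<Longrightarrow> t \<in> carrier S \<Longrightarrow> s \<otimes> t = \<one> \<Longrightarrow> t = \<one>"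
  using conical[of s t] by simp

lemma Units_conical: "Units S = {\<one>}"
proof
  show "Units S \<subseteq> {\<one>}" using conical Units_r_inv_ex by blast
qed simp

text \<open>Every nonidentity element acts as zero, so every line is invariant.\<close>

lemma simple_rep_at_one:
  fixes \<rho> :: "'s \<Rightarrow> 'f::field mat"
  assumes simple: "simple_rep S d \<rho>" and apex: "has_apex S d \<rho> \<one>"
  shows "rep_iso S d \<rho> 1 (triv_b S)"
proof -
  have rep: "is_rep S d \<rho>" and d: "d \<noteq> 0" using simple by (auto simp: simple_rep_def)
  have one: "\<rho> \<one> = 1\<^sub>m d" using rep by (simp add: is_rep_def)
  have zero: "\<rho> s = 0\<^sub>m d d" if s: "s \<in> carrier S" "s \<noteq> \<one>" for s
  proof -
    have "\<not> le_lr S s \<one>"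
    proof
      assume "le_lr S s \<one>"
      then obtain x y where "x \<in> carrier S" "y \<in> carrier S" "\<one> = x \<otimes> s \<otimes> y" by (auto simp: le_lr_def)
      then show False using conical conical_right s by (metis m_closed)
    qed
    then show ?thesis using apex s by (simp add: has_apex_def)
  qed
  have v: "unit_vec d 0 \<in> carrier_vec d" "unit_vec d 0 \<noteq> (0\<^sub>v d :: 'f vec)" using d by auto
  have "\<exists>c. \<rho> s *\<^sub>v unit_vec d 0 = c \<cdot>\<^sub>v unit_vec d 0" if s: "s \<in> carrier S" for s
  proof (cases "s = \<one>")
    case True
    then show ?thesis using one v by (intro exI[of _ 1]) auto
  next
    case False
    then show ?thesis using zero[OF s] v by (intro exI[of _ 0]) (auto simp: zero_mult_mat_vec intro!: eq_vecI)
  qed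
  then have "d = 1" using simple_rep_line_invariant[OF simple v] by blast
  moreover have "\<rho> s = triv_b S s" if "s \<in> carrier S" for s
    using that one zero \<open>d = 1\<close> by (auto simp: triv_b_def Units_conical)
  ultimately show ?thesis using rep_iso_if_eq[OF rep] by metis
qed

text \<open>The representation with trivial \<open>V\<close> at \<open>e\<close> is neither \<open>1\<^sub>b\<close>, because \<open>e\<close> does not act as
  zero, nor \<open>1\<^sub>t\<close>, because \<open>s\<close> does.\<close>

theorem ssgap_le:
  assumes e: "e \<in> carrier S" "e \<otimes> e = e" "e \<noteq> \<one>" and s: "s \<in> carrier S" "\<not> le_lr S s e"
  shows "ssgap (F :: 'f::field itself) S \<le> ereal (real (num_r_cells S e))"
proof -
  obtain d and \<rho> :: "'s \<Rightarrow> 'f mat" where L: "is_L_V S e 1 (\<lambda>_. 1\<^sub>m 1 :: 'f mat) d \<rho>"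
    using L_trivial_exists[OF e(1,2)] by blast
  have rep: "is_rep S d \<rho>" and d: "d \<noteq> 0" and apex: "\<rho> e \<noteq> 0\<^sub>m d d" "\<rho> s = 0\<^sub>m d d"
    using L s by (auto simp: is_L_V_def simple_rep_def has_apex_def)
  have re: "\<rho> e \<in> carrier_mat d d" using rep e by (simp add: is_rep_def)
  have "\<not> rep_iso S d \<rho> 1 (triv_b S)"
  proof
    assume "rep_iso S d \<rho> 1 (triv_b S)"
    then obtain P Q where PQ: "P \<in> carrier_mat 1 d" "Q \<in> carrier_mat d 1" "Q * P = 1\<^sub>m d"
      "P * \<rho> e = (triv_b S e) * P" using e unfolding rep_iso_def by blast
    have "P * \<rho> e = 0\<^sub>m 1 d" using PQ e by (simp add: triv_b_def Units_conical)
    then have "Q * (P * \<rho> e) = 0\<^sub>m d d" using PQ by simp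
    moreover have "Q * (P * \<rho> e) = \<rho> e"
      using assoc_mult_mat[OF PQ(2,1) re] PQ(3) re by simp
    ultimately show False using apex by simp
  qed
  moreover have "\<not> rep_iso S d \<rho> 1 triv_t"
  proof
    assume "rep_iso S d \<rho> 1 triv_t"
    then obtain P Q where PQ: "P \<in> carrier_mat 1 d" "Q \<in> carrier_mat d 1" "P * Q = 1\<^sub>m 1"
      "P * \<rho> s = (triv_t s) * P" using s unfolding rep_iso_def by blast
    have "P = 0\<^sub>m 1 d" using PQ apex by (simp add: triv_t_def)
    then have "(1\<^sub>m 1 :: 'f mat) = 0\<^sub>m 1 1" using PQ by simp
    then have "(1\<^sub>m 1 :: 'f mat) $$ (0, 0) = 0\<^sub>m 1 1 $$ (0, 0)" by metis
    then show False by simp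
  qed
  ultimately have "ssgap F S \<le> ereal (ssdim S e 1)"
    unfolding ssgap_def using L by (intro Inf_lower) blast
  then show ?thesis by (simp add: ssdim_def cell_ratio[OF e(1,2)])
qed

text \<open>A nontrivial simple representation has an apex away from the identity and from the
  zero-like idempotents, and \<open>dim V\<close> is at least one.\<close>

theorem le_ssgap:
  assumes "\<And>e. e \<in> carrier S \<Longrightarrow> e \<otimes> e = e \<Longrightarrow> e \<noteq> \<one> \<Longrightarrow>
    \<exists>s\<in>carrier S. e \<otimes> s \<otimes> e \<noteq> e \<Longrightarrow> b \<le> ereal (real (num_r_cells S e))"
  shows "b \<le> ssgap (F :: 'f::field itself) S"
  unfolding ssgap_def
proof (rule Inf_greatest, clarify)
  fix e c \<sigma> d and \<rho> :: "'s \<Rightarrow> 'f mat"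
  assume L: "is_L_V S e c \<sigma> d \<rho>" and nb: "\<not> rep_iso S d \<rho> 1 (triv_b S)" and nt: "\<not> rep_iso S d \<rho> 1 triv_t"
  have e: "e \<in> carrier S" "e \<otimes> e = e" and simple: "simple_rep S d \<rho>" and apex: "has_apex S d \<rho> e"
    and c: "c \<noteq> 0" using L by (auto simp: is_L_V_def simple_rep_def)
  have "e \<noteq> \<one>" using simple_rep_at_one[OF simple] apex nb by metis
  moreover have "\<exists>s\<in>carrier S. e \<otimes> s \<otimes> e \<noteq> e"
    using simple_rep_at_zero_like_idempotent[OF e(1) _ simple] apex nt by (metis has_apex_def)
  ultimately have "b \<le> ereal (real (num_r_cells S e))" using assms e by blast
  also have "real (num_r_cells S e) \<le> real (num_r_cells S e) * real c"
    using c by (simp add: mult_le_cancel_left1)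
  finally show "b \<le> ereal (ssdim S e c)"
    unfolding ssdim_def cell_ratio[OF e] by simp
qed

end

section \<open>The representation gap along an embedding\<close>

text \<open>Conjugate representations have the same kernel congruence.\<close>

lemma rep_iso_reflects_eq:
  assumes iso: "rep_iso S d \<rho> d' \<rho>'" and rep: "is_rep S d \<rho>"
    and st: "s \<in> carrier S" "t \<in> carrier S" and eq: "\<rho>' s = \<rho>' t"
  shows "\<rho> s = \<rho> t"
proof -
  obtain P Q where PQ: "P \<in> carrier_mat d' d" "Q \<in> carrier_mat d d'" "Q * P = 1\<^sub>m d"
    and inter: "\<And>s. s \<in> carrier S \<Longrightarrow> P * \<rho> s = \<rho>' s * P"
    using iso unfolding rep_iso_def by blast
  have carr: "\<rho> s \<in> carrier_mat d d" "\<rho> t \<in> carrier_mat d d" using rep st by (auto simp: is_rep_def)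
  have "Q * (P * \<rho> s) = Q * (P * \<rho> t)" using inter st eq by simp
  then show ?thesis
    using assoc_mult_mat[OF PQ(2,1) carr(1)] assoc_mult_mat[OF PQ(2,1) carr(2)] PQ(3) carr by simp
qed

lemma m_trivial_antimono: "m_trivial F S m \<Longrightarrow> m' \<le> m \<Longrightarrow> m_trivial F S m'"
  unfolding m_trivial_def using le_trans by blast

lemma m_trivial_0: "m_trivial (F :: 'f::field itself) S 0"
  unfolding m_trivial_def
proof (intro allI impI)
  fix d and \<rho> :: "'a \<Rightarrow> 'f mat" assume "d \<le> 0" and rep: "is_rep S d \<rho>"
  then have d: "d = 0" by simp
  have "rep_iso S d \<rho> d (rep_direct_sum [])"
  proof (rule rep_iso_if_eq[OF rep])
    fix s assume "s \<in> carrier S"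
    then have "\<rho> s \<in> carrier_mat 0 0" using rep d by (simp add: is_rep_def)
    then show "\<rho> s = rep_direct_sum [] s" unfolding rep_direct_sum_def by (intro eq_matI) auto
  qed
  then show "\<exists>\<sigma>s. length \<sigma>s = d \<and>
    (\<forall>\<sigma>\<in>set \<sigma>s. is_rep S 1 \<sigma> \<and> (rep_iso S 1 \<sigma> 1 (triv_b S) \<or> rep_iso S 1 \<sigma> 1 triv_t)) \<and>
    rep_iso S d \<rho> d (rep_direct_sum \<sigma>s)"
    using d by (intro exI[of _ "[]"]) simp
qed

text \<open>Neither \<open>1\<^sub>b\<close> nor \<open>1\<^sub>t\<close> separates two nonunits.\<close>

lemma trivial_summands_eq:
  assumes \<sigma>: "\<And>\<sigma>. \<sigma> \<in> set \<sigma>s \<Longrightarrow>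
      is_rep S 1 \<sigma> \<and> (rep_iso S 1 \<sigma> 1 (triv_b S) \<or> rep_iso S 1 \<sigma> 1 triv_t)"
    and st: "s \<in> carrier S" "t \<in> carrier S" "s \<notin> Units S" "t \<notin> Units S"
  shows "rep_direct_sum \<sigma>s s = (rep_direct_sum \<sigma>s t :: 'f::field mat)"
proof -
  have "\<sigma> s = \<sigma> t" if "\<sigma> \<in> set \<sigma>s" for \<sigma>
  proof -
    have "triv_b S s = (triv_b S t :: 'f mat)" "triv_t s = (triv_t t :: 'f mat)"
      using st by (simp_all add: triv_b_def triv_t_def)
    then show ?thesis using \<sigma>[OF that] rep_iso_reflects_eq st by metis
  qed
  then show ?thesis unfolding rep_direct_sum_def by (metis (mono_tags, lifting) map_eq_conv)
qed

abbreviation gap_exceptional :: "'s monoid \<Rightarrow> bool" where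
  "gap_exceptional S \<equiv> carrier S = {\<one>\<^bsub>S\<^esub>} \<or>
    (\<exists>a. a \<noteq> \<one>\<^bsub>S\<^esub> \<and> carrier S = {\<one>\<^bsub>S\<^esub>, a} \<and> a \<otimes>\<^bsub>S\<^esub> a = a)"

context conical_monoid
begin

text \<open>A sum of trivial representations identifies all nonidentity elements, so it can only be
  faithful for the two exceptional monoids. This bounds the gap, which makes the greatest value
  in its definition meaningful.\<close>

lemma not_m_trivial:
  assumes ne: "\<not> gap_exceptional S"
  shows "\<exists>m. \<not> m_trivial (F :: 'f::field itself) S m"
proof (rule ccontr)
  assume "\<not> ?thesis"
  then have triv: "m_trivial F S m" for m by blast
  obtain d and \<rho> :: "'s \<Rightarrow> 'f mat" where rep: "is_rep S d \<rho>" and inj: "inj_on \<rho> (carrier S)"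
    using faithful_rep_exists by blast
  obtain \<sigma>s where \<sigma>s: "\<And>\<sigma>. \<sigma> \<in> set \<sigma>s \<Longrightarrow>
      is_rep S 1 \<sigma> \<and> (rep_iso S 1 \<sigma> 1 (triv_b S) \<or> rep_iso S 1 \<sigma> 1 triv_t)"
    and iso: "rep_iso S d \<rho> d (rep_direct_sum \<sigma>s)"
    using triv[of d] rep unfolding m_trivial_def by blast
  have same: "s = t" if "s \<in> carrier S" "t \<in> carrier S" "s \<noteq> \<one>" "t \<noteq> \<one>" for s t
  proof -
    have "rep_direct_sum \<sigma>s s = rep_direct_sum \<sigma>s t"
      by (rule trivial_summands_eq[of _ S]) (use \<sigma>s that in \<open>auto simp: Units_conical\<close>)
    then have "\<rho> s = \<rho> t" using rep_iso_reflects_eq[OF iso rep that(1,2)] by simp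
    then show ?thesis using inj that by (auto simp: inj_on_def)
  qed
  show False
  proof (cases "carrier S = {\<one>}")
    case False
    then obtain a where a: "a \<in> carrier S" "a \<noteq> \<one>" using one_closed by blast
    have "carrier S = {\<one>, a}" using same a by blast
    moreover have "a \<otimes> a = a" using same a conical by (metis m_closed)
    ultimately show False using ne a by metis
  qed (use ne in simp)
qed

lemma rep_gap_bound:
  assumes "\<not> gap_exceptional S"
  shows "\<exists>b. \<forall>m. 1 \<le> m \<and> m_trivial (F :: 'f::field itself) S (m - 1) \<longrightarrow> m \<le> b"
proof -
  obtain b where b: "\<not> m_trivial F S b" using not_m_trivial[OF assms] by blast
  have "m \<le> b" if "1 \<le> m" "m_trivial F S (m - 1)" for m
  proof (rule ccontr)
    assume "\<not> m \<le> b"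
    then have "b \<le> m - 1" by simp
    then show False using b that(2) m_trivial_antimono by blast
  qed
  then show ?thesis by blast
qed

end

locale conical_embedding = monoid_embedding T S \<phi> + T: conical_monoid T + S: conical_monoid S
  for T :: "'t monoid" and S :: "'s monoid" and \<phi>
begin

text \<open>The convention that gives the two exceptional monoids gap zero does no harm: if the large
  monoid is exceptional, so is the small one.\<close>

lemma gap_exceptional_reflected:
  assumes "gap_exceptional S"
  shows "gap_exceptional T"
proof -
  have one: "\<phi> t = \<one>\<^bsub>S\<^esub> \<Longrightarrow> t \<in> carrier T \<Longrightarrow> t = \<one>\<^bsub>T\<^esub>" for t
    using inj hom_one by (metis T.one_closed inj_onD)
  obtain a where a: "carrier S \<subseteq> {\<one>\<^bsub>S\<^esub>, a}" "a \<otimes>\<^bsub>S\<^esub> a = a"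
    using assms by (metis S.l_one S.one_closed insert_absorb2 order_refl)
  have same: "s = t" if "s \<in> carrier T" "t \<in> carrier T" "s \<noteq> \<one>\<^bsub>T\<^esub>" "t \<noteq> \<one>\<^bsub>T\<^esub>" for s t
  proof -
    have "\<phi> s = a" "\<phi> t = a" using a that one hom_closed by blast+
    then show ?thesis using inj that by (metis inj_onD)
  qed
  show ?thesis
  proof (cases "carrier T = {\<one>\<^bsub>T\<^esub>}")
    case False
    then obtain b where b: "b \<in> carrier T" "b \<noteq> \<one>\<^bsub>T\<^esub>" using T.one_closed by blast
    have "carrier T = {\<one>\<^bsub>T\<^esub>, b}" using same b by blast
    moreover have "b \<otimes>\<^bsub>T\<^esub> b = b" using same b T.conical by (metis T.m_closed)
    ultimately show ?thesis using b by metis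
  qed simp
qed

text \<open>On the small monoid all nonidentity elements act alike. Therefore \<open>s\<close> acts like \<open>s f\<close>,
  then like \<open>s z\<close>, that is, like \<open>z\<close>, and the decomposition over the small monoid is also one
  over the large monoid.\<close>

theorem rep_gap_mono:
  assumes z: "z \<in> carrier T" "z \<noteq> \<one>\<^bsub>T\<^esub>"
    and zero: "\<And>s. s \<in> carrier S \<Longrightarrow> s \<otimes>\<^bsub>S\<^esub> \<phi> z = \<phi> z"
    and support: "\<And>s. s \<in> carrier S \<Longrightarrow> s \<noteq> \<one>\<^bsub>S\<^esub> \<Longrightarrow> \<exists>f\<in>carrier T. f \<noteq> \<one>\<^bsub>T\<^esub> \<and> s \<otimes>\<^bsub>S\<^esub> \<phi> f = s"
  shows "rep_gap (F :: 'f::field itself) T \<le> rep_gap F S"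
proof (cases "gap_exceptional T")
  case True
  then show ?thesis by (simp add: rep_gap_def)
next
  case False
  have neS: "\<not> gap_exceptional S" using False gap_exceptional_reflected by blast
  have "\<phi> (z \<otimes>\<^bsub>T\<^esub> z) = \<phi> z" using z zero hom_mult hom_closed by metis
  then have zz: "z \<otimes>\<^bsub>T\<^esub> z = z" using inj z by (auto simp: inj_on_def)
  have transfer: "m_trivial F S m" if triv: "m_trivial F T m" for m
    unfolding m_trivial_def
  proof (intro allI impI)
    fix d and \<rho> :: "'s \<Rightarrow> 'f mat" assume d: "d \<le> m" and rep: "is_rep S d \<rho>"
    have mult: "\<rho> (s \<otimes>\<^bsub>S\<^esub> t) = \<rho> s * \<rho> t" if "s \<in> carrier S" "t \<in> carrier S" for s t
      using rep that by (simp add: is_rep_def)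
    have repT: "is_rep T d (\<rho> \<circ> \<phi>)"
      using rep hom_closed hom_mult hom_one by (simp add: is_rep_def)
    obtain \<sigma>s where len: "length \<sigma>s = d" and \<sigma>s: "\<And>\<sigma>. \<sigma> \<in> set \<sigma>s \<Longrightarrow>
        is_rep T 1 \<sigma> \<and> (rep_iso T 1 \<sigma> 1 (triv_b T) \<or> rep_iso T 1 \<sigma> 1 triv_t)"
      and iso: "rep_iso T d (\<rho> \<circ> \<phi>) d (rep_direct_sum \<sigma>s)"
      using triv d repT unfolding m_trivial_def by blast
    have non_one: "\<rho> s = \<rho> (\<phi> z)" if s: "s \<in> carrier S" "s \<noteq> \<one>\<^bsub>S\<^esub>" for s
    proof -
      obtain f where f: "f \<in> carrier T" "f \<noteq> \<one>\<^bsub>T\<^esub>" "s \<otimes>\<^bsub>S\<^esub> \<phi> f = s" using support[OF s] by blast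
      have "rep_direct_sum \<sigma>s f = rep_direct_sum \<sigma>s z"
        by (rule trivial_summands_eq[of _ T]) (use \<sigma>s f z in \<open>auto simp: T.Units_conical\<close>)
      then have fz: "\<rho> (\<phi> f) = \<rho> (\<phi> z)" using rep_iso_reflects_eq[OF iso repT f(1) z(1)] by simp
      have "\<rho> s = \<rho> s * \<rho> (\<phi> f)" using mult[OF s(1) hom_closed[OF f(1)]] f(3) by simp
      also have "\<dots> = \<rho> (\<phi> z)" using fz mult[OF s(1) hom_closed[OF z(1)]] zero[OF s(1)] by simp
      finally show ?thesis .
    qed
    define pull where "pull s = (if s = \<one>\<^bsub>S\<^esub> then \<one>\<^bsub>T\<^esub> else z)" for s
    have pull: "pull s \<in> carrier T" for s using z by (simp add: pull_def)
    have \<rho>_pull: "\<rho> s = (\<rho> \<circ> \<phi>) (pull s)" if "s \<in> carrier S" for s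
      using non_one that hom_one by (simp add: pull_def)
    have pull_mult: "pull (s \<otimes>\<^bsub>S\<^esub> t) = pull s \<otimes>\<^bsub>T\<^esub> pull t"
      if st: "s \<in> carrier S" "t \<in> carrier S" for s t
      using st zz z S.conical[OF st] by (auto simp: pull_def)
    (* Each summand is extended by letting all nonidentity elements act as z does. *)
    define \<sigma>s' where "\<sigma>s' = map (\<lambda>\<sigma>. \<sigma> \<circ> pull) \<sigma>s"
    have ds: "rep_direct_sum \<sigma>s' s = rep_direct_sum \<sigma>s (pull s)" for s
      unfolding rep_direct_sum_def \<sigma>s'_def by (simp add: comp_def)
    have isoS: "rep_iso S e \<tau> e' \<tau>'" if iso': "rep_iso T e \<tau>1 e' \<tau>1'"
      and "\<And>s. s \<in> carrier S \<Longrightarrow> \<tau> s = \<tau>1 (pull s)" "\<And>s. s \<in> carrier S \<Longrightarrow> \<tau>' s = \<tau>1' (pull s)"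
      for e e' \<tau> \<tau>1 and \<tau>' \<tau>1' :: "_ \<Rightarrow> 'f mat"
      using that pull unfolding rep_iso_def by metis
    have "is_rep S 1 \<sigma> \<and> (rep_iso S 1 \<sigma> 1 (triv_b S) \<or> rep_iso S 1 \<sigma> 1 triv_t)"
      if mem: "\<sigma> \<in> set \<sigma>s'" for \<sigma>
    proof -
      obtain \<tau> where \<tau>: "\<tau> \<in> set \<sigma>s" "\<sigma> = \<tau> \<circ> pull" using mem by (auto simp: \<sigma>s'_def)
      have rep\<tau>: "is_rep T 1 \<tau>" using \<sigma>s[OF \<tau>(1)] by blast
      have "is_rep S 1 \<sigma>"
        using rep\<tau> pull pull_mult unfolding is_rep_def \<tau>(2) by (simp add: pull_def[of "\<one>\<^bsub>S\<^esub>"])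
      moreover have "triv_b S s = (triv_b T (pull s) :: 'f mat)" for s
        using z by (simp add: triv_b_def pull_def T.Units_conical S.Units_conical)
      moreover have "triv_t s = (triv_t (pull s) :: 'f mat)" for s by (simp add: triv_t_def)
      ultimately show ?thesis
        using \<sigma>s[OF \<tau>(1)] isoS[of 1 \<tau> 1 _ \<sigma>] by (metis \<tau>(2) comp_apply)
    qed
    moreover have "rep_iso S d \<rho> d (rep_direct_sum \<sigma>s')"
      by (rule isoS[OF iso]) (use \<rho>_pull ds in auto)
    moreover have "length \<sigma>s' = d" using len by (simp add: \<sigma>s'_def)
    ultimately show "\<exists>\<sigma>s. length \<sigma>s = d \<and>
        (\<forall>\<sigma>\<in>set \<sigma>s. is_rep S 1 \<sigma> \<and> (rep_iso S 1 \<sigma> 1 (triv_b S) \<or> rep_iso S 1 \<sigma> 1 triv_t)) \<and>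
        rep_iso S d \<rho> d (rep_direct_sum \<sigma>s)" by blast
  qed
  let ?P = "\<lambda>M m. 1 \<le> m \<and> m_trivial F M (m - 1)"
  let ?g = "GREATEST m. 1 \<le> m \<and> m_trivial F T (m - 1)"
  obtain bT where bT: "\<forall>m. 1 \<le> m \<and> m_trivial F T (m - 1) \<longrightarrow> m \<le> bT" using T.rep_gap_bound[OF False] by blast
  obtain bS where bS: "\<forall>m. 1 \<le> m \<and> m_trivial F S (m - 1) \<longrightarrow> m \<le> bS" using S.rep_gap_bound[OF neS] by blast
  have "1 \<le> ?g \<and> m_trivial F T (?g - 1)"
    by (rule GreatestI_nat[of _ 1]) (use bT m_trivial_0 in auto)
  then have "1 \<le> ?g \<and> m_trivial F S (?g - 1)" using transfer by blast
  then have "?g \<le> (GREATEST m. 1 \<le> m \<and> m_trivial F S (m - 1))"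
    by (rule Greatest_le_nat) (use bS in auto)
  then show ?thesis unfolding rep_gap_def if_not_P[OF False] if_not_P[OF neS] .
qed

end

section \<open>Rees factors\<close>

locale submonoid_pair = T: fin_monoid T + S: fin_monoid S for T S :: "'s monoid" +
  assumes sub: "carrier T \<subseteq> carrier S" and mult_eq: "mult T = mult S" and one_eq: "\<one>\<^bsub>T\<^esub> = \<one>\<^bsub>S\<^esub>"

sublocale submonoid_pair \<subseteq> monoid_embedding T S id
  by unfold_locales (use sub mult_eq one_eq in auto)

locale monoid_ideal = fin_monoid S for S :: "'s monoid" (structure) +
  fixes I
  assumes I_sub: "I \<subseteq> carrier S"
    and ideal_l: "s \<in> carrier S \<Longrightarrow> x \<in> I \<Longrightarrow> s \<otimes> x \<in> I"
    and ideal_r: "s \<in> carrier S \<Longrightarrow> x \<in> I \<Longrightarrow> x \<otimes> s \<in> I"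
begin

abbreviation cls :: "'s \<Rightarrow> 's set" where "cls x \<equiv> rees_rel S I `` {x}"

abbreviation Q :: "'s set monoid" where "Q \<equiv> rees_factor S I"

lemma cls_eq: "x \<in> carrier S \<Longrightarrow> cls x = (if x \<in> I then I else {x})"
  using I_sub by (auto simp: rees_rel_def)

lemma cls_eq_iff: "x \<in> carrier S \<Longrightarrow> y \<in> carrier S \<Longrightarrow> cls x = cls y \<longleftrightarrow> x = y \<or> x \<in> I \<and> y \<in> I"
  by (auto simp: cls_eq)

lemma carrier_Q: "carrier Q = cls ` carrier S"
  by (auto simp: rees_factor_def quotient_def)

lemma cls_closed [simp]: "x \<in> carrier S \<Longrightarrow> cls x \<in> carrier Q"
  by (auto simp: carrier_Q)

lemma one_Q: "\<one>\<^bsub>Q\<^esub> = cls \<one>"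
  by (simp add: rees_factor_def)

lemma mult_Q:
  assumes x: "x \<in> carrier S" and y: "y \<in> carrier S"
  shows "cls x \<otimes>\<^bsub>Q\<^esub> cls y = cls (x \<otimes> y)"
proof -
  have "cls (x' \<otimes> y') = cls (x \<otimes> y)" if "x' \<in> cls x" "y' \<in> cls y" for x' y'
  proof -
    have "x' \<in> carrier S" "y' \<in> carrier S" using that I_sub x y by (auto simp: cls_eq split: if_splits)
    then show ?thesis using that x y ideal_l ideal_r
      by (subst cls_eq_iff) (auto simp: cls_eq split: if_splits)
  qed
  moreover have "x \<in> cls x" "y \<in> cls y" using x y by (auto simp: rees_rel_def)
  ultimately have "(\<Union>x'\<in>cls x. \<Union>y'\<in>cls y. cls (x' \<otimes> y')) = cls (x \<otimes> y)" by blast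
  then show ?thesis by (simp add: rees_factor_def)
qed

lemma fin_monoid_Q: "fin_monoid Q"
proof
  fix X Y Z assume X: "X \<in> carrier Q" and Y: "Y \<in> carrier Q"
  obtain x y where x: "x \<in> carrier S" "X = cls x" and y: "y \<in> carrier S" "Y = cls y"
    using X Y by (auto simp: carrier_Q)
  show "X \<otimes>\<^bsub>Q\<^esub> Y \<in> carrier Q" using x y by (simp add: mult_Q)
  show "\<one>\<^bsub>Q\<^esub> \<otimes>\<^bsub>Q\<^esub> X = X" "X \<otimes>\<^bsub>Q\<^esub> \<one>\<^bsub>Q\<^esub> = X" using x by (simp_all add: one_Q mult_Q)
  assume Z: "Z \<in> carrier Q"
  obtain z where z: "z \<in> carrier S" "Z = cls z" using Z by (auto simp: carrier_Q)
  show "X \<otimes>\<^bsub>Q\<^esub> Y \<otimes>\<^bsub>Q\<^esub> Z = X \<otimes>\<^bsub>Q\<^esub> (Y \<otimes>\<^bsub>Q\<^esub> Z)" using x y z by (simp add: mult_Q m_assoc)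
next
  show "\<one>\<^bsub>Q\<^esub> \<in> carrier Q" by (simp add: one_Q)
  show "finite (carrier Q)" using fin by (simp add: carrier_Q)
qed

lemma conical_Q:
  assumes "conical_monoid S" and "\<one> \<notin> I"
  shows "conical_monoid Q"
proof -
  interpret Q: fin_monoid Q by (rule fin_monoid_Q)
  interpret S: conical_monoid S by fact
  show ?thesis
  proof
    fix X Y assume XY: "X \<in> carrier Q" "Y \<in> carrier Q" "X \<otimes>\<^bsub>Q\<^esub> Y = \<one>\<^bsub>Q\<^esub>"
    obtain x y where x: "x \<in> carrier S" "X = cls x" and y: "y \<in> carrier S" "Y = cls y"
      using XY by (auto simp: carrier_Q)
    have "cls (x \<otimes> y) = cls \<one>" using XY(3) x y by (simp only: mult_Q[symmetric] one_Q[symmetric])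
    then have "x \<otimes> y = \<one>"
      using cls_eq_iff[OF m_closed[OF x(1) y(1)] one_closed] assms(2) by blast
    then have "x = \<one>" by (rule S.conical[OF x(1) y(1)])
    then show "X = \<one>\<^bsub>Q\<^esub>" using x(2) by (simp add: one_Q)
  qed
qed

end

locale ideal_pair = submonoid_pair T S + S: monoid_ideal S I for T S :: "'s monoid" and I +
  fixes J assumes J_eq: "J = I \<inter> carrier T"
begin

sublocale T: monoid_ideal T J
proof
  fix s x assume s: "s \<in> carrier T" and x: "x \<in> J"
  then have c: "s \<in> carrier S" "x \<in> I" "x \<in> carrier T" using sub J_eq by auto
  show "s \<otimes>\<^bsub>T\<^esub> x \<in> J" using S.ideal_l[OF c(1,2)] T.m_closed[OF s c(3)] J_eq mult_eq by simp
  show "x \<otimes>\<^bsub>T\<^esub> s \<in> J" using S.ideal_r[OF c(1,2)] T.m_closed[OF c(3) s] J_eq mult_eq by simp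
qed (auto simp: J_eq)

text \<open>The class of \<open>x\<close> in the small Rees factor is sent to the class of \<open>x\<close> in the large one:
  closing a set under the large congruence leaves singletons alone and enlarges the small ideal
  to the large one.\<close>

definition factor_emb :: "'s set \<Rightarrow> 's set" where
  "factor_emb X = rees_rel S I `` X"

lemma factor_emb_cls: "x \<in> carrier T \<Longrightarrow> factor_emb (T.cls x) = S.cls x"
  using S.I_sub sub by (auto simp: factor_emb_def J_eq rees_rel_def)

lemma factor_embedding: "monoid_embedding T.Q S.Q factor_emb"
proof -
  interpret TQ: fin_monoid T.Q by (rule T.fin_monoid_Q)
  interpret SQ: fin_monoid S.Q by (rule S.fin_monoid_Q)
  show ?thesis
  proof
    fix X Y assume X: "X \<in> carrier T.Q" and Y: "Y \<in> carrier T.Q"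
    obtain x y where x: "x \<in> carrier T" "X = T.cls x" and y: "y \<in> carrier T" "Y = T.cls y"
      using X Y by (auto simp: T.carrier_Q)
    then have "x \<in> carrier S" "y \<in> carrier S" using sub by auto
    then show "factor_emb X \<in> carrier S.Q"
      "factor_emb (X \<otimes>\<^bsub>T.Q\<^esub> Y) = factor_emb X \<otimes>\<^bsub>S.Q\<^esub> factor_emb Y"
      using x y by (simp_all add: factor_emb_cls T.mult_Q S.mult_Q mult_eq[symmetric])
  next
    show "factor_emb \<one>\<^bsub>T.Q\<^esub> = \<one>\<^bsub>S.Q\<^esub>" by (simp add: T.one_Q S.one_Q factor_emb_cls one_eq[symmetric])
    show "inj_on factor_emb (carrier T.Q)"
    proof (rule inj_onI)
      fix X Y assume XY: "X \<in> carrier T.Q" "Y \<in> carrier T.Q" "factor_emb X = factor_emb Y"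
      obtain x y where x: "x \<in> carrier T" "X = T.cls x" and y: "y \<in> carrier T" "Y = T.cls y"
        using XY by (auto simp: T.carrier_Q)
      have "S.cls x = S.cls y" using XY(3) x y by (simp only: factor_emb_cls)
      then have "x = y \<or> x \<in> I \<and> y \<in> I" using S.cls_eq_iff x(1) y(1) sub by blast
      then show "X = Y" unfolding x(2) y(2) using T.cls_eq_iff[OF x(1) y(1)] x(1) y(1) J_eq by blast
    qed
  qed
qed

end

section \<open>Diagrams and colourings\<close>

fun colour :: "(nat \<Rightarrow> bool) \<Rightarrow> (nat \<Rightarrow> bool) \<Rightarrow> point \<Rightarrow> bool" where
  "colour v u (Top i) = v i"
| "colour v u (Bot i) = u i"

text \<open>A diagram acts on two-colourings of the points as a relation between top and bottom
  colourings.\<close>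

definition compat :: "point set set \<Rightarrow> (nat \<Rightarrow> bool) \<Rightarrow> (nat \<Rightarrow> bool) \<Rightarrow> bool" where
  "compat d v u \<longleftrightarrow> (\<forall>B\<in>d. \<forall>x\<in>B. \<forall>y\<in>B. colour v u x = colour v u y)"

lemma finite_points [simp]: "finite (points n)"
  by (simp add: points_def)

lemma Top_points [simp]: "Top i \<in> points n \<longleftrightarrow> i \<in> {1..n}"
  and Bot_points [simp]: "Bot i \<in> points n \<longleftrightarrow> i \<in> {1..n}"
  by (auto simp: points_def)

lemma compatD: "compat d v u \<Longrightarrow> B \<in> d \<Longrightarrow> x \<in> B \<Longrightarrow> y \<in> B \<Longrightarrow> colour v u x = colour v u y"
  unfolding compat_def by blast

text \<open>The indicator function of a block is an admissible colouring, and it separates the block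
  from all other points.\<close>

lemma compat_inject:
  assumes d: "partition_on (points n) d" and d': "partition_on (points n) d'"
    and eq: "\<And>v u. compat d v u = compat d' v u"
  shows "d = d'"
proof -
  have sub: "d \<subseteq> d'" if d: "partition_on (points n) d" and d': "partition_on (points n) d'"
    and eq: "\<And>v u. compat d v u = compat d' v u" for d d'
  proof
    fix B assume B: "B \<in> d"
    then obtain x where x: "x \<in> B" using d by (metis all_not_in_conv partition_onD3)
    have "x \<in> points n" using x B d by (auto dest: partition_onD1)
    then obtain B' where B': "B' \<in> d'" "x \<in> B'" using d' by (auto dest: partition_onD1)
    have inside: "C \<subseteq> C'"
      if c: "partition_on (points n) c" "C \<in> c'" "C' \<in> c" "x \<in> C" "x \<in> C'"
        "\<And>v u. compat c v u \<Longrightarrow> compat c' v u" for c c' C C'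
    proof
      fix y assume y: "y \<in> C"
      define v where "v i \<longleftrightarrow> Top i \<in> C'" for i
      define u where "u i \<longleftrightarrow> Bot i \<in> C'" for i
      have col: "colour v u z \<longleftrightarrow> z \<in> C'" for z by (cases z) (auto simp: v_def u_def)
      have "compat c v u" unfolding compat_def col
        using c(1,3) by (metis disjoint_iff partition_onD2 disjointD)
      then have "compat c' v u" by (rule c(6))
      then show "y \<in> C'" using compatD[OF _ c(2) c(4) y] c(5) col by blast
    qed
    have "B \<subseteq> B'" using inside[OF d' B B'(1) x B'(2)] eq by blast
    moreover have "B' \<subseteq> B" using inside[OF d B'(1) B B'(2) x] eq by blast
    ultimately show "B \<in> d'" using B' by auto
  qed
  show ?thesis using sub[OF d d' eq] sub[OF d' d eq[symmetric]] by blast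
qed

lemma compat_cong:
  assumes "partition_on (points n) d" "\<And>i. i \<in> {1..n} \<Longrightarrow> v i = v' i" "\<And>i. i \<in> {1..n} \<Longrightarrow> u i = u' i"
  shows "compat d v u = compat d v' u'"
proof -
  have "colour v u x = colour v' u' x" if "B \<in> d" "x \<in> B" for B x
  proof -
    have "x \<in> points n" using assms(1) that by (auto dest: partition_onD1)
    then show ?thesis using assms by (cases x) auto
  qed
  then show ?thesis unfolding compat_def by blast
qed

lemma stack_graph_sym: "sym (stack_graph a b)"
  by (auto simp: stack_graph_def sym_def)

lemma stack_rel_equiv:
  "equiv (points n) {(x, y). x \<in> points n \<and> y \<in> points n \<and> (outer x, outer y) \<in> (stack_graph a b)\<^sup>*}"
proof -
  have "sym ((stack_graph a b)\<^sup>*)" by (rule sym_rtrancl[OF stack_graph_sym])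
  then show ?thesis
    by (intro equivI) (auto simp: refl_on_def sym_def trans_def intro: rtrancl_trans)
qed

lemma stack_partition: "partition_on (points n) (stack n a b)"
  unfolding stack_def by (rule partition_on_quotient[OF stack_rel_equiv])

lemma same_block_stack_iff:
  assumes "x \<in> points n" "y \<in> points n"
  shows "(\<exists>B\<in>stack n a b. x \<in> B \<and> y \<in> B) \<longleftrightarrow> (outer x, outer y) \<in> (stack_graph a b)\<^sup>*"
proof -
  have sym: "(p, q) \<in> (stack_graph a b)\<^sup>* \<Longrightarrow> (q, p) \<in> (stack_graph a b)\<^sup>*" for p q
    using sym_rtrancl[OF stack_graph_sym] by (auto simp: sym_def)
  show ?thesis
    using assms sym unfolding stack_def quotient_def
    by (auto intro: rtrancl_trans)
qed

text \<open>A colouring of the outer points that is constant on the blocks of the stack extends to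
  the middle points: colour a point of the stack by whether it is connected to an outer point of
  colour true.\<close>

lemma compat_stack:
  assumes a: "partition_on (points n) a" and b: "partition_on (points n) b"
  shows "compat (stack n a b) v u \<longleftrightarrow> (\<exists>w. compat a v w \<and> compat b w u)"
proof
  assume "\<exists>w. compat a v w \<and> compat b w u"
  then obtain w where w: "compat a v w" "compat b w u" by blast
  define f where "f p = (case p of Upper i \<Rightarrow> v i | Middle i \<Rightarrow> w i | Lower i \<Rightarrow> u i)" for p
  have f: "f (in_upper x) = colour v w x" "f (in_lower x) = colour w u x" "f (outer x) = colour v u x" for x
    by (cases x; simp add: f_def)+
  have edge: "f p = f q" if pq: "(p, q) \<in> stack_graph a b" for p q
  proof -
    consider A x y where "A \<in> a" "x \<in> A" "y \<in> A" "p = in_upper x" "q = in_upper y"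
      | B x y where "B \<in> b" "x \<in> B" "y \<in> B" "p = in_lower x" "q = in_lower y"
      using pq unfolding stack_graph_def by blast
    then show ?thesis
    proof cases
      case 1
      then show ?thesis using compatD[OF w(1)] f(1) by metis
    next
      case 2
      then show ?thesis using compatD[OF w(2)] f(2) by metis
    qed
  qed
  have path: "f p = f q" if "(p, q) \<in> (stack_graph a b)\<^sup>*" for p q
    using that by (induction rule: rtrancl_induct) (auto dest: edge)
  show "compat (stack n a b) v u" unfolding compat_def
  proof (intro ballI)
    fix B x y assume B: "B \<in> stack n a b" "x \<in> B" "y \<in> B"
    then have "x \<in> points n" "y \<in> points n" using partition_onD1[OF stack_partition[of n a b]] by auto
    then show "colour v u x = colour v u y" using same_block_stack_iff B path f(3) by metis
  qed
next
  assume R: "compat (stack n a b) v u"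
  define f where "f p \<longleftrightarrow> (\<exists>x\<in>points n. colour v u x \<and> (outer x, p) \<in> (stack_graph a b)\<^sup>*)" for p
  have path: "f p = f q" if "(p, q) \<in> stack_graph a b" for p q
  proof -
    have "(q, p) \<in> stack_graph a b" using that stack_graph_sym by (auto simp: sym_def)
    then show ?thesis using that unfolding f_def by (meson rtrancl.rtrancl_into_rtrancl)
  qed
  have out: "f (outer y) = colour v u y" if y: "y \<in> points n" for y
    unfolding f_def using y R same_block_stack_iff[OF _ y, of _ a b] unfolding compat_def by blast
  define w where "w i = f (Middle i)" for i
  have "f (in_upper x) = colour v w x" "f (in_lower x) = colour w u x" if "x \<in> points n" for x
    using out[OF that] by (cases x; simp add: w_def)+
  moreover have "x \<in> points n" if "B \<in> a \<or> B \<in> b" "x \<in> B" for x B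
    using that a b by (auto dest: partition_onD1)
  moreover have "f (in_upper x) = f (in_upper y)" if "B \<in> a" "x \<in> B" "y \<in> B" for B x y
    using that by (intro path) (auto simp: stack_graph_def)
  moreover have "f (in_lower x) = f (in_lower y)" if "B \<in> b" "x \<in> B" "y \<in> B" for B x y
    using that by (intro path) (auto simp: stack_graph_def)
  ultimately have "compat a v w \<and> compat b w u" unfolding compat_def by metis
  then show "\<exists>w. compat a v w \<and> compat b w u" by blast
qed

lemma stack_eqI:
  assumes "partition_on (points n) a" "partition_on (points n) b" "partition_on (points n) c"
    and "\<And>v u. (\<exists>w. compat a v w \<and> compat b w u) = compat c v u"
  shows "stack n a b = c"
  by (rule compat_inject[OF stack_partition assms(3)]) (simp add: compat_stack assms)

definition part_inj :: "nat \<Rightarrow> (nat \<times> nat) set \<Rightarrow> bool" where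
  "part_inj n g \<longleftrightarrow> g \<subseteq> {1..n} \<times> {1..n} \<and> single_valued g \<and> single_valued (g\<inverse>)"

text \<open>The rook diagram of a partial injection, given by its pairs (top point, bottom point).\<close>

definition dia :: "nat \<Rightarrow> (nat \<times> nat) set \<Rightarrow> point set set" where
  "dia n g = (\<lambda>(t, b). {Bot b, Top t}) ` g \<union> (\<lambda>t. {Top t}) ` ({1..n} - Domain g) \<union>
     (\<lambda>b. {Bot b}) ` ({1..n} - Range g)"

lemma dia_partition:
  assumes "part_inj n g"
  shows "partition_on (points n) (dia n g)"
proof (rule partition_onI)
  show "\<Union> (dia n g) = points n"
    using assms unfolding dia_def points_def part_inj_def by (force simp: Domain_iff Range_iff)
  show "disjnt p q" if "p \<in> dia n g" "q \<in> dia n g" "p \<noteq> q" for p q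
    using that assms unfolding dia_def part_inj_def single_valued_def disjnt_def by auto
  show "{} \<notin> dia n g" by (auto simp: dia_def)
qed

lemma compat_dia: "compat (dia n g) v u \<longleftrightarrow> (\<forall>(t, b)\<in>g. v t = u b)"
proof
  assume R: "compat (dia n g) v u"
  have "v t = u b" if "(t, b) \<in> g" for t b
  proof -
    have "{Bot b, Top t} \<in> dia n g" using that by (force simp: dia_def)
    from compatD[OF R this, of "Top t" "Bot b"] show ?thesis by simp
  qed
  then show "\<forall>(t, b)\<in>g. v t = u b" by auto
next
  assume "\<forall>(t, b)\<in>g. v t = u b"
  then show "compat (dia n g) v u" unfolding compat_def dia_def by auto
qed

lemma part_inj_comp: "part_inj n g \<Longrightarrow> part_inj n h \<Longrightarrow> part_inj n (g O h)"
  unfolding part_inj_def single_valued_def by (auto; blast)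

lemma stack_dia:
  assumes g: "part_inj n g" and h: "part_inj n h"
  shows "stack n (dia n g) (dia n h) = dia n (g O h)"
proof (rule stack_eqI)
  show "(\<exists>w. compat (dia n g) v w \<and> compat (dia n h) w u) = compat (dia n (g O h)) v u" for v u
  proof
    assume R: "compat (dia n (g O h)) v u"
    (* On middle points that lie on strands of both diagrams the two prescriptions agree; elsewhere only one of them applies. *)
    define w where "w m = (if m \<in> Range g then \<exists>t. (t, m) \<in> g \<and> v t else \<exists>b. (m, b) \<in> h \<and> u b)" for m
    have vw: "v t = w m" if tm: "(t, m) \<in> g" for t m
    proof -
      have "t' = t" if "(t', m) \<in> g" for t'
        using that tm g unfolding part_inj_def single_valued_def by blast
      moreover have "w m = (\<exists>t. (t, m) \<in> g \<and> v t)" using tm by (auto simp: w_def)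
      ultimately show ?thesis using tm by metis
    qed
    moreover have "w m = u b" if mb: "(m, b) \<in> h" for m b
    proof (cases "m \<in> Range g")
      case True
      then obtain t where t: "(t, m) \<in> g" by auto
      then have "v t = u b" using R mb unfolding compat_dia by blast
      then show ?thesis using vw[OF t] by simp
    next
      case False
      have "b' = b" if "(m, b') \<in> h" for b'
        using that mb h unfolding part_inj_def single_valued_def by blast
      moreover have "w m = (\<exists>b. (m, b) \<in> h \<and> u b)" using False by (simp add: w_def)
      ultimately show ?thesis using mb by metis
    qed
    ultimately show "\<exists>w. compat (dia n g) v w \<and> compat (dia n h) w u"
      unfolding compat_dia by blast
  qed (auto simp: compat_dia)
qed (intro dia_partition g h part_inj_comp)+

text \<open>The partial identity with \<open>j\<close> through strands. It is planar and lies in all the monoids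
  considered.\<close>

definition eps :: "nat \<Rightarrow> nat \<Rightarrow> point set set" where
  "eps n j = dia n (Id_on {1..j})"

lemma part_inj_Id_on: "A \<subseteq> {1..n} \<Longrightarrow> part_inj n (Id_on A)"
  by (auto simp: part_inj_def single_valued_def)

lemma eps_partition: "j \<le> n \<Longrightarrow> partition_on (points n) (eps n j)"
  unfolding eps_def by (intro dia_partition part_inj_Id_on) auto

lemma compat_eps: "compat (eps n j) v u \<longleftrightarrow> (\<forall>i\<in>{1..j}. v i = u i)"
  unfolding eps_def compat_dia by auto

lemma stack_eps: "j \<le> n \<Longrightarrow> i \<le> n \<Longrightarrow> stack n (eps n j) (eps n i) = eps n (min i j)"
proof -
  assume "j \<le> n" "i \<le> n"
  moreover have "Id_on {1..j} O Id_on {1..i} = Id_on {1..min i j}" by (auto simp: relcomp_unfold Id_on_iff)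
  ultimately show ?thesis unfolding eps_def by (subst stack_dia) (auto intro!: part_inj_Id_on)
qed

lemma one_Pa: "\<one>\<^bsub>Pa n\<^esub> = eps n n"
  unfolding Pa_def eps_def dia_def by (auto simp: image_iff)

lemma carrier_Pa: "carrier (Pa n) = {d. partition_on (points n) d}"
  by (simp add: Pa_def)

lemma mult_Pa: "mult (Pa n) = stack n"
  by (simp add: Pa_def)

text \<open>Composition of relations is associative.\<close>

lemma stack_assoc:
  assumes "partition_on (points n) a" "partition_on (points n) b" "partition_on (points n) c"
  shows "stack n (stack n a b) c = stack n a (stack n b c)"
  by (rule compat_inject[OF stack_partition stack_partition])
    (auto simp: compat_stack assms stack_partition)

lemma stack_one:
  assumes d: "partition_on (points n) d"
  shows "stack n (eps n n) d = d" "stack n d (eps n n) = d"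
proof -
  show "stack n (eps n n) d = d"
  proof (rule stack_eqI[OF _ d d])
    show "(\<exists>w. compat (eps n n) v w \<and> compat d w u) = compat d v u" for v u
      using compat_cong[OF d] unfolding compat_eps by (metis (no_types))
  qed (simp add: eps_partition)
  show "stack n d (eps n n) = d"
  proof (rule stack_eqI[OF d _ d])
    show "(\<exists>w. compat d v w \<and> compat (eps n n) w u) = compat d v u" for v u
      using compat_cong[OF d] unfolding compat_eps by (metis (no_types))
  qed (simp add: eps_partition)
qed

lemma fin_monoid_Pa: "fin_monoid (Pa n)"
proof
  show "finite (carrier (Pa n))" unfolding carrier_Pa by (rule finitely_many_partition_on) simp
qed (auto simp: carrier_Pa mult_Pa one_Pa stack_partition stack_assoc stack_one eps_partition)

text \<open>A factorization of \<open>eps n r\<close> through \<open>eps n j\<close> transports each colouring of \<open>r\<close> points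
  through \<open>j\<close> points and back. So the \<open>2 ^ r\<close> colourings inject into \<open>2 ^ j\<close> colourings.\<close>

lemma eps_rank_le:
  assumes x: "partition_on (points n) x" and y: "partition_on (points n) y" and "j \<le> n" "r \<le> n"
    and eq: "eps n r = stack n (stack n x (eps n j)) y"
  shows "r \<le> j"
proof -
  have "\<exists>w. compat x (\<lambda>i. i \<in> A) w \<and> (\<exists>w'. (\<forall>i\<in>{1..j}. w i = w' i) \<and> compat y w' (\<lambda>i. i \<in> A))" for A
  proof -
    have "compat (eps n r) (\<lambda>i. i \<in> A) (\<lambda>i. i \<in> A)" by (simp add: compat_eps)
    then show ?thesis
      unfolding eq compat_stack[OF stack_partition y] compat_stack[OF x eps_partition[OF \<open>j \<le> n\<close>]]
        compat_eps by blast
  qed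
  then obtain w w' where w: "\<And>A. compat x (\<lambda>i. i \<in> A) (w A)" "\<And>A i. i \<in> {1..j} \<Longrightarrow> w A i = w' A i"
    "\<And>A. compat y (w' A) (\<lambda>i. i \<in> A)" by metis
  have "inj_on (\<lambda>A. {i \<in> {1..j}. w A i}) (Pow {1..r})"
  proof (rule inj_onI)
    fix A B assume AB: "A \<in> Pow {1..r}" "B \<in> Pow {1..r}" "{i \<in> {1..j}. w A i} = {i \<in> {1..j}. w B i}"
    then have "\<forall>i\<in>{1..j}. w A i = w' B i" using w(2) by blast
    then have "compat (eps n r) (\<lambda>i. i \<in> A) (\<lambda>i. i \<in> B)"
      unfolding eq compat_stack[OF stack_partition y] compat_stack[OF x eps_partition[OF \<open>j \<le> n\<close>]]
        compat_eps using w(1)[of A] w(3)[of B] by blast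
    then show "A = B" using AB unfolding compat_eps by blast
  qed
  moreover have "(\<lambda>A. {i \<in> {1..j}. w A i}) ` Pow {1..r} \<subseteq> Pow {1..j}" by auto
  ultimately have "card (Pow {1..r}) \<le> card (Pow {1..j})" by (intro card_inj_on_le) auto
  then show ?thesis by (simp add: card_Pow)
qed

lemma through_strands_dia:
  assumes "part_inj n g"
  shows "through_strands (dia n g) = card g"
proof -
  have "{B \<in> dia n g. (\<exists>i. Bot i \<in> B) \<and> (\<exists>j. Top j \<in> B)} = (\<lambda>(t, b). {Bot b, Top t}) ` g"
    unfolding dia_def by auto
  moreover have "inj_on (\<lambda>(t, b). {Bot b, Top t}) g"
    by (auto simp: inj_on_def doubleton_eq_iff)
  ultimately show ?thesis unfolding through_strands_def by (simp add: card_image)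
qed

lemma through_strands_eps: "j \<le> n \<Longrightarrow> through_strands (eps n j) = j"
proof -
  assume "j \<le> n"
  moreover have "Id_on {1..j} = (\<lambda>i. (i, i)) ` {1..j}" by (auto simp: Id_on_def)
  then have "card (Id_on {1..j}) = j" by (simp add: card_image inj_on_def)
  ultimately show ?thesis
    unfolding eps_def by (subst through_strands_dia) (auto intro: part_inj_Id_on)
qed

section \<open>Factorization of a diagram through its through strands\<close>

fun flip_pt :: "point \<Rightarrow> point" where
  "flip_pt (Top i) = Bot i"
| "flip_pt (Bot i) = Top i"

text \<open>Reflection of diagrams in a horizontal line, an anti-automorphism of the partition
  monoid.\<close>

definition flip :: "point set set \<Rightarrow> point set set" where
  "flip d = (`) flip_pt ` d"

lemma flip_pt_flip_pt [simp]: "flip_pt (flip_pt x) = x"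
  by (cases x) auto

lemma inj_flip_pt: "inj_on flip_pt A"
  by (rule inj_on_inverseI[where g=flip_pt]) simp

lemma colour_flip_pt [simp]: "colour v u (flip_pt x) = colour u v x"
  by (cases x) auto

lemma compat_flip: "compat (flip d) v u = compat d u v"
  by (simp add: compat_def flip_def)

lemma flip_partition:
  assumes "partition_on (points n) d"
  shows "partition_on (points n) (flip d)"
proof -
  have "flip_pt ` points n = points n" by (simp add: points_def image_Un image_image Un_commute)
  moreover have "{} \<notin> (`) flip_pt ` d" using partition_onD3[OF assms] by auto
  ultimately show ?thesis
    using partition_on_inj_image[OF assms inj_flip_pt] by (simp add: flip_def)
qed

text \<open>A half diagram: the top points are partitioned into the blocks \<open>b 1, ..., b j\<close>, which are
  joined to the first \<open>j\<close> bottom points, and the blocks in \<open>N\<close>, which are not joined to the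
  bottom.\<close>

definition half :: "nat \<Rightarrow> nat \<Rightarrow> (nat \<Rightarrow> nat set) \<Rightarrow> nat set set \<Rightarrow> point set set" where
  "half n j b N = (\<lambda>i. insert (Bot i) (Top ` b i)) ` {1..j} \<union> (`) Top ` N \<union> (\<lambda>i. {Bot i}) ` {j<..n}"

definition half_data :: "nat \<Rightarrow> nat \<Rightarrow> (nat \<Rightarrow> nat set) \<Rightarrow> nat set set \<Rightarrow> bool" where
  "half_data n j b N \<longleftrightarrow> j \<le> n \<and> partition_on {1..n} (N \<union> b ` {1..j}) \<and> inj_on b {1..j} \<and>
     N \<inter> b ` {1..j} = {}"

lemma half_dataD:
  assumes "half_data n j b N"
  shows "j \<le> n" "\<And>i. i \<in> {1..j} \<Longrightarrow> b i \<noteq> {}"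
    "\<And>i i'. i \<in> {1..j} \<Longrightarrow> i' \<in> {1..j} \<Longrightarrow> i \<noteq> i' \<Longrightarrow> b i \<inter> b i' = {}"
    "\<And>i B. i \<in> {1..j} \<Longrightarrow> B \<in> N \<Longrightarrow> b i \<inter> B = {}"
    "\<And>B B'. B \<in> N \<Longrightarrow> B' \<in> N \<Longrightarrow> B \<noteq> B' \<Longrightarrow> B \<inter> B' = {}"
    "\<And>B. B \<in> N \<Longrightarrow> B \<noteq> {}" "\<Union>N \<union> (\<Union>i\<in>{1..j}. b i) = {1..n}"
proof -
  have j: "j \<le> n" and P: "partition_on {1..n} (N \<union> b ` {1..j})" and inj: "inj_on b {1..j}"
    and N: "N \<inter> b ` {1..j} = {}" using assms by (auto simp: half_data_def)
  have D: "X \<inter> Y = {}" if "X \<in> N \<union> b ` {1..j}" "Y \<in> N \<union> b ` {1..j}" "X \<noteq> Y" for X Y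
    using partition_onD2[OF P] that by (simp add: disjointD)
  show "j \<le> n" by (rule j)
  show "b i \<noteq> {}" if "i \<in> {1..j}" for i using partition_onD3[OF P] that by fastforce
  show "b i \<inter> b i' = {}" if "i \<in> {1..j}" "i' \<in> {1..j}" "i \<noteq> i'" for i i'
    using D[of "b i" "b i'"] that inj by (meson UnI2 imageI inj_onD)
  show "b i \<inter> B = {}" if "i \<in> {1..j}" "B \<in> N" for i B
    using D[of "b i" B] that N by blast
  show "B \<inter> B' = {}" if "B \<in> N" "B' \<in> N" "B \<noteq> B'" for B B' using D that by blast
  show "B \<noteq> {}" if "B \<in> N" for B using partition_onD3[OF P] that by blast
  show "\<Union>N \<union> (\<Union>i\<in>{1..j}. b i) = {1..n}" using partition_onD1[OF P] by auto
qed

lemma half_partition: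
  assumes h: "half_data n j b N"
  shows "partition_on (points n) (half n j b N)"
proof (rule partition_onI)
  note D = half_dataD[OF h]
  have "\<Union> (half n j b N) = Bot ` ({1..j} \<union> {j<..n}) \<union> Top ` (\<Union>N \<union> (\<Union>i\<in>{1..j}. b i))"
    unfolding half_def by auto
  also have "{1..j} \<union> {j<..n} = {1..n}" using D(1) by auto
  finally show "\<Union> (half n j b N) = points n" unfolding D(7) points_def .
  have 1: "disjnt (Top ` X) (Top ` Y)" if "X \<inter> Y = {}" for X Y :: "nat set"
    using that by (auto simp: disjnt_def)
  show "disjnt p q" if p: "p \<in> half n j b N" and q: "q \<in> half n j b N" and pq: "p \<noteq> q" for p q
  proof -
    have bot: "r = (if i \<le> j then insert (Bot i) (Top ` b i) else {Bot i})"
      if "r \<in> half n j b N" "Bot i \<in> r" for r i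
      using that unfolding half_def by auto
    have top: "(\<exists>i\<in>{1..j}. x \<in> b i \<and> r = insert (Bot i) (Top ` b i)) \<or> (\<exists>B\<in>N. x \<in> B \<and> r = Top ` B)"
      if "r \<in> half n j b N" "Top x \<in> r" for r x
      using that unfolding half_def by auto
    show ?thesis unfolding disjnt_def
    proof (rule ccontr)
      assume "p \<inter> q \<noteq> {}"
      then obtain z where z: "z \<in> p" "z \<in> q" by blast
      show False
      proof (cases z)
        case (Bot i)
        then have "p = q" using bot[OF p, of i] bot[OF q, of i] z by simp
        then show False using pq by blast
      next
        case (Top x)
        consider (11) i i' where "i \<in> {1..j}" "x \<in> b i" "p = insert (Bot i) (Top ` b i)"
            "i' \<in> {1..j}" "x \<in> b i'" "q = insert (Bot i') (Top ` b i')"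
          | (12) i B where "i \<in> {1..j}" "x \<in> b i" "B \<in> N" "x \<in> B"
          | (22) B B' where "B \<in> N" "x \<in> B" "p = Top ` B" "B' \<in> N" "x \<in> B'" "q = Top ` B'"
          using top[OF p, of x] top[OF q, of x] z Top by metis
        then show False
        proof cases
          case 11
          then have "i = i'" using D(3)[of i i'] by blast
          then show False using 11 pq by blast
        next
          case 12
          then show False using D(4) by blast
        next
          case 22
          then have "B = B'" using D(5)[of B B'] by blast
          then show False using 22 pq by blast
        qed
      qed
    qed
  qed
  show "{} \<notin> half n j b N" using D(2,6) unfolding half_def by auto
qed

lemma compat_half:
  "compat (half n j b N) v u \<longleftrightarrow>
    (\<forall>B\<in>N. \<forall>x\<in>B. \<forall>y\<in>B. v x = v y) \<and> (\<forall>i\<in>{1..j}. \<forall>x\<in>b i. v x = u i)"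
proof
  assume R: "compat (half n j b N) v u"
  have "v x = v y" if "B \<in> N" "x \<in> B" "y \<in> B" for B x y
  proof -
    have "Top ` B \<in> half n j b N" using that by (auto simp: half_def)
    from compatD[OF R this, of "Top x" "Top y"] show ?thesis using that by simp
  qed
  moreover have "v x = u i" if "i \<in> {1..j}" "x \<in> b i" for i x
  proof -
    have "insert (Bot i) (Top ` b i) \<in> half n j b N" using that by (auto simp: half_def)
    from compatD[OF R this, of "Top x" "Bot i"] show ?thesis using that by simp
  qed
  ultimately show "(\<forall>B\<in>N. \<forall>x\<in>B. \<forall>y\<in>B. v x = v y) \<and> (\<forall>i\<in>{1..j}. \<forall>x\<in>b i. v x = u i)" by blast
next
  assume "(\<forall>B\<in>N. \<forall>x\<in>B. \<forall>y\<in>B. v x = v y) \<and> (\<forall>i\<in>{1..j}. \<forall>x\<in>b i. v x = u i)"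
  then have N: "\<And>B x y. B \<in> N \<Longrightarrow> x \<in> B \<Longrightarrow> y \<in> B \<Longrightarrow> v x = v y"
    and b: "\<And>i x. i \<in> {1..j} \<Longrightarrow> x \<in> b i \<Longrightarrow> v x = u i" by blast+
  show "compat (half n j b N) v u" unfolding compat_def
  proof (intro ballI)
    fix B x y assume B: "B \<in> half n j b N" and xy: "x \<in> B" "y \<in> B"
    from B consider i where "i \<in> {1..j}" "B = insert (Bot i) (Top ` b i)"
      | C where "C \<in> N" "B = Top ` C" | i where "B = {Bot i}" unfolding half_def by blast
    then show "colour v u x = colour v u y"
    proof cases
      case (1 i)
      have "colour v u z = u i" if z: "z \<in> B" for z
      proof -
        have "z = Bot i \<or> (\<exists>x\<in>b i. z = Top x)" using z 1(2) by blast
        then show ?thesis using b[OF 1(1)] by fastforce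
      qed
      then show ?thesis using xy by blast
    next
      case (2 C)
      then obtain x' y' where "x = Top x'" "y = Top y'" "x' \<in> C" "y' \<in> C" using xy by blast
      then show ?thesis using N[OF 2(1), of x' y'] by simp
    qed (use xy in auto)
  qed
qed

lemma compat_halfD:
  assumes "compat (half n j b N) v u"
  shows "B \<in> N \<Longrightarrow> x \<in> B \<Longrightarrow> y \<in> B \<Longrightarrow> v x = v y" "i \<in> {1..j} \<Longrightarrow> x \<in> b i \<Longrightarrow> v x = u i"
proof -
  have 1: "\<forall>B\<in>N. \<forall>x\<in>B. \<forall>y\<in>B. v x = v y" and 2: "\<forall>i\<in>{1..j}. \<forall>x\<in>b i. v x = u i"
    using assms[unfolded compat_half] by (rule conjunct1, rule conjunct2)
  show "v x = v y" if "B \<in> N" "x \<in> B" "y \<in> B" using 1 that by blast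
  show "v x = u i" if "i \<in> {1..j}" "x \<in> b i" using 2 that by blast
qed

lemma half_eps:
  assumes h: "half_data n j b N"
  shows "stack n (half n j b N) (eps n j) = half n j b N"
proof (rule stack_eqI)
  show "(\<exists>w. compat (half n j b N) v w \<and> compat (eps n j) w u) = compat (half n j b N) v u" for v u
    unfolding compat_half compat_eps by auto
qed (use half_dataD(1)[OF h] in \<open>auto intro: half_partition eps_partition h\<close>)

text \<open>Going up and down a half diagram returns to the bottom point \<open>i\<close> through the block \<open>b i\<close>,
  which is nonempty and disjoint from the other blocks.\<close>

lemma flip_half_half:
  assumes h: "half_data n j b N"
  shows "stack n (flip (half n j b N)) (half n j b N) = eps n j"
proof (rule stack_eqI)
  note D = half_dataD[OF h]
  show "(\<exists>w. compat (flip (half n j b N)) v w \<and> compat (half n j b N) w u) = compat (eps n j) v u" for v u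
  proof
    assume "\<exists>w. compat (flip (half n j b N)) v w \<and> compat (half n j b N) w u"
    then obtain w where "compat (half n j b N) w v" "compat (half n j b N) w u"
      unfolding compat_flip by blast
    note w = compat_halfD(2)[OF this(1)] compat_halfD(2)[OF this(2)]
    show "compat (eps n j) v u" unfolding compat_eps
    proof
      fix i assume i: "i \<in> {1..j}"
      then obtain x where "x \<in> b i" using D(2)[OF i] by blast
      then show "v i = u i" using w[OF i] by metis
    qed
  next
    assume E: "compat (eps n j) v u"
    define w where "w x \<longleftrightarrow> (\<exists>i\<in>{1..j}. x \<in> b i \<and> v i)" for x
    have wb: "w x = v i" if "i \<in> {1..j}" "x \<in> b i" for x i
      using that D(3) unfolding w_def by blast
    have wN: "\<not> w x" if "B \<in> N" "x \<in> B" for B x using that D(4) unfolding w_def by blast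
    have const: "w x = w y" if "B \<in> N" "x \<in> B" "y \<in> B" for B x y
      using wN[OF that(1,2)] wN[OF that(1,3)] by simp
    have "compat (half n j b N) w v" unfolding compat_half
      by (intro conjI ballI) (erule (2) const, erule (1) wb)
    moreover have "compat (half n j b N) w u" unfolding compat_half
    proof (intro conjI ballI)
      fix i x assume i: "i \<in> {1..j}" "x \<in> b i"
      then show "w x = u i" using wb[OF i] bspec[OF E[unfolded compat_eps] i(1)] by simp
    qed (erule (2) const)
    ultimately show "\<exists>w. compat (flip (half n j b N)) v w \<and> compat (half n j b N) w u"
      unfolding compat_flip by blast
  qed
qed (use half_dataD(1)[OF h] in \<open>auto intro: half_partition flip_partition eps_partition h\<close>)

lemma stack_flip:
  assumes "partition_on (points n) a" "partition_on (points n) b"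
  shows "stack n (flip b) (flip a) = flip (stack n a b)"
  by (rule stack_eqI) (auto simp: compat_flip compat_stack assms stack_partition intro!: flip_partition assms)

lemma flip_eps: "j \<le> n \<Longrightarrow> flip (eps n j) = eps n j"
  by (rule compat_inject[of n]) (auto simp: compat_flip compat_eps intro!: flip_partition eps_partition)

definition tops :: "point set \<Rightarrow> nat set" where "tops B = {t. Top t \<in> B}"
definition bots :: "point set \<Rightarrow> nat set" where "bots B = {t. Bot t \<in> B}"

lemma tops_bots: "Top ` tops B \<union> Bot ` bots B = B"
proof -
  have "x \<in> Top ` tops B \<union> Bot ` bots B \<longleftrightarrow> x \<in> B" for x
    by (cases x) (auto simp: tops_def bots_def)
  then show ?thesis by blast
qed

lemma tops_flip: "tops (flip_pt ` B) = bots B" and bots_flip: "bots (flip_pt ` B) = tops B"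
  unfolding tops_def bots_def by (auto simp: image_iff) (metis flip_pt.simps flip_pt_flip_pt)+

lemma half_data_tops:
  assumes d: "partition_on (points n) d" and \<beta>: "bij_betw \<beta> {1..j} {B \<in> d. bots B \<noteq> {} \<and> tops B \<noteq> {}}"
  shows "half_data n j (\<lambda>i. tops (\<beta> i)) (tops ` {B \<in> d. bots B = {}})"
proof -
  let ?T = "{B \<in> d. bots B \<noteq> {} \<and> tops B \<noteq> {}}"
  have disj: "tops B \<inter> tops B' = {}" if "B \<in> d" "B' \<in> d" "B \<noteq> B'" for B B'
    using that disjointD[OF partition_onD2[OF d]] unfolding tops_def by blast
  have inj: "B = B'" if "B \<in> d" "B' \<in> d" "tops B = tops B'" "tops B \<noteq> {}" for B B'
    using disj that by blast
  have ne: "tops B \<noteq> {}" if "B \<in> d" "bots B = {}" for B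
    using tops_bots[of B] that partition_onD3[OF d] by auto
  have im: "(\<lambda>i. tops (\<beta> i)) ` {1..j} = tops ` ?T"
    using \<beta> by (metis (no_types) bij_betw_imp_surj_on image_image)
  have P: "partition_on {1..n} (tops ` {B \<in> d. bots B = {}} \<union> tops ` ?T)"
  proof (rule partition_onI)
    have "\<Union> (tops ` {B \<in> d. bots B = {}} \<union> tops ` ?T) = {t. Top t \<in> \<Union>d}"
      by (auto simp: tops_def)
    also have "\<dots> = {1..n}" unfolding partition_onD1[OF d, symmetric] by auto
    finally show "\<Union> (tops ` {B \<in> d. bots B = {}} \<union> tops ` ?T) = {1..n}" .
    show "disjnt p q" if "p \<in> tops ` {B \<in> d. bots B = {}} \<union> tops ` ?T"
      "q \<in> tops ` {B \<in> d. bots B = {}} \<union> tops ` ?T" "p \<noteq> q" for p q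
      using that disj unfolding disjnt_def by blast
    show "{} \<notin> tops ` {B \<in> d. bots B = {}} \<union> tops ` ?T" using ne by auto
  qed
  have inj_b: "inj_on (\<lambda>i. tops (\<beta> i)) {1..j}"
  proof (rule inj_onI)
    fix i i' assume i: "i \<in> {1..j}" "i' \<in> {1..j}" "tops (\<beta> i) = tops (\<beta> i')"
    then have "\<beta> i \<in> ?T" "\<beta> i' \<in> ?T" using bij_betwE[OF \<beta>] by blast+
    then have "\<beta> i = \<beta> i'" using inj[of "\<beta> i" "\<beta> i'"] i(3) by blast
    then show "i = i'" using inj_onD[OF bij_betw_imp_inj_on[OF \<beta>]] i(1,2) by blast
  qed
  moreover have "tops ` {B \<in> d. bots B = {}} \<inter> tops ` ?T = {}" using inj by blast
  moreover have "j \<le> n"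
  proof -
    have "b' \<noteq> {}" if "b' \<in> (\<lambda>i. tops (\<beta> i)) ` {1..j}" for b' using that unfolding im by auto
    then obtain c where c: "\<And>b'. b' \<in> (\<lambda>i. tops (\<beta> i)) ` {1..j} \<Longrightarrow> c b' \<in> b'" by (metis ex_in_conv)
    have "inj_on (\<lambda>i. c (tops (\<beta> i))) {1..j}"
    proof (rule inj_onI)
      fix i i' assume i: "i \<in> {1..j}" "i' \<in> {1..j}" "c (tops (\<beta> i)) = c (tops (\<beta> i'))"
      have "tops (\<beta> i) \<inter> tops (\<beta> i') \<noteq> {}" using c i by (metis disjoint_iff imageI)
      moreover have "\<beta> i \<in> d" "\<beta> i' \<in> d" using bij_betwE[OF \<beta>] i(1,2) by blast+
      ultimately have "\<beta> i = \<beta> i'" using disj by blast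
      then show "i = i'" using inj_onD[OF bij_betw_imp_inj_on[OF \<beta>]] i(1,2) by blast
    qed
    moreover have "(\<lambda>i. c (tops (\<beta> i))) ` {1..j} \<subseteq> {1..n}"
    proof (rule image_subsetI)
      fix i assume "i \<in> {1..j}"
      then have i: "tops (\<beta> i) \<in> (\<lambda>i. tops (\<beta> i)) ` {1..j}" by simp
      then have "c (tops (\<beta> i)) \<in> \<Union> (tops ` {B \<in> d. bots B = {}} \<union> tops ` ?T)"
        by (intro UnionI[OF UnI2[OF i[unfolded im]] c[OF i]])
      then show "c (tops (\<beta> i)) \<in> {1..n}" unfolding partition_onD1[OF P, symmetric] .
    qed
    ultimately have "card {1..j} \<le> card {1..n}" by (intro card_inj_on_le) auto
    then show ?thesis by simp
  qed
  ultimately show ?thesis unfolding half_data_def im using P by blast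
qed

text \<open>Cut every through strand in the middle. The upper and the lower part are half diagrams
  for one common numbering \<open>\<beta>\<close> of the through strands.\<close>

theorem diagram_factorization:
  assumes d: "partition_on (points n) d"
  obtains \<beta> where "bij_betw \<beta> {1..through_strands d} {B \<in> d. bots B \<noteq> {} \<and> tops B \<noteq> {}}"
    "half_data n (through_strands d) (\<lambda>i. tops (\<beta> i)) (tops ` {B \<in> d. bots B = {}})"
    "half_data n (through_strands d) (\<lambda>i. bots (\<beta> i)) (bots ` {B \<in> d. tops B = {}})"
    "d = stack n (half n (through_strands d) (\<lambda>i. tops (\<beta> i)) (tops ` {B \<in> d. bots B = {}}))
      (flip (half n (through_strands d) (\<lambda>i. bots (\<beta> i)) (bots ` {B \<in> d. tops B = {}})))"
proof -
  let ?T = "{B \<in> d. bots B \<noteq> {} \<and> tops B \<noteq> {}}"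
  let ?j = "through_strands d"
  have "finite ?T" using finite_elements[OF finite_points d] by simp
  moreover have card: "card ?T = ?j"
    unfolding through_strands_def tops_def bots_def by (rule arg_cong[where f=card]) blast
  ultimately obtain \<beta> where \<beta>: "bij_betw \<beta> {1..?j} ?T"
    using ex_bij_betw_nat_finite_1[of ?T] unfolding card by blast
  let ?p = "half n ?j (\<lambda>i. tops (\<beta> i)) (tops ` {B \<in> d. bots B = {}})"
  let ?q = "half n ?j (\<lambda>i. bots (\<beta> i)) (bots ` {B \<in> d. tops B = {}})"
  have h: "half_data n ?j (\<lambda>i. tops (\<beta> i)) (tops ` {B \<in> d. bots B = {}})"
    by (rule half_data_tops[OF d \<beta>])
  have inj: "inj_on ((`) flip_pt) X" for X
    by (rule inj_on_inverseI[where g="(`) flip_pt"]) (simp add: image_image)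
  have T': "{B \<in> flip d. bots B \<noteq> {} \<and> tops B \<noteq> {}} = (`) flip_pt ` ?T"
    by (auto simp: flip_def tops_flip bots_flip)
  have N': "tops ` {B \<in> flip d. bots B = {}} = bots ` {B \<in> d. tops B = {}}"
  proof -
    have "{B \<in> flip d. bots B = {}} = (`) flip_pt ` {B \<in> d. tops B = {}}"
      by (auto simp: flip_def bots_flip)
    then show ?thesis by (simp add: image_image tops_flip)
  qed
  have "bij_betw ((`) flip_pt \<circ> \<beta>) {1..?j} {B \<in> flip d. bots B \<noteq> {} \<and> tops B \<noteq> {}}"
    unfolding T' by (rule bij_betw_trans[OF \<beta>]) (simp add: bij_betw_def inj)
  from half_data_tops[OF flip_partition[OF d] this]
  have h': "half_data n ?j (\<lambda>i. bots (\<beta> i)) (bots ` {B \<in> d. tops B = {}})"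
    unfolding N' by (simp add: tops_flip)
  have p: "partition_on (points n) ?p" by (rule half_partition[OF h])
  have q: "partition_on (points n) (flip ?q)" by (intro flip_partition half_partition h')
  have colB: "(\<forall>x\<in>B. \<forall>y\<in>B. colour v u x = colour v u y) \<longleftrightarrow>
      (\<exists>c. (\<forall>t\<in>tops B. v t = c) \<and> (\<forall>t\<in>bots B. u t = c))" if "B \<noteq> {}" for B v u
  proof -
    have "(\<forall>x\<in>B. \<forall>y\<in>B. colour v u x = colour v u y) \<longleftrightarrow> (\<exists>c. \<forall>x\<in>B. colour v u x = c)"
      using that by (metis ex_in_conv)
    also have "\<dots> \<longleftrightarrow> (\<exists>c. \<forall>x\<in>Top ` tops B \<union> Bot ` bots B. colour v u x = c)"
      by (simp only: tops_bots)
    also have "\<dots> \<longleftrightarrow> (\<exists>c. (\<forall>t\<in>tops B. v t = c) \<and> (\<forall>t\<in>bots B. u t = c))"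
      by (simp add: ball_Un)
    finally show ?thesis .
  qed
  have ne: "B \<noteq> {}" if "B \<in> d" for B using partition_onD3[OF d] that by auto
  have "stack n ?p (flip ?q) = d"
  proof (rule stack_eqI[OF p q d])
    fix v u
    show "(\<exists>w. compat ?p v w \<and> compat (flip ?q) w u) = compat d v u"
    proof
      assume "\<exists>w. compat ?p v w \<and> compat (flip ?q) w u"
      then obtain w where pw: "compat ?p v w" and qw: "compat ?q u w"
        unfolding compat_flip by blast
      have w: "\<And>B x y. B \<in> d \<Longrightarrow> bots B = {} \<Longrightarrow> x \<in> tops B \<Longrightarrow> y \<in> tops B \<Longrightarrow> v x = v y"
        "\<And>i x. i \<in> {1..?j} \<Longrightarrow> x \<in> tops (\<beta> i) \<Longrightarrow> v x = w i"
        "\<And>B x y. B \<in> d \<Longrightarrow> tops B = {} \<Longrightarrow> x \<in> bots B \<Longrightarrow> y \<in> bots B \<Longrightarrow> u x = u y"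
        "\<And>i x. i \<in> {1..?j} \<Longrightarrow> x \<in> bots (\<beta> i) \<Longrightarrow> u x = w i"
        using compat_halfD(1)[OF pw, of "tops _"] compat_halfD(2)[OF pw]
          compat_halfD(1)[OF qw, of "bots _"] compat_halfD(2)[OF qw] by blast+
      have col: "\<exists>c. (\<forall>t\<in>tops B. v t = c) \<and> (\<forall>t\<in>bots B. u t = c)" if B: "B \<in> d" for B
      proof (cases "B \<in> ?T")
        case True
        then have "B \<in> \<beta> ` {1..?j}" using bij_betw_imp_surj_on[OF \<beta>] by simp
        then obtain i where i: "i \<in> {1..?j}" "B = \<beta> i" by (rule imageE)
        show ?thesis
          unfolding i(2) using w(2)[OF i(1)] w(4)[OF i(1)] by blast
      next
        case False
        then consider "bots B = {}" | "tops B = {}" using B by blast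
        then show ?thesis
        proof cases
          case 1
          obtain x where x: "x \<in> tops B" using 1 tops_bots[of B] ne[OF B] by auto
          show ?thesis using w(1)[OF B 1 _ x] 1 by blast
        next
          case 2
          obtain x where x: "x \<in> bots B" using 2 tops_bots[of B] ne[OF B] by auto
          show ?thesis using w(3)[OF B 2 _ x] 2 by blast
        qed
      qed
      show "compat d v u" unfolding compat_def
      proof
        fix B assume B: "B \<in> d"
        show "\<forall>x\<in>B. \<forall>y\<in>B. colour v u x = colour v u y"
          unfolding colB[OF ne[OF B]] by (rule col[OF B])
      qed
    next
      assume R: "compat d v u"
      have "\<exists>c. (\<forall>t\<in>tops B. v t = c) \<and> (\<forall>t\<in>bots B. u t = c)" if B: "B \<in> d" for B
        unfolding colB[OF ne[OF B], symmetric] by (rule bspec[OF R[unfolded compat_def] B])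
      then obtain c where c: "\<And>B. B \<in> d \<Longrightarrow> (\<forall>t\<in>tops B. v t = c B) \<and> (\<forall>t\<in>bots B. u t = c B)"
        by metis
      have "\<beta> i \<in> d" if "i \<in> {1..?j}" for i using bij_betwE[OF \<beta>] that by blast
      then have "\<forall>i\<in>{1..?j}. \<forall>x\<in>tops (\<beta> i). v x = c (\<beta> i)" "\<forall>i\<in>{1..?j}. \<forall>x\<in>bots (\<beta> i). u x = c (\<beta> i)"
        using c by auto
      moreover have "\<forall>B\<in>tops ` {B \<in> d. bots B = {}}. \<forall>x\<in>B. \<forall>y\<in>B. v x = v y"
        "\<forall>B\<in>bots ` {B \<in> d. tops B = {}}. \<forall>x\<in>B. \<forall>y\<in>B. u x = u y"
        using c by (metis (no_types, lifting) imageE mem_Collect_eq)+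
      ultimately have "compat ?p v (\<lambda>i. c (\<beta> i)) \<and> compat (flip ?q) (\<lambda>i. c (\<beta> i)) u"
        unfolding compat_flip compat_half by (intro conjI)
      then show "\<exists>w. compat ?p v w \<and> compat (flip ?q) w u" by blast
    qed
  qed
  then show ?thesis using that[OF \<beta> h h'] by metis
qed

section \<open>Truncated diagram monoids\<close>

text \<open>A monoid of diagrams that contains all partial identities.\<close>

locale diagram_monoid =
  fixes n :: nat and X :: "point set set monoid"
  assumes sub: "carrier X \<subseteq> carrier (Pa n)"
    and mult_eq: "mult X = stack n" and one_eq: "\<one>\<^bsub>X\<^esub> = eps n n"
    and closed: "a \<in> carrier X \<Longrightarrow> b \<in> carrier X \<Longrightarrow> stack n a b \<in> carrier X"
    and eps_closed: "j \<le> n \<Longrightarrow> eps n j \<in> carrier X"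
begin

lemma partition: "a \<in> carrier X \<Longrightarrow> partition_on (points n) a"
  using sub by (auto simp: carrier_Pa)

lemma assoc: "a \<in> carrier X \<Longrightarrow> b \<in> carrier X \<Longrightarrow> c \<in> carrier X \<Longrightarrow>
    stack n (stack n a b) c = stack n a (stack n b c)"
  by (intro stack_assoc partition)

lemma l_one': "a \<in> carrier X \<Longrightarrow> stack n (eps n n) a = a"
  and r_one': "a \<in> carrier X \<Longrightarrow> stack n a (eps n n) = a"
  by (simp_all add: stack_one partition)

lemma fin_monoid: "fin_monoid X"
proof
  show "finite (carrier X)"
    using fin_monoid.fin[OF fin_monoid_Pa] sub finite_subset by blast
qed (auto simp: mult_eq one_eq closed assoc l_one' r_one' eps_closed)

end

text \<open>A factorization \<open>d = p q\<close> at the minimal width \<open>j\<close>, together with a left inverse \<open>p'\<close> of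
  \<open>p\<close> and a right inverse \<open>q'\<close> of \<open>q\<close> up to the partial identity \<open>eps n j\<close>.\<close>

definition factors ::
  "nat \<Rightarrow> point set set monoid \<Rightarrow> point set set \<Rightarrow> point set set \<Rightarrow> point set set \<Rightarrow>
    point set set \<Rightarrow> point set set \<Rightarrow> bool" where
  "factors n X d p q p' q' \<longleftrightarrow> p \<in> carrier X \<and> q \<in> carrier X \<and> p' \<in> carrier X \<and> q' \<in> carrier X \<and>
     through_strands d \<le> n \<and> d = stack n p q \<and>
     stack n p' p = eps n (through_strands d) \<and> stack n q q' = eps n (through_strands d) \<and>
     stack n p (eps n (through_strands d)) = p \<and> stack n (eps n (through_strands d)) q = q"

locale factorizable_monoid = diagram_monoid +
  assumes factorizable: "d \<in> carrier X \<Longrightarrow> \<exists>p q p' q'. factors n X d p q p' q'"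

lemma factors_half:
  assumes d: "partition_on (points n) d"
    and hp: "half_data n (through_strands d) b N" and hq: "half_data n (through_strands d) b' N'"
    and eq: "d = stack n (half n (through_strands d) b N) (flip (half n (through_strands d) b' N'))"
    and mem: "half n (through_strands d) b N \<in> carrier X" "flip (half n (through_strands d) b N) \<in> carrier X"
      "half n (through_strands d) b' N' \<in> carrier X" "flip (half n (through_strands d) b' N') \<in> carrier X"
  shows "factors n X d (half n (through_strands d) b N) (flip (half n (through_strands d) b' N'))
     (flip (half n (through_strands d) b N)) (half n (through_strands d) b' N')"
proof -
  let ?j = "through_strands d" and ?p = "half n (through_strands d) b N"
    and ?q = "half n (through_strands d) b' N'"
  have j: "?j \<le> n" using half_dataD(1)[OF hp] .
  have "stack n (eps n ?j) (flip ?q) = flip (stack n ?q (eps n ?j))"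
    using stack_flip[OF half_partition[OF hq] eps_partition[OF j]] flip_eps[OF j] by simp
  then have "stack n (eps n ?j) (flip ?q) = flip ?q" using half_eps[OF hq] by simp
  then show ?thesis
    unfolding factors_def
    using mem j eq half_eps[OF hp] flip_half_half[OF hp] flip_half_half[OF hq] by blast
qed

lemma diagram_monoid_Pa: "diagram_monoid n (Pa n)"
  by unfold_locales (auto simp: mult_Pa one_Pa carrier_Pa stack_partition eps_partition)

lemma factorizable_Pa: "factorizable_monoid n (Pa n)"
proof -
  interpret diagram_monoid n "Pa n" by (rule diagram_monoid_Pa)
  show ?thesis
  proof
    fix d assume "d \<in> carrier (Pa n)"
    then have d: "partition_on (points n) d" by (simp add: carrier_Pa)
    obtain \<beta> where h: "half_data n (through_strands d) (\<lambda>i. tops (\<beta> i)) (tops ` {B \<in> d. bots B = {}})"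
      "half_data n (through_strands d) (\<lambda>i. bots (\<beta> i)) (bots ` {B \<in> d. tops B = {}})"
      "d = stack n (half n (through_strands d) (\<lambda>i. tops (\<beta> i)) (tops ` {B \<in> d. bots B = {}}))
        (flip (half n (through_strands d) (\<lambda>i. bots (\<beta> i)) (bots ` {B \<in> d. tops B = {}})))"
      by (rule diagram_factorization[OF d])
    have "factors n (Pa n) d (half n (through_strands d) (\<lambda>i. tops (\<beta> i)) (tops ` {B \<in> d. bots B = {}}))
        (flip (half n (through_strands d) (\<lambda>i. bots (\<beta> i)) (bots ` {B \<in> d. tops B = {}})))
        (flip (half n (through_strands d) (\<lambda>i. tops (\<beta> i)) (tops ` {B \<in> d. bots B = {}})))
        (half n (through_strands d) (\<lambda>i. bots (\<beta> i)) (bots ` {B \<in> d. tops B = {}}))"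
      by (rule factors_half[OF d h(1,2,3)])
        (simp_all add: carrier_Pa half_partition[OF h(1)] half_partition[OF h(2)] flip_partition)
    then show "\<exists>p q p' q'. factors n (Pa n) d p q p' q'" by blast
  qed
qed

text \<open>Factor the inner diagram \<open>a\<close> through \<open>eps n j\<close> and the product through \<open>eps n i\<close>. Then
  \<open>eps n i\<close> factors through \<open>eps n j\<close>.\<close>

lemma through_strands_stack_le:
  assumes x: "partition_on (points n) x" and a: "partition_on (points n) a"
    and y: "partition_on (points n) y"
  shows "through_strands (stack n (stack n x a) y) \<le> through_strands a"
proof -
  interpret P: factorizable_monoid n "Pa n" by (rule factorizable_Pa)
  let ?d = "stack n (stack n x a) y"
  have c: "x \<in> carrier (Pa n)" "a \<in> carrier (Pa n)" "y \<in> carrier (Pa n)" "?d \<in> carrier (Pa n)"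
    using x a y by (simp_all add: carrier_Pa stack_partition)
  obtain p q p' q' where F: "factors n (Pa n) a p q p' q'" using P.factorizable c by blast
  obtain r s r' s' where G: "factors n (Pa n) ?d r s r' s'" using P.factorizable c by blast
  let ?j = "through_strands a" and ?i = "through_strands ?d"
  have ij: "?j \<le> n" "?i \<le> n" using F G by (auto simp: factors_def)
  have pc: "p \<in> carrier (Pa n)" "q \<in> carrier (Pa n)" and a_eq: "a = stack n (stack n p (eps n ?j)) q"
    using F unfolding factors_def by auto
  have rc: "r \<in> carrier (Pa n)" "s \<in> carrier (Pa n)" "r' \<in> carrier (Pa n)" "s' \<in> carrier (Pa n)"
    and G': "?d = stack n r s" "stack n r' r = eps n ?i" "stack n s s' = eps n ?i"
    using G unfolding factors_def by auto
  have "eps n ?i = stack n (stack n r' r) (stack n s s')"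
    using G' ij by (simp add: stack_eps)
  also have "\<dots> = stack n (stack n r' (stack n r s)) s'"
    using rc by (simp add: P.assoc P.closed)
  also have "\<dots> = stack n (stack n r' ?d) s'" using G'(1) by simp
  also have "\<dots> = stack n (stack n (stack n r' (stack n x p)) (eps n ?j)) (stack n q (stack n y s'))"
    by (subst a_eq) (use c pc rc ij in \<open>simp add: P.assoc P.closed P.eps_closed\<close>)
  finally show ?thesis
    by (intro eps_rank_le[OF _ _ ij]) (use c pc rc in \<open>auto simp: P.closed P.partition\<close>)
qed

text \<open>Both sides put no condition on the outer colouring, since the constant colouring is
  always admissible in the middle.\<close>

lemma eps_0_absorb:
  assumes "partition_on (points n) x"
  shows "stack n (stack n (eps n 0) x) (eps n 0) = eps n 0"
proof (rule stack_eqI)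
  have "compat x (\<lambda>_. False) (\<lambda>_. False)"
    unfolding compat_def by (metis (full_types) colour.elims)
  then show "(\<exists>w. compat (stack n (eps n 0) x) v w \<and> compat (eps n 0) w u) = compat (eps n 0) v u" for v u
    by (auto simp: compat_stack[OF eps_partition assms] compat_eps)
qed (simp_all add: stack_partition eps_partition)

context diagram_monoid
begin

lemma mult_trunc: "mult (trunc X k) = stack n" and one_trunc: "\<one>\<^bsub>trunc X k\<^esub> = eps n n"
  by (simp_all add: trunc_def mult_eq one_eq)

lemma trunc_sub: "carrier (trunc X k) \<subseteq> carrier X"
  using eps_closed[of n] by (auto simp: trunc_def one_eq)

lemma trunc_partition: "a \<in> carrier (trunc X k) \<Longrightarrow> partition_on (points n) a"
  using trunc_sub partition by blast

lemma in_trunc_iff: "s \<in> carrier (trunc X k) \<longleftrightarrow> s \<in> carrier X \<and>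
    (s = eps n n \<or> (\<exists>a\<in>J X k. \<exists>x\<in>carrier X. \<exists>y\<in>carrier X. s = stack n (stack n x a) y))"
  using eps_closed[of n] by (auto simp: trunc_def one_eq le_lr_def mult_eq)

lemma trunc_closed:
  assumes s: "s \<in> carrier (trunc X k)" and t: "t \<in> carrier (trunc X k)"
  shows "stack n s t \<in> carrier (trunc X k)"
proof -
  have c: "s \<in> carrier X" "t \<in> carrier X" using s t trunc_sub by auto
  show ?thesis
  proof (cases "s = eps n n")
    case True
    then show ?thesis using t c by (simp add: l_one')
  next
    case False
    then obtain a x y where a: "a \<in> J X k" "x \<in> carrier X" "y \<in> carrier X" "s = stack n (stack n x a) y"
      using s unfolding in_trunc_iff by blast
    have "a \<in> carrier X" using a by (simp add: J_def)
    then have "stack n s t = stack n (stack n x a) (stack n y t)" using a c by (simp add: assoc closed)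
    then show ?thesis unfolding in_trunc_iff using a c closed by blast
  qed
qed

lemma fin_monoid_trunc: "fin_monoid (trunc X k)"
proof
  show "finite (carrier (trunc X k))"
    using fin_monoid.fin[OF fin_monoid] trunc_sub finite_subset by blast
next
  note c = subsetD[OF trunc_sub]
  fix x y z assume x: "x \<in> carrier (trunc X k)" and y: "y \<in> carrier (trunc X k)"
  show "x \<otimes>\<^bsub>trunc X k\<^esub> y \<in> carrier (trunc X k)" using trunc_closed[OF x y] by (simp add: mult_trunc)
  show "\<one>\<^bsub>trunc X k\<^esub> \<otimes>\<^bsub>trunc X k\<^esub> x = x" "x \<otimes>\<^bsub>trunc X k\<^esub> \<one>\<^bsub>trunc X k\<^esub> = x"
    unfolding mult_trunc one_trunc using l_one'[OF c[OF x]] r_one'[OF c[OF x]] by simp_all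
  assume z: "z \<in> carrier (trunc X k)"
  show "x \<otimes>\<^bsub>trunc X k\<^esub> y \<otimes>\<^bsub>trunc X k\<^esub> z = x \<otimes>\<^bsub>trunc X k\<^esub> (y \<otimes>\<^bsub>trunc X k\<^esub> z)"
    unfolding mult_trunc by (rule assoc[OF c[OF x] c[OF y] c[OF z]])
qed (simp add: one_trunc in_trunc_iff eps_closed)

lemma through_strands_trunc_le:
  assumes "d \<in> carrier (trunc X k)" "d \<noteq> eps n n"
  shows "through_strands d \<le> k"
proof -
  obtain a x y where a: "a \<in> J X k" "x \<in> carrier X" "y \<in> carrier X" "d = stack n (stack n x a) y"
    using assms unfolding in_trunc_iff by blast
  then have "a \<in> carrier X" "through_strands a = k" by (simp_all add: J_def)
  then show ?thesis using through_strands_stack_le[of n x a y] a partition by metis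
qed

lemma eps_in_trunc:
  assumes "j \<le> k" "k \<le> n"
  shows "eps n j \<in> carrier (trunc X k)"
proof -
  have "eps n k \<in> J X k" using assms by (simp add: J_def eps_closed through_strands_eps)
  moreover have "eps n j = stack n (stack n (eps n n) (eps n k)) (eps n j)"
    using assms by (simp add: stack_eps min_def)
  ultimately show ?thesis unfolding in_trunc_iff using assms eps_closed by (meson le_trans order_refl)
qed

lemma conical_trunc:
  assumes "k < n"
  shows "conical_monoid (trunc X k)"
proof -
  interpret T: fin_monoid "trunc X k" by (rule fin_monoid_trunc)
  show ?thesis
  proof
    fix s t assume s: "s \<in> carrier (trunc X k)" and t: "t \<in> carrier (trunc X k)"
      and st: "s \<otimes>\<^bsub>trunc X k\<^esub> t = \<one>\<^bsub>trunc X k\<^esub>"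
    show "s = \<one>\<^bsub>trunc X k\<^esub>"
    proof (rule ccontr)
      assume "s \<noteq> \<one>\<^bsub>trunc X k\<^esub>"
      then have le: "through_strands s \<le> k" using through_strands_trunc_le s by (simp add: one_trunc)
      have "eps n n = stack n (stack n (eps n n) s) t"
        using s t st trunc_sub[of k] by (simp add: mult_trunc one_trunc l_one' subset_iff)
      moreover have "through_strands (stack n (stack n (eps n n) s) t) \<le> through_strands s"
        by (rule through_strands_stack_le[OF eps_partition trunc_partition[OF s] trunc_partition[OF t]]) simp
      ultimately have "through_strands (eps n n) \<le> through_strands s" by metis
      then show False using le assms by (simp add: through_strands_eps)
    qed
  qed
qed

lemma not_le_lr_eps_0:
  assumes "1 \<le> j" "j \<le> n"
  shows "\<not> le_lr (trunc X k) (eps n 0) (eps n j)"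
proof
  assume "le_lr (trunc X k) (eps n 0) (eps n j)"
  then obtain x y where xy: "x \<in> carrier (trunc X k)" "y \<in> carrier (trunc X k)"
    "eps n j = stack n (stack n x (eps n 0)) y" unfolding le_lr_def mult_trunc by blast
  have "j \<le> 0"
    by (rule eps_rank_le[OF trunc_partition[OF xy(1)] trunc_partition[OF xy(2)] _ assms(2) xy(3)]) simp
  then show False using assms by simp
qed

lemma eps_neq: "j < n \<Longrightarrow> eps n j \<noteq> eps n n"
  using through_strands_eps[of j n] through_strands_eps[of n n] by auto

theorem ssgap_trunc_le:
  assumes k: "k < n" and j: "1 \<le> j" "j \<le> k"
  shows "ssgap (F :: 'f::field itself) (trunc X k) \<le> ereal (real (num_r_cells (trunc X k) (eps n j)))"
proof -
  interpret T: conical_monoid "trunc X k" by (rule conical_trunc[OF k])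
  show ?thesis
  proof (rule T.ssgap_le)
    show "eps n j \<in> carrier (trunc X k)" "eps n 0 \<in> carrier (trunc X k)"
      using j k by (auto intro: eps_in_trunc)
    show "\<not> le_lr (trunc X k) (eps n 0) (eps n j)" using j k by (intro not_le_lr_eps_0) auto
  qed (use j k eps_neq[of j] in \<open>auto simp: mult_trunc one_trunc stack_eps\<close>)
qed

end

context factorizable_monoid
begin

text \<open>If \<open>p eps n j = p\<close> with \<open>j \<le> k\<close>, then also \<open>p eps n k = p\<close>, so \<open>p\<close> lies in the ideal
  generated by a diagram with \<open>k\<close> through strands.\<close>

lemma in_trunc_if_eps_right:
  assumes p: "p \<in> carrier X" and "stack n p (eps n j) = p" "j \<le> k" "k \<le> n"
  shows "p \<in> carrier (trunc X k)"
proof -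
  have ec: "eps n j \<in> carrier X" "eps n k \<in> carrier X" "eps n n \<in> carrier X" using assms eps_closed by auto
  have "stack n p (eps n k) = stack n p (stack n (eps n j) (eps n k))"
    using assms ec by (simp flip: assoc)
  also have "\<dots> = p" using assms by (simp add: stack_eps min_def)
  finally have "p = stack n (stack n p (eps n k)) (eps n n)" using p by (simp add: r_one')
  moreover have "eps n k \<in> J X k" using assms ec by (simp add: J_def through_strands_eps)
  ultimately show ?thesis unfolding in_trunc_iff using p ec by blast
qed

lemma in_trunc_if_eps_left:
  assumes q: "q \<in> carrier X" and "stack n (eps n j) q = q" "j \<le> k" "k \<le> n"
  shows "q \<in> carrier (trunc X k)"
proof -
  have ec: "eps n j \<in> carrier X" "eps n k \<in> carrier X" "eps n n \<in> carrier X" using assms eps_closed by auto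
  have "stack n (eps n k) q = stack n (stack n (eps n k) (eps n j)) q"
    using assms ec by (simp add: assoc)
  also have "\<dots> = q" using assms by (simp add: stack_eps min_def)
  finally have "q = stack n (stack n (eps n n) (eps n k)) q" using ec assms by (simp add: l_one')
  moreover have "eps n k \<in> J X k" using assms ec by (simp add: J_def through_strands_eps)
  ultimately show ?thesis unfolding in_trunc_iff using q ec by blast
qed

lemma factors_in_trunc:
  assumes "factors n X d p q p' q'" "through_strands d \<le> k" "k \<le> n"
  shows "p \<in> carrier (trunc X k)" "q \<in> carrier (trunc X k)" "d \<in> carrier (trunc X k)"
proof -
  show p: "p \<in> carrier (trunc X k)" and q: "q \<in> carrier (trunc X k)"
    using assms in_trunc_if_eps_right in_trunc_if_eps_left unfolding factors_def by blast+
  have "d = stack n p q" using assms by (simp add: factors_def)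
  then show "d \<in> carrier (trunc X k)" using trunc_closed p q by simp
qed

lemma carrier_trunc:
  assumes "k \<le> n"
  shows "carrier (trunc X k) = {d \<in> carrier X. through_strands d \<le> k} \<union> {eps n n}"
proof
  show "carrier (trunc X k) \<subseteq> {d \<in> carrier X. through_strands d \<le> k} \<union> {eps n n}"
    using through_strands_trunc_le trunc_sub by blast
  show "{d \<in> carrier X. through_strands d \<le> k} \<union> {eps n n} \<subseteq> carrier (trunc X k)"
  proof
    fix d assume d: "d \<in> {d \<in> carrier X. through_strands d \<le> k} \<union> {eps n n}"
    show "d \<in> carrier (trunc X k)"
    proof (cases "d = eps n n")
      case True
      then show ?thesis by (simp add: in_trunc_iff eps_closed)
    next
      case False
      then show ?thesis using d factors_in_trunc(3) factorizable assms by blast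
    qed
  qed
qed

text \<open>From \<open>e = p q\<close> and \<open>e e = e\<close> one cancels \<open>p\<close> on the left and \<open>q\<close> on the right in \<open>p q p q
  = p q\<close> to obtain that \<open>q p\<close> is the partial identity.\<close>

lemma idempotent_conjugate_eps:
  assumes e: "e \<in> carrier X" "stack n e e = e" and j: "through_strands e \<le> k" "k \<le> n"
  obtains p q where "p \<in> carrier (trunc X k)" "q \<in> carrier (trunc X k)"
    "stack n p q = e" "stack n q p = eps n (through_strands e)"
proof -
  let ?e = "eps n (through_strands e)"
  obtain p q p' q' where F: "factors n X e p q p' q'" using factorizable e by blast
  have c: "p \<in> carrier X" "q \<in> carrier X" "p' \<in> carrier X" "q' \<in> carrier X"
    and e_eq: "e = stack n p q" and p': "stack n p' p = ?e" and q': "stack n q q' = ?e"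
    and pe: "stack n p ?e = p" and eq: "stack n ?e q = q" and le: "through_strands e \<le> n"
    using F unfolding factors_def by auto
  have "stack n q p = stack n (stack n ?e q) (stack n p ?e)" using pe eq by simp
  also have "\<dots> = stack n (stack n (stack n p' p) q) (stack n p (stack n q q'))" using p' q' by simp
  also have "\<dots> = stack n p' (stack n (stack n (stack n p q) (stack n p q)) q')"
    using c by (simp add: assoc closed)
  also have "\<dots> = stack n p' (stack n (stack n p q) q')" using e e_eq by simp
  also have "\<dots> = stack n (stack n p' p) (stack n q q')" using c by (simp add: assoc closed)
  also have "\<dots> = ?e" using p' q' le by (simp add: stack_eps)
  finally have "stack n q p = ?e" .
  then show ?thesis using that factors_in_trunc[OF F j] e_eq by metis
qed

text \<open>A diagram without through strands factors through \<open>eps n 0\<close>, which absorbs everything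
  between two copies of itself.\<close>

lemma rank_zero_absorb:
  assumes e: "e \<in> carrier X" "through_strands e = 0" and s: "s \<in> carrier X"
  shows "stack n (stack n e s) e = e"
proof -
  obtain p q p' q' where F: "factors n X e p q p' q'" using factorizable e by blast
  have c: "p \<in> carrier X" "q \<in> carrier X" "eps n 0 \<in> carrier X" using F eps_closed by (auto simp: factors_def)
  have pe: "stack n p (eps n 0) = p" and eq: "stack n (eps n 0) q = q" and e_eq: "e = stack n p q"
    using F e(2) by (auto simp: factors_def)
  have e_eq': "e = stack n (stack n p (eps n 0)) q" using pe e_eq by simp
  have "stack n (stack n e s) e =
    stack n p (stack n (stack n (stack n (eps n 0) (stack n q (stack n s p))) (eps n 0)) q)"
    using c s unfolding e_eq' by (simp add: assoc closed)
  also have "stack n (stack n (eps n 0) (stack n q (stack n s p))) (eps n 0) = eps n 0"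
    using c s by (intro eps_0_absorb partition closed)
  finally show ?thesis using eq e_eq by simp
qed

text \<open>Only the partial identities with \<open>1 \<le> j \<le> k\<close> strands matter: every nontrivial idempotent
  is conjugate to one of them.\<close>

theorem le_ssgap_trunc:
  assumes k: "k < n" and b: "\<And>j. 1 \<le> j \<Longrightarrow> j \<le> k \<Longrightarrow> b \<le> ereal (real (num_r_cells (trunc X k) (eps n j)))"
  shows "b \<le> ssgap (F :: 'f::field itself) (trunc X k)"
proof -
  interpret T: conical_monoid "trunc X k" by (rule conical_trunc[OF k])
  show ?thesis
  proof (rule T.le_ssgap)
    fix e assume e: "e \<in> carrier (trunc X k)" "e \<otimes>\<^bsub>trunc X k\<^esub> e = e" "e \<noteq> \<one>\<^bsub>trunc X k\<^esub>"
      and ne: "\<exists>s\<in>carrier (trunc X k). e \<otimes>\<^bsub>trunc X k\<^esub> s \<otimes>\<^bsub>trunc X k\<^esub> e \<noteq> e"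
    let ?j = "through_strands e"
    have ec: "e \<in> carrier X" "stack n e e = e" using e trunc_sub by (auto simp: mult_trunc)
    have jk: "?j \<le> k" using through_strands_trunc_le e by (simp add: one_trunc)
    have j1: "1 \<le> ?j"
    proof (rule ccontr)
      assume "\<not> 1 \<le> ?j"
      then show False using rank_zero_absorb[OF ec(1)] ne trunc_sub[of k] by (auto simp: mult_trunc)
    qed
    obtain p q where pq: "p \<in> carrier (trunc X k)" "q \<in> carrier (trunc X k)"
      "stack n p q = e" "stack n q p = eps n ?j"
      using idempotent_conjugate_eps[OF ec jk] k by auto
    have "num_r_cells (trunc X k) e = num_r_cells (trunc X k) (eps n ?j)"
      by (rule T.num_r_cells_conjugate[OF pq(1,2)]) (use pq ec jk k in \<open>auto simp: mult_trunc stack_eps\<close>)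
    then show "b \<le> ereal (real (num_r_cells (trunc X k) e))" using b[OF j1 jk] by simp
  qed
qed

end

text \<open>The idempotents that have to be conjugated into the smaller monoid are those of the large
  monoid \<open>X\<close>, so it is \<open>X\<close> that must have factorizations.\<close>

locale diagram_pair = Y: diagram_monoid n Y + X: factorizable_monoid n X
  for n :: nat and Y X :: "point set set monoid" +
  assumes pair_sub: "carrier Y \<subseteq> carrier X"
begin

lemma submonoid_trunc: "submonoid_pair (trunc Y k) (trunc X k)"
proof -
  interpret T: fin_monoid "trunc Y k" by (rule Y.fin_monoid_trunc)
  interpret S: fin_monoid "trunc X k" by (rule X.fin_monoid_trunc)
  show ?thesis
  proof
    have "J Y k \<subseteq> J X k" using pair_sub by (auto simp: J_def)
    then show "carrier (trunc Y k) \<subseteq> carrier (trunc X k)"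
      unfolding subset_iff Y.in_trunc_iff X.in_trunc_iff using pair_sub by blast
  qed (simp_all add: Y.mult_trunc X.mult_trunc Y.one_trunc X.one_trunc)
qed

theorem faith_trunc: "faith (F :: 'f::field itself) (trunc Y k) \<le> faith F (trunc X k)"
proof -
  interpret submonoid_pair "trunc Y k" "trunc X k" by (rule submonoid_trunc)
  show ?thesis by (rule faith_mono)
qed

text \<open>Each idempotent of the large monoid is conjugate there to \<open>eps n j\<close>, which lies in the
  small monoid and has no more right cells to meet there.\<close>

theorem ssgap_trunc:
  assumes k: "k < n"
  shows "ssgap (F :: 'f::field itself) (trunc Y k) \<le> ssgap F (trunc X k)"
proof (rule X.le_ssgap_trunc[OF k])
  fix j assume j: "1 \<le> j" "j \<le> k"
  interpret submonoid_pair "trunc Y k" "trunc X k" by (rule submonoid_trunc)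
  have "num_r_cells (trunc Y k) (eps n j) \<le> num_r_cells (trunc X k) (id (eps n j))"
    by (rule num_r_cells_mono) (use j k in \<open>auto simp: Y.eps_in_trunc Y.mult_trunc stack_eps\<close>)
  then show "ssgap F (trunc Y k) \<le> ereal (real (num_r_cells (trunc X k) (eps n j)))"
    using Y.ssgap_trunc_le[OF k j, of F] by (simp add: order_trans)
qed

end

section \<open>Stacking preserves planarity and small blocks\<close>

text \<open>The equivalence relation generated by \<open>E\<close>, described by two-colourings to match the
  description of stacking.\<close>

definition gen :: "(nat \<times> nat) set \<Rightarrow> nat \<Rightarrow> nat \<Rightarrow> bool" where
  "gen E p q \<longleftrightarrow> (\<forall>f :: nat \<Rightarrow> bool. (\<forall>(x, y)\<in>E. f x = f y) \<longrightarrow> f p = f q)"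

lemma gen_refl [simp]: "gen E p p"
  by (simp add: gen_def)

lemma gen_sym: "gen E p q \<Longrightarrow> gen E q p"
  unfolding gen_def by metis

lemma gen_trans: "gen E p q \<Longrightarrow> gen E q r \<Longrightarrow> gen E p r"
  unfolding gen_def by metis

lemma gen_base: "(p, q) \<in> E \<Longrightarrow> gen E p q"
  unfolding gen_def by blast

lemma gen_mono: "gen E p q \<Longrightarrow> E \<subseteq> E' \<Longrightarrow> gen E' p q"
  unfolding gen_def by blast

text \<open>Adding one pair merges two classes.\<close>

lemma gen_insert:
  "gen (insert (u, v) E) p q \<longleftrightarrow> gen E p q \<or> (gen E p u \<or> gen E p v) \<and> (gen E q u \<or> gen E q v)"
proof
  assume L: "gen (insert (u, v) E) p q"
  define f where "f t \<longleftrightarrow> gen E p t \<or> (gen E p u \<or> gen E p v) \<and> (gen E t u \<or> gen E t v)" for t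
  have "f x = f y" if "gen E x y" for x y
    using that unfolding f_def by (meson gen_sym gen_trans)
  moreover have "f u = f v" unfolding f_def by (meson gen_refl gen_sym)
  ultimately have "f p = f q"
    using L[unfolded gen_def, rule_format, of f] gen_base by blast
  then show "gen E p q \<or> (gen E p u \<or> gen E p v) \<and> (gen E q u \<or> gen E q v)"
    by (simp add: f_def)
next
  assume R: "gen E p q \<or> (gen E p u \<or> gen E p v) \<and> (gen E q u \<or> gen E q v)"
  have uv: "gen (insert (u, v) E) u v" by (rule gen_base) simp
  have m: "gen E x y \<Longrightarrow> gen (insert (u, v) E) x y" for x y by (rule gen_mono) auto
  show "gen (insert (u, v) E) p q" using R uv m by (meson gen_sym gen_trans)
qed

definition noncrossing :: "nat set \<Rightarrow> (nat \<Rightarrow> nat \<Rightarrow> bool) \<Rightarrow> bool" where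
  "noncrossing D r \<longleftrightarrow> (\<forall>w\<in>D. \<forall>x\<in>D. \<forall>y\<in>D. \<forall>z\<in>D.
     w < x \<and> x < y \<and> y < z \<and> r w y \<and> r x z \<longrightarrow> r w x)"

definition at_most_pairs :: "nat set \<Rightarrow> (nat \<Rightarrow> nat \<Rightarrow> bool) \<Rightarrow> bool" where
  "at_most_pairs D r \<longleftrightarrow> (\<forall>x\<in>D. \<forall>y\<in>D. \<forall>z\<in>D. r x y \<and> r x z \<longrightarrow> x = y \<or> x = z \<or> y = z)"

text \<open>Let \<open>M\<close> be the merged class. A crossing of \<open>M\<close> with another chord would be a crossing of
  this chord with a chord from \<open>p\<close> or from \<open>q\<close> within one of the old classes: as \<open>p\<close> and \<open>q\<close> are
  neighbours among the remaining points, they lie on the same side of every other chord, so it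
  does not matter which of them an end of the \<open>M\<close>-chord is attached to. Afterwards \<open>p\<close> and \<open>q\<close>
  are forgotten, so that the next pair becomes adjacent.\<close>

lemma noncrossing_merge_adjacent:
  assumes nc: "noncrossing D (gen E)" and pq: "p \<in> D" "q \<in> D" "p < q"
    and adj: "\<And>x. x \<in> D \<Longrightarrow> x \<le> p \<or> q \<le> x"
  shows "noncrossing (D - {p, q}) (gen (insert (p, q) E))"
  unfolding noncrossing_def
proof (intro ballI impI)
  fix w x y z
  assume D': "w \<in> D - {p, q}" "x \<in> D - {p, q}" "y \<in> D - {p, q}" "z \<in> D - {p, q}"
    and A: "w < x \<and> x < y \<and> y < z \<and> gen (insert (p, q) E) w y \<and> gen (insert (p, q) E) x z"
  then have D: "w \<in> D" "x \<in> D" "y \<in> D" "z \<in> D" and lt: "w < x" "x < y" "y < z" by auto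
  define M where "M t \<longleftrightarrow> gen E t p \<or> gen E t q" for t
  have M_rep: "\<exists>p'\<in>{p, q}. gen E t p'" if "M t" for t using that by (auto simp: M_def)
  have M_trans: "M t = M t'" if "gen E t t'" for t t'
    using that unfolding M_def by (meson gen_sym gen_trans)
  have Mpq: "M p" "M q" by (simp_all add: M_def)
  have NC: "gen E s t" if "s \<in> D" "t \<in> D" "u \<in> D" "v \<in> D" "s < t" "t < u" "u < v" "gen E s u" "gen E t v" for s t u v
    using nc that unfolding noncrossing_def by blast
  have r': "gen (insert (p, q) E) s t \<longleftrightarrow> gen E s t \<or> M s \<and> M t" for s t
    unfolding M_def by (rule gen_insert)
  (* The neighbours p and q lie on the same side of every chord that avoids them. *)
  have side: "(s < p' \<and> p' < t) = (s < p'' \<and> p'' < t)"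
    if "s \<in> D - {p, q}" "t \<in> D - {p, q}" "p' \<in> {p, q}" "p'' \<in> {p, q}" for s t p' p''
    using that adj[of s] adj[of t] pq(3) by force
  have Dpq: "p' \<in> D" "p' \<notin> {w, x, y, z}" "M p'" if "p' \<in> {p, q}" for p' using that pq D' Mpq by auto
  show "gen (insert (p, q) E) w x"
  proof (cases "M w \<and> M x")
    case False
    consider "gen E w y" "gen E x z" | "gen E w y" "\<not> M w" "M x" "M z" | "gen E x z" "M w" "M y" "\<not> M x"
      using A False unfolding r' by blast
    then show ?thesis
    proof cases
      case 1
      then show ?thesis using NC[OF D lt] r' by blast
    next
      case 2
      then have My: "\<not> M y" using M_trans by blast
      obtain x' where x': "x' \<in> {p, q}" "gen E x x'" using M_rep 2 by blast
      obtain z' where z': "z' \<in> {p, q}" "gen E z z'" using M_rep 2 by blast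
      note Dx = Dpq[OF x'(1)] and Dz = Dpq[OF z'(1)]
      show ?thesis
      proof (cases "w < x' \<and> x' < y")
        case True
        then have "w < z'" "z' < y" using side[OF D'(1,3) x'(1) z'(1)] by auto
        then have "gen E w z'" using NC[of w z' y z] D Dz lt 2(1) gen_sym[OF z'(2)] by blast
        then show ?thesis using M_trans Dz 2 by blast
      next
        case False
        then have "x' < w \<or> y < x'" using Dx by force
        then show ?thesis
        proof
          assume "x' < w"
          then have "gen E x' w" using NC[of x' w x y] D Dx lt 2(1) gen_sym[OF x'(2)] by blast
          then show ?thesis using M_trans Dx 2 by blast
        next
          assume "y < x'"
          then have "gen E w x" using NC[of w x y x'] D Dx lt 2(1) x'(2) by blast
          then show ?thesis using r' by blast
        qed
      qed
    next
      case 3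
      obtain y' where y': "y' \<in> {p, q}" "gen E y y'" using M_rep 3 by blast
      obtain w' where w': "w' \<in> {p, q}" "gen E w w'" using M_rep 3 by blast
      note Dy = Dpq[OF y'(1)] and Dw = Dpq[OF w'(1)]
      show ?thesis
      proof (cases "x < y' \<and> y' < z")
        case True
        then have "x < w'" "w' < z" using side[OF D'(2,4) y'(1) w'(1)] by auto
        then have "gen E w x" using NC[of w x w' z] D Dw lt 3(1) w'(2) by blast
        then show ?thesis using r' by blast
      next
        case False
        then have "y' < x \<or> z < y'" using Dy by force
        then show ?thesis
        proof
          assume "y' < x"
          then have "gen E y' x" using NC[of y' x y z] D Dy lt 3(1) gen_sym[OF y'(2)] by blast
          then show ?thesis using M_trans Dy 3 by blast
        next
          assume "z < y'"
          then have "gen E x y" using NC[of x y z y'] D Dy lt 3(1) y'(2) by blast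
          then show ?thesis using M_trans gen_sym 3 by blast
        qed
      qed
    qed
  qed (use r' in blast)
qed

text \<open>Forgetting \<open>p\<close> and \<open>q\<close> leaves at most one further point in each of the two classes that
  are merged.\<close>

lemma at_most_pairs_merge:
  assumes am: "at_most_pairs D (gen E)" and pq: "p \<in> D" "q \<in> D"
  shows "at_most_pairs (D - {p, q}) (gen (insert (p, q) E))"
  unfolding at_most_pairs_def
proof (intro ballI impI)
  fix x y z
  assume D': "x \<in> D - {p, q}" "y \<in> D - {p, q}" "z \<in> D - {p, q}"
    and A: "gen (insert (p, q) E) x y \<and> gen (insert (p, q) E) x z"
  have AM: "s = t \<or> s = u \<or> t = u" if "s \<in> D" "t \<in> D" "u \<in> D" "gen E s t" "gen E s u" for s t u
    using am that unfolding at_most_pairs_def by blast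
  have one: "s = t" if s: "s \<in> D - {p, q}" "t \<in> D - {p, q}" and p': "p' \<in> {p, q}" "gen E s p'" "gen E t p'" for s t p'
    using AM[of p' s t] s p' pq gen_sym by blast
  have rel: "s = t \<or> (\<not> (gen E s p \<or> gen E s q) \<and> gen E s t) \<or>
      (gen E s p \<and> gen E t q) \<or> (gen E s q \<and> gen E t p)"
    if "s \<in> D - {p, q}" "t \<in> D - {p, q}" "gen (insert (p, q) E) s t" for s t
    using that(3) one[OF that(1,2)] unfolding gen_insert by (metis gen_sym gen_trans insertCI)
  show "x = y \<or> x = z \<or> y = z"
    using rel[OF D'(1,2)] rel[OF D'(1,3)] A one[OF D'(2,3)] AM[of x y z] one[OF D'(1,2)] one[OF D'(1,3)] D'
    by (metis DiffD1 insertCI)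
qed

lemma boundary_pos_range: "x \<in> points n \<Longrightarrow> 1 \<le> boundary_pos n x \<and> boundary_pos n x \<le> 2 * n"
  by (cases x) auto

lemma boundary_pos_inj: "x \<in> points n \<Longrightarrow> y \<in> points n \<Longrightarrow> boundary_pos n x = boundary_pos n y \<Longrightarrow> x = y"
  by (cases x; cases y) auto

definition block_rel :: "nat \<Rightarrow> nat \<Rightarrow> point set set \<Rightarrow> (nat \<times> nat) set" where
  "block_rel n c d = (\<Union>B\<in>d. (\<lambda>x. c + boundary_pos n x) ` B \<times> (\<lambda>x. c + boundary_pos n x) ` B)"

text \<open>All points of the two diagrams are placed on one line: first the boundary of the lower
  diagram \<open>b\<close>, ending with its top points from right to left, then the boundary of the upper
  diagram \<open>a\<close>, beginning with its bottom points from left to right. The middle points number \<open>1,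
  ..., i\<close> of both diagrams are identified.\<close>

definition glue :: "nat \<Rightarrow> point set set \<Rightarrow> point set set \<Rightarrow> nat \<Rightarrow> (nat \<times> nat) set" where
  "glue n a b i = (\<lambda>m. (2 * n + 1 - m, 2 * n + m)) ` {1..i} \<union> block_rel n (2 * n) a \<union> block_rel n 0 b"

fun outer_pos :: "nat \<Rightarrow> point \<Rightarrow> nat" where
  "outer_pos n (Bot i) = i"
| "outer_pos n (Top i) = 4 * n + 1 - i"

lemma outer_pos_mono:
  "x \<in> points n \<Longrightarrow> y \<in> points n \<Longrightarrow> boundary_pos n x < boundary_pos n y \<Longrightarrow> outer_pos n x < outer_pos n y"
  by (cases x; cases y) auto

lemma same_block_if_compat:
  assumes d: "partition_on (points n) d" and x: "x \<in> points n"
    and eq: "\<And>v u. compat d v u \<Longrightarrow> colour v u x = colour v u y"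
  shows "\<exists>B\<in>d. x \<in> B \<and> y \<in> B"
proof -
  obtain B where B: "B \<in> d" "x \<in> B" using d x by (auto dest: partition_onD1)
  define v where "v i \<longleftrightarrow> Top i \<in> B" for i
  define u where "u i \<longleftrightarrow> Bot i \<in> B" for i
  have col: "colour v u z \<longleftrightarrow> z \<in> B" for z by (cases z) (auto simp: v_def u_def)
  have "compat d v u" unfolding compat_def col
    using d B(1) by (metis disjoint_iff partition_onD2 disjointD)
  then show ?thesis using eq col B by blast
qed

lemma block_relI: "B \<in> d \<Longrightarrow> x \<in> B \<Longrightarrow> y \<in> B \<Longrightarrow> (c + boundary_pos n x, c + boundary_pos n y) \<in> block_rel n c d"
  by (auto simp: block_rel_def)

text \<open>An admissible colouring of the glued line is the same as admissible colourings of the two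
  diagrams that agree on the middle points.\<close>

lemma same_block_stack_gen:
  assumes a: "partition_on (points n) a" and b: "partition_on (points n) b"
    and x: "x \<in> points n" and y: "y \<in> points n"
  shows "(\<exists>B\<in>stack n a b. x \<in> B \<and> y \<in> B) \<longleftrightarrow> gen (glue n a b n) (outer_pos n x) (outer_pos n y)"
proof
  assume same: "\<exists>B\<in>stack n a b. x \<in> B \<and> y \<in> B"
  show "gen (glue n a b n) (outer_pos n x) (outer_pos n y)"
    unfolding gen_def
  proof (intro allI impI)
    fix f :: "nat \<Rightarrow> bool" assume "\<forall>(x, y)\<in>glue n a b n. f x = f y"
    then have f: "f s = f t" if "(s, t) \<in> glue n a b n" for s t using that by blast
    define v where "v i = f (4 * n + 1 - i)" for i
    define u where "u i = f i" for i
    define w where "w i = f (2 * n + i)" for i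
    have w': "w i = f (2 * n + 1 - i)" if "i \<in> {1..n}" for i
      using f[of "2 * n + 1 - i" "2 * n + i"] that by (auto simp: glue_def w_def)
    have colA: "colour v w z = f (2 * n + boundary_pos n z)" if "z \<in> points n" for z
      using that by (cases z) (auto simp: v_def w_def)
    have colB: "colour w u z = f (0 + boundary_pos n z)" if "z \<in> points n" for z
      using that w' by (cases z) (auto simp: u_def)
    have "compat a v w" unfolding compat_def
    proof (intro ballI)
      fix B s t assume B: "B \<in> a" "s \<in> B" "t \<in> B"
      then have "s \<in> points n" "t \<in> points n" using partition_onD1[OF a] by auto
      then show "colour v w s = colour v w t"
        using colA f[of "2 * n + boundary_pos n s" "2 * n + boundary_pos n t"] block_relI[OF B, of "2 * n" n]
        by (auto simp: glue_def)
    qed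
    moreover have "compat b w u" unfolding compat_def
    proof (intro ballI)
      fix B s t assume B: "B \<in> b" "s \<in> B" "t \<in> B"
      then have "s \<in> points n" "t \<in> points n" using partition_onD1[OF b] by auto
      then show "colour w u s = colour w u t"
        using colB f[of "0 + boundary_pos n s" "0 + boundary_pos n t"] block_relI[OF B, of 0 n]
        by (auto simp: glue_def)
    qed
    ultimately have "compat (stack n a b) v u" using compat_stack[OF a b] by blast
    then have "colour v u x = colour v u y" using same compatD by blast
    moreover have "colour v u z = f (outer_pos n z)" for z by (cases z) (auto simp: v_def u_def)
    ultimately show "f (outer_pos n x) = f (outer_pos n y)" by simp
  qed
next
  assume G: "gen (glue n a b n) (outer_pos n x) (outer_pos n y)"
  show "\<exists>B\<in>stack n a b. x \<in> B \<and> y \<in> B"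
  proof (rule same_block_if_compat[OF stack_partition x])
    fix v u assume "compat (stack n a b) v u"
    then obtain w where w: "compat a v w" "compat b w u" using compat_stack[OF a b] by blast
    define f where "f p = (if p \<le> n then u p else if p \<le> 2 * n then w (2 * n + 1 - p)
      else if p \<le> 3 * n then w (p - 2 * n) else v (4 * n + 1 - p))" for p
    have fA: "f (2 * n + boundary_pos n z) = colour v w z" if "z \<in> points n" for z
      using that by (cases z) (auto simp: f_def)
    have fB: "f (0 + boundary_pos n z) = colour w u z" if "z \<in> points n" for z
      using that by (cases z) (auto simp: f_def)
    have "f s = f t" if st: "(s, t) \<in> glue n a b n" for s t
    proof -
      consider m where "m \<in> {1..n}" "s = 2 * n + 1 - m" "t = 2 * n + m"
        | B s' t' where "B \<in> a" "s' \<in> B" "t' \<in> B" "s = 2 * n + boundary_pos n s'" "t = 2 * n + boundary_pos n t'"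
        | B s' t' where "B \<in> b" "s' \<in> B" "t' \<in> B" "s = 0 + boundary_pos n s'" "t = 0 + boundary_pos n t'"
        using st unfolding glue_def block_rel_def by blast
      then show ?thesis
      proof cases
        case 1
        then show ?thesis by (auto simp: f_def)
      next
        case 2
        then have "s' \<in> points n" "t' \<in> points n" using partition_onD1[OF a] by auto
        then show ?thesis using fA compatD[OF w(1) 2(1,2,3)] 2(4,5) by simp
      next
        case 3
        then have "s' \<in> points n" "t' \<in> points n" using partition_onD1[OF b] by auto
        then show ?thesis using fB compatD[OF w(2) 3(1,2,3)] 3(4,5) by simp
      qed
    qed
    then have "f (outer_pos n x) = f (outer_pos n y)" using G unfolding gen_def by blast
    moreover have "f (outer_pos n z) = colour v u z" if "z \<in> points n" for z
      using that by (cases z) (auto simp: f_def)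
    ultimately show "colour v u x = colour v u y" using x y by simp
  qed
qed

text \<open>The positions that remain after gluing and forgetting the first \<open>i\<close> pairs of middle
  points. For \<open>i = n\<close> these are the outer points.\<close>

definition unglued :: "nat \<Rightarrow> nat \<Rightarrow> nat set" where
  "unglued n i = {1..2 * n - i} \<union> {2 * n + 1 + i..4 * n}"

lemma glue_Suc: "glue n a b (Suc i) = insert (2 * n - i, 2 * n + 1 + i) (glue n a b i)"
  unfolding glue_def by (simp add: atLeastAtMostSuc_conv)

lemma unglued_Suc: "i < n \<Longrightarrow> unglued n (Suc i) = unglued n i - {2 * n - i, 2 * n + 1 + i}"
  unfolding unglued_def by auto

lemma noncrossing_glue:
  assumes "noncrossing (unglued n 0) (gen (glue n a b 0))" "i \<le> n"
  shows "noncrossing (unglued n i) (gen (glue n a b i))"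
  using assms(2)
proof (induction i)
  case (Suc i)
  then show ?case unfolding glue_Suc unglued_Suc[OF Suc_le_lessD[OF Suc.prems]]
    by (intro noncrossing_merge_adjacent) (auto simp: unglued_def)
qed (rule assms(1))

lemma at_most_pairs_glue:
  assumes "at_most_pairs (unglued n 0) (gen (glue n a b 0))" "i \<le> n"
  shows "at_most_pairs (unglued n i) (gen (glue n a b i))"
  using assms(2)
proof (induction i)
  case (Suc i)
  then show ?case unfolding glue_Suc unglued_Suc[OF Suc_le_lessD[OF Suc.prems]]
    by (intro at_most_pairs_merge) (auto simp: unglued_def)
qed (rule assms(1))

lemma outer_pos_unglued: "x \<in> points n \<Longrightarrow> outer_pos n x \<in> unglued n n"
  by (cases x) (auto simp: unglued_def)

lemma gen_glue_0:
  assumes a: "partition_on (points n) a" and b: "partition_on (points n) b"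
    and G: "gen (glue n a b 0) p q" and ne: "p \<noteq> q"
  obtains (upper) A x y where "A \<in> a" "x \<in> A" "y \<in> A" "p = 2 * n + boundary_pos n x" "q = 2 * n + boundary_pos n y"
  | (lower) B x y where "B \<in> b" "x \<in> B" "y \<in> B" "p = boundary_pos n x" "q = boundary_pos n y"
proof -
  have tr: "(s, u) \<in> block_rel n c d" if d: "partition_on (points n) d"
    and st: "(s, t) \<in> block_rel n c d" and tu: "(t, u) \<in> block_rel n c d" for s t u c d
  proof -
    obtain B x y where B: "B \<in> d" "x \<in> B" "y \<in> B" "s = c + boundary_pos n x" "t = c + boundary_pos n y"
      using st by (auto simp: block_rel_def)
    obtain C y' z where C: "C \<in> d" "y' \<in> C" "z \<in> C" "t = c + boundary_pos n y'" "u = c + boundary_pos n z"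
      using tu by (auto simp: block_rel_def)
    have "y \<in> points n" "y' \<in> points n" using B C partition_onD1[OF d] by auto
    then have "y = y'" using boundary_pos_inj B C by simp
    then have "B = C" using disjointD[OF partition_onD2[OF d] B(1) C(1)] B C by blast
    then show ?thesis using B C block_relI by blast
  qed
  have rng: "c + 1 \<le> s \<and> s \<le> c + 2 * n \<and> c + 1 \<le> t \<and> t \<le> c + 2 * n"
    if d: "partition_on (points n) d" and st: "(s, t) \<in> block_rel n c d" for s t c d
  proof -
    obtain B x y where B: "B \<in> d" "x \<in> B" "y \<in> B" "s = c + boundary_pos n x" "t = c + boundary_pos n y"
      using st by (auto simp: block_rel_def)
    have "x \<in> points n" "y \<in> points n" using B partition_onD1[OF d] by auto
    then show ?thesis using boundary_pos_range B by auto
  qed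
  have sy: "(t, s) \<in> block_rel n c d" if "(s, t) \<in> block_rel n c d" for s t c d
    using that by (auto simp: block_rel_def)
  let ?E = "block_rel n (2 * n) a \<union> block_rel n 0 b"
  have E: "glue n a b 0 = ?E" by (simp add: glue_def)
  have trE: "(s, u) \<in> ?E" if "(s, t) \<in> ?E" "(t, u) \<in> ?E" for s t u
  proof -
    have "False" if "(x, y) \<in> block_rel n (2 * n) a" "(y, z) \<in> block_rel n 0 b" for x y z
      using rng[OF a that(1)] rng[OF b that(2)] by simp
    moreover have "False" if "(x, y) \<in> block_rel n 0 b" "(y, z) \<in> block_rel n (2 * n) a" for x y z
      using rng[OF b that(1)] rng[OF a that(2)] by simp
    ultimately show ?thesis using that tr[OF a, of s t _ u] tr[OF b, of s t _ u] by blast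
  qed
  have syE: "(t, s) \<in> ?E" if "(s, t) \<in> ?E" for s t using that sy by blast
  define f where "f t \<longleftrightarrow> t = p \<or> (p, t) \<in> ?E" for t
  have "f s = f t" if "(s, t) \<in> ?E" for s t
    using that trE syE unfolding f_def by blast
  then have "f p = f q" using G unfolding gen_def E by blast
  then have "(p, q) \<in> ?E" using ne by (auto simp: f_def)
  then show ?thesis using upper lower by (auto simp: block_rel_def)
qed

lemma planarD:
  assumes "planar n d" "A \<in> d" "B \<in> d" and in_AB: "w \<in> A" "x \<in> B" "y \<in> A" "z \<in> B"
    and lt: "boundary_pos n w < boundary_pos n x" "boundary_pos n x < boundary_pos n y"
      "boundary_pos n y < boundary_pos n z"
  shows "A = B"
proof (rule ccontr)
  assume ne: "A \<noteq> B"
  have "\<exists>A\<in>d. \<exists>B\<in>d. A \<noteq> B \<and> (\<exists>w\<in>A. \<exists>x\<in>B. \<exists>y\<in>A. \<exists>z\<in>B.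
      boundary_pos n w < boundary_pos n x \<and> boundary_pos n x < boundary_pos n y \<and>
      boundary_pos n y < boundary_pos n z)"
    by (rule bexI[OF _ assms(2)], rule bexI[OF _ assms(3)], rule conjI[OF ne],
        rule bexI[OF _ in_AB(1)], rule bexI[OF _ in_AB(2)], rule bexI[OF _ in_AB(3)],
        rule bexI[OF _ in_AB(4)]) (use lt in simp)
  from assms(1)[unfolded planar_def] this show False by (rule notE)
qed

theorem planar_stack:
  assumes a: "partition_on (points n) a" "planar n a" and b: "partition_on (points n) b" "planar n b"
  shows "planar n (stack n a b)"
proof -
  have base: "noncrossing (unglued n 0) (gen (glue n a b 0))"
    unfolding noncrossing_def
  proof (intro ballI impI)
    fix w x y z assume A: "w < x \<and> x < y \<and> y < z \<and> gen (glue n a b 0) w y \<and> gen (glue n a b 0) x z"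
    from A have wy: "gen (glue n a b 0) w y" "w \<noteq> y" and xz: "gen (glue n a b 0) x z" "x \<noteq> z"
      and lt: "w < x" "x < y" "y < z" by auto
    have rangeA: "1 \<le> boundary_pos n s \<and> boundary_pos n s \<le> 2 * n" if "C \<in> a \<or> C \<in> b" "s \<in> C" for s C
    proof -
      have "s \<in> points n" using that partition_onD1[OF a(1)] partition_onD1[OF b(1)] by auto
      then show ?thesis by (rule boundary_pos_range)
    qed
    show "gen (glue n a b 0) w x"
    proof (cases rule: gen_glue_0[OF a(1) b(1) wy, case_names upper lower])
      case u: (upper A w' y')
      show ?thesis
      proof (cases rule: gen_glue_0[OF a(1) b(1) xz, case_names upper lower])
        case v: (upper B x' z')
        have "A = B"
          by (rule planarD[OF a(2) u(1) v(1) u(2) v(2) u(3) v(3)]) (use u(4,5) v(4,5) lt in linarith)+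
        then have "(w, x) \<in> block_rel n (2 * n) a"
          unfolding u(4) v(4) using u(1,2) v(2) by (intro block_relI) auto
        then show ?thesis by (intro gen_base) (simp add: glue_def)
      next
        case v: (lower B x' z')
        have "z \<le> 2 * n" "2 * n < w" using rangeA[of B z'] rangeA[of A w'] u(1,2,4) v(1,3,5) by auto
        then show ?thesis using lt by linarith
      qed
    next
      case u: (lower A w' y')
      show ?thesis
      proof (cases rule: gen_glue_0[OF a(1) b(1) xz, case_names upper lower])
        case v: (upper B x' z')
        have "y \<le> 2 * n" "2 * n < x" using rangeA[of A y'] rangeA[of B x'] u(1,3,5) v(1,2,4) by auto
        then show ?thesis using lt by linarith
      next
        case v: (lower B x' z')
        have "A = B"
          by (rule planarD[OF b(2) u(1) v(1) u(2) v(2) u(3) v(3)]) (use u(4,5) v(4,5) lt in linarith)+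
        then have "(0 + boundary_pos n w', 0 + boundary_pos n x') \<in> block_rel n 0 b"
          using u(1,2) v(2) by (intro block_relI) auto
        then have "(w, x) \<in> block_rel n 0 b" unfolding u(4) v(4) by simp
        then show ?thesis by (intro gen_base) (simp add: glue_def)
      qed
    qed
  qed
  have nc: "noncrossing (unglued n n) (gen (glue n a b n))" by (rule noncrossing_glue[OF base]) simp
  show ?thesis unfolding planar_def
  proof
    assume "\<exists>A\<in>stack n a b. \<exists>B\<in>stack n a b. A \<noteq> B \<and> (\<exists>w\<in>A. \<exists>x\<in>B. \<exists>y\<in>A. \<exists>z\<in>B.
      boundary_pos n w < boundary_pos n x \<and> boundary_pos n x < boundary_pos n y \<and> boundary_pos n y < boundary_pos n z)"
    then obtain A B w x y z where AB: "A \<in> stack n a b" "B \<in> stack n a b" "A \<noteq> B"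
      and in_AB: "w \<in> A" "x \<in> B" "y \<in> A" "z \<in> B"
      and lt: "boundary_pos n w < boundary_pos n x" "boundary_pos n x < boundary_pos n y" "boundary_pos n y < boundary_pos n z"
      by blast
    have pts: "w \<in> points n" "x \<in> points n" "y \<in> points n" "z \<in> points n"
      using AB in_AB partition_onD1[OF stack_partition[of n a b]] by auto
    have "gen (glue n a b n) (outer_pos n w) (outer_pos n y)" "gen (glue n a b n) (outer_pos n x) (outer_pos n z)"
      using same_block_stack_gen[OF a(1) b(1)] AB in_AB pts by blast+
    then have "gen (glue n a b n) (outer_pos n w) (outer_pos n x)"
      using nc outer_pos_mono lt pts outer_pos_unglued unfolding noncrossing_def by blast
    then obtain C where "C \<in> stack n a b" "w \<in> C" "x \<in> C"
      using same_block_stack_gen[OF a(1) b(1)] pts by blast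
    then have "C = A" "C = B" using AB in_AB disjointD[OF partition_onD2[OF stack_partition]] by blast+
    then show False using AB by blast
  qed
qed

lemma card_le_2_if_no_three_distinct:
  assumes "\<And>x y z. x \<in> B \<Longrightarrow> y \<in> B \<Longrightarrow> z \<in> B \<Longrightarrow> x = y \<or> x = z \<or> y = z" "finite B"
  shows "card B \<le> 2"
proof (rule ccontr)
  assume "\<not> card B \<le> 2"
  then obtain C where "C \<subseteq> B" "card C = 3" by (metis not_less_eq_eq numeral_2_eq_2 numeral_3_eq_3 obtain_subset_with_card_n)
  then obtain x y z where "C = {x, y, z}" "x \<noteq> y" "y \<noteq> z" "x \<noteq> z" by (auto simp: card_3_iff)
  then show False using assms(1)[of x y z] \<open>C \<subseteq> B\<close> by auto
qed

text \<open>A component of the stack of two such diagrams is a path, so it has at most two ends.\<close>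

theorem pairs_stack:
  assumes a: "partition_on (points n) a" "\<And>B. B \<in> a \<Longrightarrow> card B \<le> 2"
    and b: "partition_on (points n) b" "\<And>B. B \<in> b \<Longrightarrow> card B \<le> 2" and C: "C \<in> stack n a b"
  shows "card C \<le> 2"
proof -
  have small: "x = y \<or> x = z \<or> y = z" if "card B \<le> 2" "B \<subseteq> points n" "x \<in> B" "y \<in> B" "z \<in> B" for B x y z
  proof (rule ccontr)
    assume "\<not> (x = y \<or> x = z \<or> y = z)"
    then have "card {x, y, z} = 3" by simp
    moreover have "card {x, y, z} \<le> card B"
      using that by (intro card_mono finite_subset[OF that(2) finite_points]) auto
    ultimately show False using that by simp
  qed
  have bl: "x = y \<or> x = z \<or> y = z"
    if d: "partition_on (points n) d" "\<And>B. B \<in> d \<Longrightarrow> card B \<le> 2" and "B \<in> d" "B' \<in> d" "x \<in> B" "y \<in> B" "x' \<in> B'" "z \<in> B'"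
      "boundary_pos n x = boundary_pos n x'" for d B B' x y x' z
  proof -
    have sub: "B \<subseteq> points n" "B' \<subseteq> points n" using that partition_onD1[OF d(1)] by auto
    then have "x = x'" using that boundary_pos_inj by blast
    then have "B = B'" using disjointD[OF partition_onD2[OF d(1)]] that by blast
    then show ?thesis using small[OF d(2) sub(1)] that by blast
  qed
  have base: "at_most_pairs (unglued n 0) (gen (glue n a b 0))"
    unfolding at_most_pairs_def
  proof (intro ballI impI)
    fix x y z assume A: "gen (glue n a b 0) x y \<and> gen (glue n a b 0) x z"
    show "x = y \<or> x = z \<or> y = z"
    proof (rule ccontr)
      assume ne: "\<not> (x = y \<or> x = z \<or> y = z)"
      have rangeA: "1 \<le> boundary_pos n s \<and> boundary_pos n s \<le> 2 * n" if "C \<in> a \<or> C \<in> b" "s \<in> C" for s C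
      proof -
        have "s \<in> points n" using that partition_onD1[OF a(1)] partition_onD1[OF b(1)] by auto
        then show ?thesis by (rule boundary_pos_range)
      qed
      from A ne have xy: "gen (glue n a b 0) x y" "x \<noteq> y" and xz: "gen (glue n a b 0) x z" "x \<noteq> z" by auto
      show False
      proof (cases rule: gen_glue_0[OF a(1) b(1) xy, case_names upper lower])
        case u: (upper B x1 y1)
        show False
        proof (cases rule: gen_glue_0[OF a(1) b(1) xz, case_names upper lower])
          case (upper B' x2 z2)
          then show False using bl[OF a u(1) upper(1) u(2,3) upper(2,3)] u ne by auto
        next
          case (lower B' x2 z2)
          then show False using rangeA[of B x1] rangeA[of B' x2] u by auto
        qed
      next
        case l: (lower B x1 y1)
        show False
        proof (cases rule: gen_glue_0[OF a(1) b(1) xz, case_names upper lower])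
          case (upper B' x2 z2)
          then show False using rangeA[of B x1] rangeA[of B' x2] l by auto
        next
          case (lower B' x2 z2)
          then show False using bl[OF b l(1) lower(1) l(2,3) lower(2,3)] l ne by auto
        qed
      qed
    qed
  qed
  have am: "at_most_pairs (unglued n n) (gen (glue n a b n))" by (rule at_most_pairs_glue[OF base]) simp
  have sub: "C \<subseteq> points n" using C partition_onD1[OF stack_partition[of n a b]] by auto
  show ?thesis
  proof (rule card_le_2_if_no_three_distinct)
    show "finite C" using sub finite_points finite_subset by blast
    fix x y z assume xyz: "x \<in> C" "y \<in> C" "z \<in> C"
    then have pts: "x \<in> points n" "y \<in> points n" "z \<in> points n" using sub by auto
    have "gen (glue n a b n) (outer_pos n x) (outer_pos n y)" "gen (glue n a b n) (outer_pos n x) (outer_pos n z)"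
      using same_block_stack_gen[OF a(1) b(1)] C xyz pts by blast+
    then have "outer_pos n x = outer_pos n y \<or> outer_pos n x = outer_pos n z \<or> outer_pos n y = outer_pos n z"
      using am outer_pos_unglued pts unfolding at_most_pairs_def by blast
    moreover have "s = t" if "outer_pos n s = outer_pos n t" "s \<in> points n" "t \<in> points n" for s t
      using that by (cases s; cases t) auto
    ultimately show "x = y \<or> x = z \<or> y = z" using pts by blast
  qed
qed

section \<open>Rook-Brauer, Motzkin, partition and rook monoids\<close>

lemma carrier_RoBr: "carrier (RoBr n) = {d. partition_on (points n) d \<and> (\<forall>B\<in>d. card B = 1 \<or> card B = 2)}"
  by (auto simp: RoBr_def carrier_Pa)

lemma RoBr_ops: "mult (RoBr n) = stack n" "\<one>\<^bsub>RoBr n\<^esub> = eps n n"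
  using one_Pa[of n] by (simp_all add: RoBr_def mult_Pa)

lemma card_block_pos: "partition_on (points n) d \<Longrightarrow> B \<in> d \<Longrightarrow> card B > 0"
  by (metis Union_upper card_gt_0_iff finite_points finite_subset partition_onD1 partition_onD3)

lemma RoBr_iff: "d \<in> carrier (RoBr n) \<longleftrightarrow> partition_on (points n) d \<and> (\<forall>B\<in>d. card B \<le> 2)"
  unfolding carrier_RoBr using card_block_pos[of n d] by fastforce

lemma card_dia_block: "B \<in> dia n g \<Longrightarrow> card B \<le> 2"
  unfolding dia_def by (auto simp: card_insert_if)

lemma card_flip_block:
  assumes "\<forall>B\<in>d. card B \<le> 2"
  shows "\<forall>B\<in>flip d. card B \<le> 2"
  using assms card_image[OF inj_flip_pt] by (auto simp: flip_def)

lemma diagram_monoid_RoBr: "diagram_monoid n (RoBr n)"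
proof
  show "carrier (RoBr n) \<subseteq> carrier (Pa n)" by (auto simp: carrier_RoBr carrier_Pa)
  show "stack n a b \<in> carrier (RoBr n)" if "a \<in> carrier (RoBr n)" "b \<in> carrier (RoBr n)" for a b
    using that pairs_stack[of n a b] stack_partition by (auto simp: RoBr_iff)
  show "eps n j \<in> carrier (RoBr n)" if "j \<le> n" for j
    using that eps_partition card_dia_block by (auto simp: RoBr_iff eps_def)
qed (simp_all add: RoBr_ops)

lemma card_half_block:
  assumes "\<And>i. i \<in> {1..j} \<Longrightarrow> finite (b i) \<and> card (b i) \<le> 1" "\<And>B. B \<in> N \<Longrightarrow> card B \<le> 2"
    and "C \<in> half n j b N"
  shows "card C \<le> 2"
proof -
  from assms(3) consider i where "i \<in> {1..j}" "C = insert (Bot i) (Top ` b i)"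
    | B where "B \<in> N" "C = Top ` B" | i where "C = {Bot i}" unfolding half_def by blast
  then show ?thesis
  proof cases
    case 1
    have "card (Top ` b i) \<le> 1"
      using assms(1)[OF 1(1)] card_image_le[of "b i" Top] by linarith
    then show ?thesis using 1 assms(1)[OF 1(1)] by (simp add: card_insert_if)
  next
    case 2
    then show ?thesis using assms(2)[OF 2(1)] by (simp add: card_image inj_on_def)
  qed simp
qed

lemma card_tops_bots:
  assumes "finite B"
  shows "finite (tops B)" "finite (bots B)" "card B = card (tops B) + card (bots B)"
proof -
  have f: "finite (Top ` tops B)" "finite (Bot ` bots B)"
    using assms tops_bots[of B] by (metis finite_Un)+
  then show fin: "finite (tops B)" "finite (bots B)"
    by (simp_all add: finite_image_iff inj_on_def)
  have "card B = card (Top ` tops B) + card (Bot ` bots B)"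
    using card_Un_disjoint[OF f] tops_bots[of B] by auto
  then show "card B = card (tops B) + card (bots B)" by (simp add: card_image inj_on_def)
qed

text \<open>A through strand of size at most two has one top and one bottom point, so the two halves
  of the diagram have blocks of size at most two as well.\<close>

lemma factorizable_RoBr: "factorizable_monoid n (RoBr n)"
proof -
  interpret diagram_monoid n "RoBr n" by (rule diagram_monoid_RoBr)
  show ?thesis
  proof
    fix d assume dR: "d \<in> carrier (RoBr n)"
    then have d: "partition_on (points n) d" and small: "\<And>B. B \<in> d \<Longrightarrow> card B \<le> 2" by (auto simp: RoBr_iff)
    let ?j = "through_strands d"
    obtain \<beta> where \<beta>: "bij_betw \<beta> {1..?j} {B \<in> d. bots B \<noteq> {} \<and> tops B \<noteq> {}}"
      and h: "half_data n ?j (\<lambda>i. tops (\<beta> i)) (tops ` {B \<in> d. bots B = {}})"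
        "half_data n ?j (\<lambda>i. bots (\<beta> i)) (bots ` {B \<in> d. tops B = {}})"
        "d = stack n (half n ?j (\<lambda>i. tops (\<beta> i)) (tops ` {B \<in> d. bots B = {}}))
          (flip (half n ?j (\<lambda>i. bots (\<beta> i)) (bots ` {B \<in> d. tops B = {}})))"
      by (rule diagram_factorization[OF d])
    have finB: "finite B" if "B \<in> d" for B
      using that partition_onD1[OF d] finite_points by (metis Union_upper finite_subset)
    have through: "finite (tops (\<beta> i)) \<and> card (tops (\<beta> i)) \<le> 1 \<and> finite (bots (\<beta> i)) \<and> card (bots (\<beta> i)) \<le> 1"
      if i: "i \<in> {1..?j}" for i
    proof -
      have B: "\<beta> i \<in> d" "bots (\<beta> i) \<noteq> {}" "tops (\<beta> i) \<noteq> {}" using bij_betwE[OF \<beta>] i by auto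
      note c = card_tops_bots[OF finB[OF B(1)]]
      then have "card (tops (\<beta> i)) > 0" "card (bots (\<beta> i)) > 0" using B by (simp_all add: card_gt_0_iff)
      then show ?thesis using c small[OF B(1)] by auto
    qed
    have le: "card (tops B) \<le> 2" "card (bots B) \<le> 2" if "B \<in> d" for B
      using card_tops_bots[OF finB[OF that]] small[OF that] by auto
    have 1: "\<forall>C\<in>half n ?j (\<lambda>i. tops (\<beta> i)) (tops ` {B \<in> d. bots B = {}}). card C \<le> 2"
      by (intro ballI, erule card_half_block[rotated 2]) (use through le in auto)
    have 2: "\<forall>C\<in>half n ?j (\<lambda>i. bots (\<beta> i)) (bots ` {B \<in> d. tops B = {}}). card C \<le> 2"
      by (intro ballI, erule card_half_block[rotated 2]) (use through le in auto)
    have "factors n (RoBr n) d (half n ?j (\<lambda>i. tops (\<beta> i)) (tops ` {B \<in> d. bots B = {}}))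
        (flip (half n ?j (\<lambda>i. bots (\<beta> i)) (bots ` {B \<in> d. tops B = {}})))
        (flip (half n ?j (\<lambda>i. tops (\<beta> i)) (tops ` {B \<in> d. bots B = {}})))
        (half n ?j (\<lambda>i. bots (\<beta> i)) (bots ` {B \<in> d. tops B = {}}))"
      by (rule factors_half[OF d h(1,2,3)])
        (use 1 2 card_flip_block half_partition[OF h(1)] half_partition[OF h(2)] flip_partition in
          \<open>simp_all add: RoBr_iff\<close>)
    then show "\<exists>p q p' q'. factors n (RoBr n) d p q p' q'" by blast
  qed
qed

text \<open>The pairs of \<open>g\<close> are pairs (top, bottom), so this says that \<open>g\<close> preserves the order from
  bottom to top.\<close>

definition mono_rel :: "(nat \<times> nat) set \<Rightarrow> bool" where
  "mono_rel g \<longleftrightarrow> (\<forall>t b t' b'. (t, b) \<in> g \<longrightarrow> (t', b') \<in> g \<longrightarrow> b < b' \<longrightarrow> t < t')"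

lemma part_injD:
  assumes "part_inj n g"
  shows "(t, b) \<in> g \<Longrightarrow> t \<in> {1..n} \<and> b \<in> {1..n}"
    and "(t, b) \<in> g \<Longrightarrow> (t, b') \<in> g \<Longrightarrow> b = b'" and "(t, b) \<in> g \<Longrightarrow> (t', b) \<in> g \<Longrightarrow> t = t'"
  using assms unfolding part_inj_def single_valued_def by blast+

text \<open>Along the boundary the bottom points are passed in increasing and the top points in
  decreasing order, so two strands interleave exactly when their ends are in opposite order.\<close>

lemma planar_dia_iff:
  assumes g: "part_inj n g"
  shows "planar n (dia n g) \<longleftrightarrow> mono_rel g"
proof
  assume P: "planar n (dia n g)"
  show "mono_rel g" unfolding mono_rel_def
  proof (intro allI impI)
    fix t b t' b' assume tb: "(t, b) \<in> g" "(t', b') \<in> g" "b < b'"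
    show "t < t'"
    proof (rule ccontr)
      assume "\<not> t < t'"
      moreover have "t \<noteq> t'" using part_injD(2)[OF g] tb by blast
      ultimately have lt: "t' < t" by simp
      have mem: "{Bot b, Top t} \<in> dia n g" "{Bot b', Top t'} \<in> dia n g" using tb by (force simp: dia_def)+
      have "{Bot b, Top t} = {Bot b', Top t'}"
        by (rule planarD[OF P mem, of "Bot b" "Bot b'" "Top t" "Top t'"])
          (use tb lt part_injD(1)[OF g tb(1)] part_injD(1)[OF g tb(2)] in auto)
      then show False using tb by (auto simp: doubleton_eq_iff)
    qed
  qed
next
  assume M: "mono_rel g"
  have pair: "\<exists>t b. (t, b) \<in> g \<and> w = Bot b \<and> y = Top t"
    if wy: "A \<in> dia n g" "w \<in> A" "y \<in> A" "boundary_pos n w < boundary_pos n y" for A w y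
  proof -
    have "w \<noteq> y" using wy by auto
    from wy(1) consider t b where "(t, b) \<in> g" "A = {Bot b, Top t}" | z where "A = {z}"
      unfolding dia_def by blast
    then obtain t b where tb: "(t, b) \<in> g" "A = {Bot b, Top t}"
      using \<open>w \<noteq> y\<close> wy(2,3) by cases blast+
    have "b \<le> n" "t \<le> n" using part_injD(1)[OF g tb(1)] by auto
    then show ?thesis using tb wy by auto
  qed
  show "planar n (dia n g)" unfolding planar_def
  proof (rule notI, elim bexE conjE)
    fix A B w x y z assume AB: "A \<in> dia n g" "B \<in> dia n g" "w \<in> A" "x \<in> B" "y \<in> A" "z \<in> B"
      and lt: "boundary_pos n w < boundary_pos n x" "boundary_pos n x < boundary_pos n y"
        "boundary_pos n y < boundary_pos n z"
    obtain t b where tb: "(t, b) \<in> g" "w = Bot b" "y = Top t" using pair[of A w y] AB lt by auto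
    obtain t' b' where tb': "(t', b') \<in> g" "x = Bot b'" "z = Top t'" using pair[of B x z] AB lt by auto
    have "t < t'" using M tb tb' lt unfolding mono_rel_def by auto
    then show False using lt(3) tb tb' by auto
  qed
qed

lemma planar_eps: "j \<le> n \<Longrightarrow> planar n (eps n j)"
  unfolding eps_def by (subst planar_dia_iff) (auto intro: part_inj_Id_on simp: mono_rel_def)

lemma diagram_monoid_planar:
  assumes "diagram_monoid n X" and Y: "Y = X\<lparr>carrier := {d \<in> carrier X. planar n d}\<rparr>"
  shows "diagram_monoid n Y"
proof -
  interpret diagram_monoid n X by fact
  show ?thesis
    by unfold_locales (use sub in \<open>auto simp: Y mult_eq one_eq closed eps_closed planar_eps partition intro: planar_stack\<close>)
qed

lemma diagram_pair_planar:
  assumes "factorizable_monoid n X" and Y: "Y = X\<lparr>carrier := {d \<in> carrier X. planar n d}\<rparr>"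
  shows "diagram_pair n Y X"
proof -
  interpret X: factorizable_monoid n X by fact
  interpret Y: diagram_monoid n Y
    by (rule diagram_monoid_planar[OF X.diagram_monoid_axioms Y])
  show ?thesis by unfold_locales (auto simp: Y)
qed

lemma diagram_pair_Mo: "diagram_pair n (Mo n) (RoBr n)"
  by (rule diagram_pair_planar[OF factorizable_RoBr]) (simp add: Mo_def)

lemma diagram_pair_pPa: "diagram_pair n (pPa n) (Pa n)"
  by (rule diagram_pair_planar[OF factorizable_Pa]) (simp add: pPa_def)

lemma carrier_Ro: "carrier (Ro n) = dia n ` {g. part_inj n g}"
proof
  show "carrier (Ro n) \<subseteq> dia n ` {g. part_inj n g}"
  proof
    fix d assume "d \<in> carrier (Ro n)"
    then have d: "partition_on (points n) d" and shape: "\<And>B. B \<in> d \<Longrightarrow> card B = 1 \<or> (\<exists>i j. B = {Bot i, Top j})"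
      by (auto simp: Ro_def carrier_Pa)
    define g where "g = {(t, b). {Bot b, Top t} \<in> d}"
    have same: "B = C" if "B \<in> d" "C \<in> d" "x \<in> B" "x \<in> C" for B C x
      using disjointD[OF partition_onD2[OF d] that(1,2)] that by blast
    have "part_inj n g" unfolding part_inj_def
    proof (intro conjI)
      show "g \<subseteq> {1..n} \<times> {1..n}"
      proof clarify
        fix t b assume "(t, b) \<in> g"
        then have "Top t \<in> points n" "Bot b \<in> points n" using partition_onD1[OF d] by (auto simp: g_def)
        then show "t \<in> {1..n} \<and> b \<in> {1..n}" by simp
      qed
      show "single_valued g" unfolding single_valued_def g_def
        using same[of "{Bot _, Top _}" "{Bot _, Top _}"] by (auto simp: doubleton_eq_iff) blast
      show "single_valued (g\<inverse>)" unfolding single_valued_def g_def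
        using same[of "{Bot _, Top _}" "{Bot _, Top _}"] by (auto simp: doubleton_eq_iff) blast
    qed
    moreover have "d = dia n g"
    proof (rule compat_inject[OF d dia_partition[OF \<open>part_inj n g\<close>]])
      fix v u
      show "compat d v u = compat (dia n g) v u" unfolding compat_dia
      proof
        assume R: "compat d v u"
        have "v t = u b" if "(t, b) \<in> g" for t b
          using compatD[OF R, of "{Bot b, Top t}" "Top t" "Bot b"] that by (simp add: g_def)
        then show "\<forall>(t, b)\<in>g. v t = u b" by auto
      next
        assume L: "\<forall>(t, b)\<in>g. v t = u b"
        show "compat d v u" unfolding compat_def
        proof (intro ballI)
          fix B x y assume B: "B \<in> d" "x \<in> B" "y \<in> B"
          show "colour v u x = colour v u y"
          proof (cases "card B = 1")
            case True
            then show ?thesis using B by (auto simp: card_1_singleton_iff)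
          next
            case False
            then obtain i j where ij: "B = {Bot i, Top j}" using shape[OF B(1)] by blast
            then have "v j = u i" using L B(1) by (auto simp: g_def)
            then show ?thesis using B ij by auto
          qed
        qed
      qed
    qed
    ultimately show "d \<in> dia n ` {g. part_inj n g}" by blast
  qed
  show "dia n ` {g. part_inj n g} \<subseteq> carrier (Ro n)"
  proof clarify
    fix g assume g: "part_inj n g"
    have "card B = 1 \<or> (\<exists>i j. B = {Bot i, Top j})" if "B \<in> dia n g" for B
      using that unfolding dia_def by auto
    then show "dia n g \<in> carrier (Ro n)" using dia_partition[OF g] by (simp add: Ro_def carrier_Pa)
  qed
qed

lemma carrier_pRo: "carrier (pRo n) = dia n ` {g. part_inj n g \<and> mono_rel g}"
  using carrier_Ro[of n] planar_dia_iff[of n] by (auto simp: pRo_def)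

lemma diagram_monoid_Ro: "diagram_monoid n (Ro n)"
proof
  show "carrier (Ro n) \<subseteq> carrier (Pa n)" by (auto simp: Ro_def)
  show "mult (Ro n) = stack n" "\<one>\<^bsub>Ro n\<^esub> = eps n n" using one_Pa[of n] by (simp_all add: Ro_def mult_Pa)
  show "stack n a b \<in> carrier (Ro n)" if "a \<in> carrier (Ro n)" "b \<in> carrier (Ro n)" for a b
    using that part_inj_comp by (auto simp: carrier_Ro stack_dia)
  show "eps n j \<in> carrier (Ro n)" if "j \<le> n" for j
    using part_inj_Id_on[of "{1..j}" n] that by (auto simp: carrier_Ro eps_def)
qed

lemma diagram_monoid_pRo: "diagram_monoid n (pRo n)"
  by (rule diagram_monoid_planar[OF diagram_monoid_Ro]) (simp add: pRo_def)

lemma part_inj_converse: "part_inj n g \<Longrightarrow> part_inj n (g\<inverse>)"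
  by (auto simp: part_inj_def)

lemma mono_rel_converse: "part_inj n g \<Longrightarrow> mono_rel g \<Longrightarrow> mono_rel (g\<inverse>)"
  unfolding mono_rel_def using part_injD(3)[of n g] by (metis converseD linorder_neqE_nat not_less_iff_gr_or_eq)

lemma part_inj_comp_converse: "part_inj n g \<Longrightarrow> g O g\<inverse> = Id_on (Domain g)"
  using part_injD(3)[of n g] by (auto simp: Id_on_iff)

text \<open>The order isomorphism from \<open>{1..card A}\<close> onto \<open>A\<close>.\<close>

lemma order_bijection_rel:
  assumes "A \<subseteq> {1..n}"
  obtains P where "part_inj n P" "mono_rel P" "P O P\<inverse> = Id_on A" "P\<inverse> O P = Id_on {1..card A}"
proof -
  have "finite A" using assms finite_subset by blast
  then obtain h where h: "bij_betw h {..<card A} A" "strict_mono_on {..<card A} h"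
    using ex_bij_betw_strict_mono_card by blast
  define P where "P = (\<lambda>i. (h i, Suc i)) ` {..<card A}"
  have cA: "card A \<le> n" using card_mono[OF _ assms] by simp
  have mem: "(t, b) \<in> P \<longleftrightarrow> (\<exists>i<card A. t = h i \<and> b = Suc i)" for t b by (auto simp: P_def)
  have inj: "h i = h i' \<Longrightarrow> i < card A \<Longrightarrow> i' < card A \<Longrightarrow> i = i'" for i i'
    using h(1) by (auto simp: bij_betw_def inj_on_def)
  have hA: "h i \<in> A" if "i < card A" for i using h(1) that by (auto simp: bij_betw_def)
  have P: "part_inj n P" unfolding part_inj_def single_valued_def
    using inj hA assms cA by (auto simp: mem subset_iff)
  have "Domain P = h ` {..<card A}" by (force simp: P_def)
  then have dom: "Domain P = A" using bij_betw_imp_surj_on[OF h(1)] by simp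
  have "Domain (P\<inverse>) = Suc ` {..<card A}" by (force simp: P_def)
  then have ran: "Domain (P\<inverse>) = {1..card A}" by (simp add: image_Suc_lessThan)
  have "mono_rel P" unfolding mono_rel_def mem using strict_mono_onD[OF h(2)] by auto
  then show ?thesis
    using that[OF P] part_inj_comp_converse[OF P] part_inj_comp_converse[OF part_inj_converse[OF P]]
    unfolding dom ran by simp
qed

text \<open>The left factor is the order isomorphism onto the set of upper ends. It is planar, so the
  right factor is in the monoid whenever the diagram is; this treats the planar and the full rook
  monoid at once.\<close>

lemma factors_dia:
  assumes g: "part_inj n g" and X: "diagram_monoid n X" "carrier (pRo n) \<subseteq> carrier X"
    and mem: "dia n g \<in> carrier X" "dia n (g\<inverse>) \<in> carrier X"
  shows "\<exists>p q p' q'. factors n X (dia n g) p q p' q'"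
proof -
  interpret diagram_monoid n X by fact
  have A: "Domain g \<subseteq> {1..n}" using part_injD(1)[OF g] by auto
  obtain P where P: "part_inj n P" "mono_rel P" "P O P\<inverse> = Id_on (Domain g)" "P\<inverse> O P = Id_on {1..card (Domain g)}"
    by (rule order_bijection_rel[OF A])
  note P' = part_inj_converse[OF P(1)] and g' = part_inj_converse[OF g]
  have Pm: "dia n P \<in> carrier X" "dia n (P\<inverse>) \<in> carrier X"
    using X(2) P(1,2) P' mono_rel_converse[OF P(1,2)] by (auto simp: carrier_pRo)
  have card: "through_strands (dia n g) = card (Domain g)"
  proof -
    have "inj_on fst g" using part_injD(2)[OF g] by (auto simp: inj_on_def)
    then show ?thesis by (simp add: through_strands_dia[OF g] card_image Domain_fst)
  qed
  have le: "card (Domain g) \<le> n" using card_mono[OF _ A] by simp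
  have gg: "Id_on (Domain g) O g = g" "g\<inverse> O Id_on (Domain g) = g\<inverse>" by (auto simp: Id_on_iff)
  have P_Id: "P O Id_on {1..card (Domain g)} = P" "Id_on {1..card (Domain g)} O P\<inverse> = P\<inverse>"
  proof -
    have "b \<in> {1..card (Domain g)}" if "(t, b) \<in> P" for t b
    proof -
      have "(b, b) \<in> P\<inverse> O P" using that by blast
      then show ?thesis unfolding P(4) by (simp add: Id_on_iff)
    qed
    then show "P O Id_on {1..card (Domain g)} = P" "Id_on {1..card (Domain g)} O P\<inverse> = P\<inverse>"
      by (auto simp: Id_on_iff)
  qed
  have "factors n X (dia n g) (dia n P) (dia n (P\<inverse> O g)) (dia n (P\<inverse>)) (dia n (g\<inverse> O P))"
    unfolding factors_def card
  proof (intro conjI)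
    show "dia n (P\<inverse> O g) \<in> carrier X" using closed[OF Pm(2) mem(1)] by (simp add: stack_dia[OF P' g])
    show "dia n (g\<inverse> O P) \<in> carrier X" using closed[OF mem(2) Pm(1)] by (simp add: stack_dia[OF g' P(1)])
    show "dia n g = stack n (dia n P) (dia n (P\<inverse> O g))"
      using stack_dia[OF P(1) part_inj_comp[OF P' g]] P(3) gg by (simp add: O_assoc[symmetric])
    show "stack n (dia n (P\<inverse>)) (dia n P) = eps n (card (Domain g))"
      unfolding eps_def using stack_dia[OF P' P(1)] P(4) by simp
    have "(P\<inverse> O g) O (g\<inverse> O P) = P\<inverse> O (g O g\<inverse>) O P" by (simp add: O_assoc)
    also have "\<dots> = P\<inverse> O P O (P\<inverse> O P)" unfolding part_inj_comp_converse[OF g] P(3)[symmetric] by (simp add: O_assoc)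
    also have "\<dots> = Id_on {1..card (Domain g)}" using P(4) P_Id by (simp add: O_assoc[symmetric])
    finally show "stack n (dia n (P\<inverse> O g)) (dia n (g\<inverse> O P)) = eps n (card (Domain g))"
      unfolding eps_def using stack_dia[OF part_inj_comp[OF P' g] part_inj_comp[OF g' P(1)]] by simp
    have I: "part_inj n (Id_on {1..card (Domain g)})" using le by (intro part_inj_Id_on) auto
    show "stack n (dia n P) (eps n (card (Domain g))) = dia n P"
      unfolding eps_def using stack_dia[OF P(1) I] P_Id by simp
    show "stack n (eps n (card (Domain g))) (dia n (P\<inverse> O g)) = dia n (P\<inverse> O g)"
      unfolding eps_def using stack_dia[OF I part_inj_comp[OF P' g]] P_Id by (simp add: O_assoc[symmetric])
  qed (use Pm le in auto)
  then show ?thesis by blast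
qed

lemma pRo_sub: "carrier (pRo n) \<subseteq> carrier (Ro n)"
  by (auto simp: pRo_def)

lemma factorizable_Ro: "factorizable_monoid n (Ro n)"
proof -
  interpret diagram_monoid n "Ro n" by (rule diagram_monoid_Ro)
  show ?thesis
    by unfold_locales
      (unfold carrier_Ro, elim imageE CollectE, hypsubst,
        intro factors_dia[OF _ diagram_monoid_Ro pRo_sub], auto simp: carrier_Ro part_inj_converse)
qed

lemma factorizable_pRo: "factorizable_monoid n (pRo n)"
proof -
  interpret diagram_monoid n "pRo n" by (rule diagram_monoid_pRo)
  show ?thesis
    by unfold_locales
      (unfold carrier_pRo, elim imageE CollectE conjE, hypsubst,
        intro factors_dia[OF _ diagram_monoid_pRo order_refl],
        auto simp: carrier_pRo part_inj_converse mono_rel_converse)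
qed

text \<open>Rook diagrams have inverses, and their idempotents are partial identities, which are
  planar.\<close>

lemma Ro_inverse:
  assumes "d \<in> carrier (Ro n)"
  shows "\<exists>d'\<in>carrier (Ro n). stack n d d' \<in> carrier (pRo n) \<and> stack n d' d \<in> carrier (pRo n) \<and>
    stack n (stack n d d') d = d"
proof -
  obtain g where g: "part_inj n g" "d = dia n g" using assms by (auto simp: carrier_Ro)
  note g' = part_inj_converse[OF g(1)]
  have D: "Domain g \<subseteq> {1..n}" "Domain (g\<inverse>) \<subseteq> {1..n}" using part_injD(1)[OF g(1)] by auto
  have I: "dia n (Id_on A) \<in> carrier (pRo n)" if "A \<subseteq> {1..n}" for A
    unfolding carrier_pRo
    by (intro imageI CollectI conjI part_inj_Id_on[OF that]) (auto simp: mono_rel_def)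
  have "Id_on (Domain g) O g = g" by (auto simp: Id_on_iff)
  moreover have "stack n d (dia n (g\<inverse>)) = dia n (Id_on (Domain g))"
    unfolding g(2) stack_dia[OF g(1) g'] part_inj_comp_converse[OF g(1)] ..
  moreover have "stack n (dia n (g\<inverse>)) d = dia n (Id_on (Domain (g\<inverse>)))"
    unfolding g(2) stack_dia[OF g' g(1)] using part_inj_comp_converse[OF g'] by simp
  moreover have "dia n (g\<inverse>) \<in> carrier (Ro n)" using g' by (simp add: carrier_Ro)
  ultimately show ?thesis
    using I[OF D(1)] I[OF D(2)] stack_dia[OF part_inj_Id_on[OF D(1)] g(1)] g(2)
    by (intro bexI[of _ "dia n (g\<inverse>)"]) simp_all
qed

lemma Ro_zero:
  assumes "d \<in> carrier (Ro n)"
  shows "stack n d (eps n 0) = eps n 0"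
proof -
  obtain g where g: "part_inj n g" "d = dia n g" using assms by (auto simp: carrier_Ro)
  have "g O Id_on {1..0} = Id_on {1..0}" by auto
  then show ?thesis unfolding g(2) eps_def using stack_dia[OF g(1) part_inj_Id_on[of "{1..0}" n]] by simp
qed

section \<open>Rees factors of truncated diagram monoids\<close>

context factorizable_monoid
begin

lemma factor_rank:
  assumes "d \<in> carrier X"
  shows "through_strands d \<le> n" "le_lr X (eps n (through_strands d)) d" "le_lr X d (eps n (through_strands d))"
proof -
  let ?j = "through_strands d"
  obtain p q p' q' where F: "factors n X d p q p' q'" using factorizable assms by blast
  have c: "p \<in> carrier X" "q \<in> carrier X" "p' \<in> carrier X" "q' \<in> carrier X" "?j \<le> n"
    and eq: "d = stack n p q" "stack n p' p = eps n ?j" "stack n q q' = eps n ?j" "stack n p (eps n ?j) = p"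
    using F unfolding factors_def by blast+
  show "?j \<le> n" by fact
  have "d = stack n (stack n p (eps n ?j)) q" using eq by simp
  then show "le_lr X (eps n ?j) d" unfolding le_lr_def mult_eq using c by blast
  have "stack n (stack n p' d) q' = stack n (stack n p' p) (stack n q q')"
    unfolding eq(1) using c by (simp add: assoc closed)
  also have "\<dots> = eps n ?j" using eq c by (simp add: stack_eps)
  finally show "le_lr X d (eps n ?j)" unfolding le_lr_def mult_eq using c by metis
qed

lemma le_lr_rank: "a \<in> carrier X \<Longrightarrow> le_lr X a b \<Longrightarrow> through_strands b \<le> through_strands a"
  unfolding le_lr_def mult_eq using through_strands_stack_le partition by blast

lemma le_lr_trans: "a \<in> carrier X \<Longrightarrow> le_lr X a b \<Longrightarrow> le_lr X b c \<Longrightarrow> le_lr X a c"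
proof -
  assume a: "a \<in> carrier X" and "le_lr X a b" "le_lr X b c"
  then obtain s t u v where "s \<in> carrier X" "t \<in> carrier X" "u \<in> carrier X" "v \<in> carrier X"
    "b = stack n (stack n s a) t" "c = stack n (stack n u b) v" unfolding le_lr_def mult_eq by blast
  moreover from this a have "c = stack n (stack n (stack n u s) a) (stack n t v)"
    by (simp add: assoc closed)
  ultimately show ?thesis unfolding le_lr_def mult_eq using closed by blast
qed

theorem le_lr_iff:
  assumes a: "a \<in> carrier X" and b: "b \<in> carrier X"
  shows "le_lr X a b \<longleftrightarrow> through_strands b \<le> through_strands a"
proof
  assume le: "through_strands b \<le> through_strands a"
  let ?i = "through_strands b" and ?j = "through_strands a"
  have ij: "?i \<le> n" "?j \<le> n" using factor_rank a b by auto
  have "eps n ?i = stack n (stack n (eps n n) (eps n ?j)) (eps n ?i)"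
    using ij le by (simp add: stack_eps min_def)
  then have "le_lr X (eps n ?j) (eps n ?i)" unfolding le_lr_def mult_eq using eps_closed ij by blast
  then show "le_lr X a b"
    using factor_rank(3)[OF a] factor_rank(2)[OF b] le_lr_trans a eps_closed ij by blast
qed (rule le_lr_rank[OF a])

text \<open>The elements that are identified to zero, once the order of the cells is expressed by
  through strands.\<close>

definition low :: "nat \<Rightarrow> nat \<Rightarrow> point set set set" where
  "low k l = {s \<in> carrier (trunc X k). through_strands s < l}"

lemma trunc2_eq:
  assumes l: "l \<le> n"
  shows "trunc2 X k l = rees_factor (trunc X k) (low k l)"
proof -
  have "(\<exists>a\<in>J X l. le_lr X a s \<and> \<not> le_lr X s a) \<longleftrightarrow> through_strands s < l"
    if s: "s \<in> carrier (trunc X k)" for s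
  proof -
    have sc: "s \<in> carrier X" using s trunc_sub by blast
    have "eps n l \<in> J X l" using l by (simp add: J_def eps_closed through_strands_eps)
    then show ?thesis using le_lr_iff sc by (auto simp: J_def)
  qed
  then show ?thesis unfolding trunc2_def low_def by (metis (no_types, lifting))
qed

lemma low_ideal: "monoid_ideal (trunc X k) (low k l)"
proof -
  interpret T: fin_monoid "trunc X k" by (rule fin_monoid_trunc)
  show ?thesis
  proof
    show "low k l \<subseteq> carrier (trunc X k)" by (auto simp: low_def)
    fix s x assume s: "s \<in> carrier (trunc X k)" and x: "x \<in> low k l"
    have xc: "x \<in> carrier (trunc X k)" "through_strands x < l" using x by (auto simp: low_def)
    have c: "s \<in> carrier X" "x \<in> carrier X" "eps n n \<in> carrier X" using s xc trunc_sub eps_closed by auto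
    have "through_strands (stack n (stack n s x) (eps n n)) \<le> through_strands x"
      "through_strands (stack n (stack n (eps n n) x) s) \<le> through_strands x"
      using c partition by (blast intro: through_strands_stack_le)+
    then show "s \<otimes>\<^bsub>trunc X k\<^esub> x \<in> low k l" "x \<otimes>\<^bsub>trunc X k\<^esub> s \<in> low k l"
      using c s xc trunc_closed by (auto simp: low_def mult_trunc l_one' r_one' closed)
  qed
qed

lemma eps_n_notin_low: "l \<le> n \<Longrightarrow> eps n n \<notin> low k l"
  by (simp add: low_def through_strands_eps)

lemma eps_notin_low: "l \<le> j \<Longrightarrow> j \<le> n \<Longrightarrow> eps n j \<notin> low k l"
  by (simp add: low_def through_strands_eps)

lemma conical_trunc2:
  assumes "k < n" "l \<le> n"
  shows "conical_monoid (trunc2 X k l)"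
proof -
  interpret monoid_ideal "trunc X k" "low k l" by (rule low_ideal)
  show ?thesis unfolding trunc2_eq[OF assms(2)]
    by (rule conical_Q[OF conical_trunc[OF assms(1)]]) (simp add: one_trunc eps_n_notin_low assms)
qed

abbreviation cl :: "nat \<Rightarrow> nat \<Rightarrow> point set set \<Rightarrow> point set set set" where
  "cl k l x \<equiv> rees_rel (trunc X k) (low k l) `` {x}"

lemma cl_mult:
  assumes "l \<le> n" "x \<in> carrier (trunc X k)" "y \<in> carrier (trunc X k)"
  shows "cl k l x \<otimes>\<^bsub>trunc2 X k l\<^esub> cl k l y = cl k l (stack n x y)"
proof -
  interpret monoid_ideal "trunc X k" "low k l" by (rule low_ideal)
  show ?thesis using mult_Q[OF assms(2,3)] by (simp add: trunc2_eq assms mult_trunc)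
qed

lemma cl_closed: "l \<le> n \<Longrightarrow> x \<in> carrier (trunc X k) \<Longrightarrow> cl k l x \<in> carrier (trunc2 X k l)"
  and carrier_trunc2: "l \<le> n \<Longrightarrow> carrier (trunc2 X k l) = cl k l ` carrier (trunc X k)"
  and one_trunc2: "l \<le> n \<Longrightarrow> \<one>\<^bsub>trunc2 X k l\<^esub> = cl k l (eps n n)"
proof -
  interpret monoid_ideal "trunc X k" "low k l" by (rule low_ideal)
  show "l \<le> n \<Longrightarrow> x \<in> carrier (trunc X k) \<Longrightarrow> cl k l x \<in> carrier (trunc2 X k l)"
    "l \<le> n \<Longrightarrow> carrier (trunc2 X k l) = cl k l ` carrier (trunc X k)"
    "l \<le> n \<Longrightarrow> \<one>\<^bsub>trunc2 X k l\<^esub> = cl k l (eps n n)"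
    by (simp only: trunc2_eq cls_closed, simp only: trunc2_eq carrier_Q, simp only: trunc2_eq one_Q one_trunc)
qed

lemma cl_eq_iff:
  assumes "x \<in> carrier (trunc X k)" "y \<in> carrier (trunc X k)"
  shows "cl k l x = cl k l y \<longleftrightarrow> x = y \<or> x \<in> low k l \<and> y \<in> low k l"
proof -
  interpret monoid_ideal "trunc X k" "low k l" by (rule low_ideal)
  show ?thesis by (rule cls_eq_iff[OF assms])
qed

theorem ssgap_trunc2_le:
  assumes k: "k < n" and l: "l \<le> n" and j: "1 \<le> j" "j \<le> k" "l \<le> j"
  shows "ssgap (F :: 'f::field itself) (trunc2 X k l) \<le> ereal (real (num_r_cells (trunc2 X k l) (cl k l (eps n j))))"
proof -
  interpret Q: conical_monoid "trunc2 X k l" by (rule conical_trunc2[OF k l])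
  have c: "eps n j \<in> carrier (trunc X k)" "eps n 0 \<in> carrier (trunc X k)" "eps n n \<in> carrier (trunc X k)"
    using j k eps_in_trunc[of j k] eps_in_trunc[of 0 k] in_trunc_iff[of "eps n n" k] eps_closed[of n]
    by simp_all
  have nl: "eps n j \<notin> low k l" using j k by (intro eps_notin_low) auto
  show ?thesis
  proof (rule Q.ssgap_le)
    show "cl k l (eps n j) \<in> carrier (trunc2 X k l)" "cl k l (eps n 0) \<in> carrier (trunc2 X k l)"
      using cl_closed[OF l] c by auto
    show "cl k l (eps n j) \<otimes>\<^bsub>trunc2 X k l\<^esub> cl k l (eps n j) = cl k l (eps n j)"
      using cl_mult[OF l c(1,1)] j k by (simp add: stack_eps)
    show "cl k l (eps n j) \<noteq> \<one>\<^bsub>trunc2 X k l\<^esub>"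
      unfolding one_trunc2[OF l] cl_eq_iff[OF c(1,3)] using nl eps_neq[of j] j k by auto
    show "\<not> le_lr (trunc2 X k l) (cl k l (eps n 0)) (cl k l (eps n j))"
    proof
      assume "le_lr (trunc2 X k l) (cl k l (eps n 0)) (cl k l (eps n j))"
      then obtain x y where xy: "x \<in> carrier (trunc X k)" "y \<in> carrier (trunc X k)"
        "cl k l (eps n j) = cl k l x \<otimes>\<^bsub>trunc2 X k l\<^esub> cl k l (eps n 0) \<otimes>\<^bsub>trunc2 X k l\<^esub> cl k l y"
        unfolding le_lr_def carrier_trunc2[OF l] by blast
      have xe: "stack n x (eps n 0) \<in> carrier (trunc X k)" using trunc_closed xy c by blast
      have "cl k l (eps n j) = cl k l (stack n (stack n x (eps n 0)) y)"
        using xy(3) unfolding cl_mult[OF l xy(1) c(2)] cl_mult[OF l xe xy(2)] .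
      then have "eps n j = stack n (stack n x (eps n 0)) y"
        using cl_eq_iff[OF c(1) trunc_closed[OF xe xy(2)]] nl by blast
      then have "le_lr (trunc X k) (eps n 0) (eps n j)"
        unfolding le_lr_def mult_trunc using xy by blast
      then show False using not_le_lr_eps_0 j k by auto
    qed
  qed
qed

theorem le_ssgap_trunc2:
  assumes k: "k < n" and l: "l \<le> n"
    and b: "\<And>j. 1 \<le> j \<Longrightarrow> j \<le> k \<Longrightarrow> l \<le> j \<Longrightarrow> b \<le> ereal (real (num_r_cells (trunc2 X k l) (cl k l (eps n j))))"
  shows "b \<le> ssgap (F :: 'f::field itself) (trunc2 X k l)"
proof -
  interpret I: monoid_ideal "trunc X k" "low k l" by (rule low_ideal)
  interpret Q: conical_monoid "trunc2 X k l" by (rule conical_trunc2[OF k l])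
  show ?thesis
  proof (rule Q.le_ssgap)
    fix E assume E: "E \<in> carrier (trunc2 X k l)" "E \<otimes>\<^bsub>trunc2 X k l\<^esub> E = E" "E \<noteq> \<one>\<^bsub>trunc2 X k l\<^esub>"
      and ne: "\<exists>s\<in>carrier (trunc2 X k l). E \<otimes>\<^bsub>trunc2 X k l\<^esub> s \<otimes>\<^bsub>trunc2 X k l\<^esub> E \<noteq> E"
    obtain e where e: "e \<in> carrier (trunc X k)" and E_eq: "E = cl k l e" using E carrier_trunc2[OF l] by auto
    obtain s where s: "s \<in> carrier (trunc X k)" "cl k l (stack n (stack n e s) e) \<noteq> cl k l e"
    proof -
      obtain s where s: "s \<in> carrier (trunc X k)"
        "cl k l e \<otimes>\<^bsub>trunc2 X k l\<^esub> cl k l s \<otimes>\<^bsub>trunc2 X k l\<^esub> cl k l e \<noteq> cl k l e"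
        using ne unfolding E_eq carrier_trunc2[OF l] by blast
      from s(2)[unfolded cl_mult[OF l e s(1)] cl_mult[OF l trunc_closed[OF e s(1)] e]] s(1) that
      show ?thesis by blast
    qed
    have es: "stack n (stack n e s) e \<in> carrier (trunc X k)" using trunc_closed e s by blast
    let ?j = "through_strands e"
    have enl: "e \<notin> low k l"
    proof
      assume "e \<in> low k l"
      then have "stack n (stack n e s) e \<in> low k l"
        using I.ideal_l[OF trunc_closed[OF e s(1)]] by (simp add: mult_trunc)
      then show False using s(2) cl_eq_iff[OF es e] \<open>e \<in> low k l\<close> by blast
    qed
    have ec: "e \<in> carrier X" using e trunc_sub by blast
    have ee: "stack n e e = e"
      using E(2) enl cl_eq_iff[OF trunc_closed[OF e e] e] unfolding E_eq cl_mult[OF l e e] by blast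
    have e1: "e \<noteq> eps n n" using E(3) unfolding E_eq one_trunc2[OF l] by blast
    have jk: "?j \<le> k" by (rule through_strands_trunc_le[OF e e1])
    have lj: "l \<le> ?j" using enl e by (auto simp: low_def)
    have j1: "1 \<le> ?j"
    proof (rule ccontr)
      assume "\<not> 1 \<le> ?j"
      then have "stack n (stack n e s) e = e" using rank_zero_absorb[OF ec] trunc_sub s(1) by auto
      then show False using s(2) by simp
    qed
    obtain p q where pq: "p \<in> carrier (trunc X k)" "q \<in> carrier (trunc X k)"
      "stack n p q = e" "stack n q p = eps n ?j"
      using idempotent_conjugate_eps[OF ec ee jk] k by auto
    have ej: "eps n ?j \<in> carrier (trunc X k)" "stack n (eps n ?j) (eps n ?j) = eps n ?j"
      using jk k by (auto intro: eps_in_trunc simp: stack_eps)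
    have "num_r_cells (trunc2 X k l) (cl k l e) = num_r_cells (trunc2 X k l) (cl k l (eps n ?j))"
      by (rule Q.num_r_cells_conjugate[OF cl_closed[OF l pq(1)] cl_closed[OF l pq(2)]])
        (simp_all only: cl_mult[OF l pq(1,2)] cl_mult[OF l pq(2,1)] cl_mult[OF l e e] cl_mult[OF l ej(1,1)] pq(3,4) ee ej(2))
    then show "b \<le> ereal (real (num_r_cells (trunc2 X k l) E))" using b[OF j1 jk lj] unfolding E_eq by simp
  qed
qed

end

text \<open>For Rees factors the ideals of the two monoids must be compared, so both are required to
  have factorizations.\<close>

locale factorizable_pair = Y: factorizable_monoid n Y + X: factorizable_monoid n X
  for n :: nat and Y X :: "point set set monoid" +
  assumes pair_sub: "carrier Y \<subseteq> carrier X"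
begin

sublocale diagram_pair n Y X
  by unfold_locales (rule pair_sub)

lemma low_pair: "ideal_pair (trunc Y k) (trunc X k) (X.low k l) (Y.low k l)"
proof -
  interpret submonoid_pair "trunc Y k" "trunc X k" by (rule submonoid_trunc)
  interpret monoid_ideal "trunc X k" "X.low k l" by (rule X.low_ideal)
  show ?thesis by unfold_locales (use sub in \<open>auto simp: X.low_def Y.low_def\<close>)
qed

lemma trunc2_embedding:
  assumes "l \<le> n"
  obtains \<phi> where "monoid_embedding (trunc2 Y k l) (trunc2 X k l) \<phi>"
    "\<And>x. x \<in> carrier (trunc Y k) \<Longrightarrow> \<phi> (Y.cl k l x) = X.cl k l x"
proof -
  interpret ideal_pair "trunc Y k" "trunc X k" "X.low k l" "Y.low k l" by (rule low_pair)
  show ?thesis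
    using that[of factor_emb] factor_embedding factor_emb_cls
    unfolding X.trunc2_eq[OF assms] Y.trunc2_eq[OF assms] by blast
qed

theorem faith_trunc2:
  assumes "l \<le> n"
  shows "faith (F :: 'f::field itself) (trunc2 Y k l) \<le> faith F (trunc2 X k l)"
proof -
  obtain \<phi> where "monoid_embedding (trunc2 Y k l) (trunc2 X k l) \<phi>" using trunc2_embedding[OF assms] by metis
  then interpret monoid_embedding "trunc2 Y k l" "trunc2 X k l" \<phi> .
  show ?thesis by (rule faith_mono)
qed

theorem ssgap_trunc2:
  assumes k: "k < n" and l: "l \<le> n"
  shows "ssgap (F :: 'f::field itself) (trunc2 Y k l) \<le> ssgap F (trunc2 X k l)"
proof (rule X.le_ssgap_trunc2[OF k l])
  fix j assume j: "1 \<le> j" "j \<le> k" "l \<le> j"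
  obtain \<phi> where \<phi>: "monoid_embedding (trunc2 Y k l) (trunc2 X k l) \<phi>"
    "\<And>x. x \<in> carrier (trunc Y k) \<Longrightarrow> \<phi> (Y.cl k l x) = X.cl k l x"
    using trunc2_embedding[OF l] by metis
  interpret monoid_embedding "trunc2 Y k l" "trunc2 X k l" \<phi> by (rule \<phi>(1))
  have ej: "eps n j \<in> carrier (trunc Y k)" using j k by (intro Y.eps_in_trunc) auto
  have "num_r_cells (trunc2 Y k l) (Y.cl k l (eps n j)) \<le> num_r_cells (trunc2 X k l) (\<phi> (Y.cl k l (eps n j)))"
    by (rule num_r_cells_mono) (use Y.cl_closed[OF l ej] Y.cl_mult[OF l ej ej] j k in \<open>simp_all add: stack_eps\<close>)
  then show "ssgap F (trunc2 Y k l) \<le> ereal (real (num_r_cells (trunc2 X k l) (X.cl k l (eps n j))))"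
    using Y.ssgap_trunc2_le[OF k l j, of F] unfolding \<phi>(2)[OF ej] by (simp add: order_trans)
qed

end

text \<open>The situation of the planar rook monoid in the rook monoid.\<close>

locale inverse_pair = factorizable_pair +
  assumes inverse: "d \<in> carrier X \<Longrightarrow> \<exists>d'\<in>carrier X. stack n d d' \<in> carrier Y \<and>
      stack n d' d \<in> carrier Y \<and> stack n (stack n d d') d = d"
    and zero: "d \<in> carrier X \<Longrightarrow> stack n d (eps n 0) = eps n 0"
begin

text \<open>An element \<open>d\<close> of the left cell of \<open>eps n j\<close> has the idempotent \<open>f = d d'\<close> in its right
  cell. This \<open>f\<close> is in the small monoid and is conjugate there to \<open>eps n j\<close>, and the conjugating
  factor \<open>p\<close> lies in the small left cell and in the right cell of \<open>d\<close>. So the small left cell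
  meets every right cell that the large one meets.\<close>

theorem ssgap_trunc2_eq:
  assumes k: "k < n" and l: "l \<le> n"
  shows "ssgap (F :: 'f::field itself) (trunc2 X k l) = ssgap F (trunc2 Y k l)"
proof (rule antisym[OF _ ssgap_trunc2[OF k l]], rule Y.le_ssgap_trunc2[OF k l])
  fix j assume j: "1 \<le> j" "j \<le> k" "l \<le> j"
  obtain \<phi> where \<phi>: "monoid_embedding (trunc2 Y k l) (trunc2 X k l) \<phi>"
    "\<And>x. x \<in> carrier (trunc Y k) \<Longrightarrow> \<phi> (Y.cl k l x) = X.cl k l x"
    using trunc2_embedding[OF l] by metis
  interpret E: monoid_embedding "trunc2 Y k l" "trunc2 X k l" \<phi> by (rule \<phi>(1))
  interpret I: monoid_ideal "trunc X k" "X.low k l" by (rule X.low_ideal)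
  interpret TS: submonoid_pair "trunc Y k" "trunc X k" by (rule submonoid_trunc)
  have kn: "k \<le> n" using k by simp
  have ejY: "eps n j \<in> carrier (trunc Y k)" and ejX: "eps n j \<in> carrier (trunc X k)"
    using j kn by (auto intro: Y.eps_in_trunc X.eps_in_trunc)
  have eX: "eps n j \<in> carrier X" using ejX X.trunc_sub by blast
  have nl: "eps n j \<notin> X.low k l" using j k by (intro X.eps_notin_low) auto
  have "num_r_cells (trunc2 Y k l) (Y.cl k l (eps n j)) = num_r_cells (trunc2 X k l) (\<phi> (Y.cl k l (eps n j)))"
  proof (rule E.num_r_cells_eq)
    show "Y.cl k l (eps n j) \<in> carrier (trunc2 Y k l)" by (rule Y.cl_closed[OF l ejY])
    show "Y.cl k l (eps n j) \<otimes>\<^bsub>trunc2 Y k l\<^esub> Y.cl k l (eps n j) = Y.cl k l (eps n j)"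
      using Y.cl_mult[OF l ejY ejY] j k by (simp add: stack_eps)
    fix U assume "U \<in> l_cell (trunc2 X k l) (\<phi> (Y.cl k l (eps n j)))"
    then obtain S T where ST: "U \<in> carrier (trunc2 X k l)" "S \<in> carrier (trunc2 X k l)" "T \<in> carrier (trunc2 X k l)"
      "U = S \<otimes>\<^bsub>trunc2 X k l\<^esub> X.cl k l (eps n j)" "X.cl k l (eps n j) = T \<otimes>\<^bsub>trunc2 X k l\<^esub> U"
      unfolding \<phi>(2)[OF ejY] by (rule l_cellD)
    obtain s t where s: "s \<in> carrier (trunc X k)" "S = X.cl k l s" and t: "t \<in> carrier (trunc X k)" "T = X.cl k l t"
      using ST(2,3) X.carrier_trunc2[OF l] by auto
    define d where "d = stack n s (eps n j)"
    have dc: "d \<in> carrier (trunc X k)" unfolding d_def by (rule X.trunc_closed[OF s(1) ejX])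
    have U: "U = X.cl k l d" using ST(4) unfolding s(2) X.cl_mult[OF l s(1) ejX] d_def .
    have "X.cl k l (eps n j) = X.cl k l (stack n t d)" using ST(5) unfolding t(2) U X.cl_mult[OF l t(1) dc] .
    then have td: "stack n t d = eps n j"
      using X.cl_eq_iff[OF ejX X.trunc_closed[OF t(1) dc]] nl by metis
    have dX: "d \<in> carrier X" and tX: "t \<in> carrier X" and sX: "s \<in> carrier X" using dc t s X.trunc_sub by auto
    have d_eps: "stack n d (eps n j) = d"
      unfolding d_def using sX eX j k by (simp add: X.assoc stack_eps)
    obtain d' where d': "d' \<in> carrier X" "stack n d d' \<in> carrier Y" "stack n (stack n d d') d = d"
      using inverse[OF dX] by blast
    define f where "f = stack n d d'"
    have fY: "f \<in> carrier Y" and fX: "f \<in> carrier X" using d' pair_sub by (auto simp: f_def)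
    have fd: "stack n f d = d" using d' by (simp add: f_def)
    have ff: "stack n f f = f"
      using fd unfolding f_def using dX d'(1) by (metis X.assoc X.closed)
    have one: "eps n n \<in> carrier X" by (rule X.eps_closed) simp
    have "through_strands f = j"
    proof (rule antisym)
      have "f = stack n (stack n s (eps n j)) d'" by (simp add: f_def d_def)
      then show "through_strands f \<le> j"
        using through_strands_stack_le[of n s "eps n j" d'] sX eX d'(1) X.partition
        by (metis through_strands_eps j(2) kn le_trans)
      have "eps n j = stack n (stack n t f) d" using td fd tX fX dX by (simp add: X.assoc)
      then show "j \<le> through_strands f"
        using through_strands_stack_le[of n t f d] tX fX dX X.partition
        by (metis through_strands_eps j(2) kn le_trans)
    qed
    then obtain p0 q where pq: "p0 \<in> carrier (trunc Y k)" "q \<in> carrier (trunc Y k)"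
      "stack n p0 q = f" "stack n q p0 = eps n j"
      using Y.idempotent_conjugate_eps[OF fY ff, of k] j kn by auto
    define p where "p = stack n p0 (eps n j)"
    have p: "p \<in> carrier (trunc Y k)" unfolding p_def by (rule Y.trunc_closed[OF pq(1) ejY])
    have cY: "p0 \<in> carrier Y" "q \<in> carrier Y" "p \<in> carrier Y" "eps n j \<in> carrier Y"
      using p pq ejY Y.trunc_sub by auto
    have ee: "stack n (eps n j) (eps n j) = eps n j" using j kn by (simp add: stack_eps)
    have p_eps: "stack n p (eps n j) = p" unfolding p_def using cY ee by (simp add: Y.assoc)
    have p_eq: "p = stack n f p0" unfolding p_def pq(4)[symmetric] pq(3)[symmetric]
      using cY by (simp add: Y.assoc Y.closed)
    have qp: "stack n q p = eps n j" unfolding p_def using cY pq(4) ee by (simp flip: Y.assoc)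
    have "stack n p q = stack n f (stack n p0 q)" unfolding p_eq using cY fY by (simp add: Y.assoc)
    then have pq': "stack n p q = f" using pq(3) ff by simp
    have fp: "stack n f p = p" unfolding p_eq using cY fY ff by (simp flip: Y.assoc)
    have pX: "p \<in> carrier (trunc X k)" and qX: "q \<in> carrier (trunc X k)" using p pq TS.sub by auto
    have cX: "p \<in> carrier X" "q \<in> carrier X" using pX qX X.trunc_sub by auto
    show "\<exists>v\<in>l_cell (trunc2 Y k l) (Y.cl k l (eps n j)). r_cell (trunc2 X k l) (\<phi> v) = r_cell (trunc2 X k l) U"
    proof (rule bexI)
      show "Y.cl k l p \<in> l_cell (trunc2 Y k l) (Y.cl k l (eps n j))"
      proof (rule l_cellI)
        show "Y.cl k l p = Y.cl k l p \<otimes>\<^bsub>trunc2 Y k l\<^esub> Y.cl k l (eps n j)"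
          using Y.cl_mult[OF l p ejY] p_eps by simp
        show "Y.cl k l (eps n j) = Y.cl k l q \<otimes>\<^bsub>trunc2 Y k l\<^esub> Y.cl k l p"
          using Y.cl_mult[OF l pq(2) p] qp by simp
      qed (use Y.cl_closed[OF l] p pq(2) in auto)
      have qd: "stack n q d \<in> carrier (trunc X k)" by (rule X.trunc_closed[OF qX dc])
      have d'p: "stack n d' p \<in> carrier (trunc X k)"
        by (rule X.in_trunc_if_eps_right[where j=j])
          (use d'(1) cX eX p_eps j kn in \<open>simp_all add: X.assoc X.closed\<close>)
      have 1: "stack n p (stack n q d) = d" using pq' fd cX dX by (simp flip: X.assoc)
      have 2: "stack n d (stack n d' p) = p" using fp cX dX d'(1) unfolding f_def by (simp add: X.assoc)
      have "r_cell (trunc2 X k l) (X.cl k l p) = r_cell (trunc2 X k l) (X.cl k l d)"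
        by (rule E.S.r_cell_eqI[OF X.cl_closed[OF l pX] X.cl_closed[OF l dc] X.cl_closed[OF l qd] X.cl_closed[OF l d'p]])
          (simp_all only: X.cl_mult[OF l pX qd] X.cl_mult[OF l dc d'p] 1 2)
      then show "r_cell (trunc2 X k l) (\<phi> (Y.cl k l p)) = r_cell (trunc2 X k l) U"
        unfolding U \<phi>(2)[OF p] .
    qed
  qed
  then show "ssgap F (trunc2 X k l) \<le> ereal (real (num_r_cells (trunc2 Y k l) (Y.cl k l (eps n j))))"
    using X.ssgap_trunc2_le[OF k l j, of F] unfolding \<phi>(2)[OF ejY] by simp
qed

text \<open>The diagram without strands is a zero, and \<open>d' d\<close> is an idempotent of the small monoid
  which fixes \<open>d\<close> from the right.\<close>

theorem rep_gap_trunc2: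
  assumes k: "k < n" and l: "l \<le> n"
  shows "rep_gap (F :: 'f::field itself) (trunc2 Y k l) \<le> rep_gap F (trunc2 X k l)"
proof -
  obtain \<phi> where \<phi>: "monoid_embedding (trunc2 Y k l) (trunc2 X k l) \<phi>"
    "\<And>x. x \<in> carrier (trunc Y k) \<Longrightarrow> \<phi> (Y.cl k l x) = X.cl k l x"
    using trunc2_embedding[OF l] by metis
  interpret monoid_embedding "trunc2 Y k l" "trunc2 X k l" \<phi> by (rule \<phi>(1))
  interpret TC: conical_monoid "trunc2 Y k l" by (rule Y.conical_trunc2[OF k l])
  interpret SC: conical_monoid "trunc2 X k l" by (rule X.conical_trunc2[OF k l])
  interpret conical_embedding "trunc2 Y k l" "trunc2 X k l" \<phi> by unfold_locales
  have kn: "k \<le> n" using k by simp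
  have e0: "eps n 0 \<in> carrier (trunc Y k)" "eps n 0 \<in> carrier (trunc X k)"
    using kn by (auto intro: Y.eps_in_trunc X.eps_in_trunc)
  have e1: "eps n n \<in> carrier (trunc Y k)" by (simp add: Y.in_trunc_iff Y.eps_closed)
  have not_one: "Y.cl k l f \<noteq> \<one>\<^bsub>trunc2 Y k l\<^esub>" if "f \<in> carrier (trunc Y k)" "f \<noteq> eps n n" for f
    unfolding Y.one_trunc2[OF l] Y.cl_eq_iff[OF that(1) e1] using that Y.eps_n_notin_low[OF l] by blast
  show ?thesis
  proof (rule rep_gap_mono)
    show "Y.cl k l (eps n 0) \<in> carrier (trunc2 Y k l)" by (rule Y.cl_closed[OF l e0(1)])
    show "Y.cl k l (eps n 0) \<noteq> \<one>\<^bsub>trunc2 Y k l\<^esub>"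
      by (rule not_one[OF e0(1) Y.eps_neq]) (use k in simp)
    fix S assume S: "S \<in> carrier (trunc2 X k l)"
    then obtain s where s: "s \<in> carrier (trunc X k)" "S = X.cl k l s" using X.carrier_trunc2[OF l] by auto
    have sX: "s \<in> carrier X" using s X.trunc_sub by auto
    show "S \<otimes>\<^bsub>trunc2 X k l\<^esub> \<phi> (Y.cl k l (eps n 0)) = \<phi> (Y.cl k l (eps n 0))"
      unfolding \<phi>(2)[OF e0(1)] s(2) X.cl_mult[OF l s(1) e0(2)] zero[OF sX] ..
    assume "S \<noteq> \<one>\<^bsub>trunc2 X k l\<^esub>"
    then have "s \<noteq> eps n n" unfolding s(2) X.one_trunc2[OF l] by blast
    then have rank: "through_strands s \<le> k" using X.through_strands_trunc_le s by blast
    obtain s' where s': "s' \<in> carrier X" "stack n s' s \<in> carrier Y" "stack n (stack n s s') s = s"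
      using inverse[OF sX] by blast
    let ?f = "stack n s' s"
    have one: "eps n n \<in> carrier X" by (rule X.eps_closed) simp
    have "through_strands (stack n (stack n s' s) (eps n n)) \<le> through_strands s"
      by (rule through_strands_stack_le) (use s' sX one X.partition in auto)
    then have frank: "through_strands ?f \<le> k" using rank s' pair_sub by (simp add: X.r_one' subset_iff)
    then have f: "?f \<in> carrier (trunc Y k)" using s'(2) by (simp add: Y.carrier_trunc[OF kn])
    have fX: "?f \<in> carrier (trunc X k)" using s'(2) pair_sub frank by (auto simp: X.carrier_trunc[OF kn])
    have "?f \<noteq> eps n n" using frank k through_strands_eps[of n n] by auto
    moreover have "S \<otimes>\<^bsub>trunc2 X k l\<^esub> \<phi> (Y.cl k l ?f) = S"
      unfolding \<phi>(2)[OF f] s(2) X.cl_mult[OF l s(1) fX] using s' sX by (simp flip: X.assoc)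
    ultimately show "\<exists>f\<in>carrier (trunc2 Y k l). f \<noteq> \<one>\<^bsub>trunc2 Y k l\<^esub> \<and> S \<otimes>\<^bsub>trunc2 X k l\<^esub> \<phi> f = S"
      by (intro bexI[OF _ Y.cl_closed[OF l f]] conjI not_one[OF f])
  qed
qed

end

lemma inverse_pair_Ro: "inverse_pair n (pRo n) (Ro n)"
proof -
  interpret Y: factorizable_monoid n "pRo n" by (rule factorizable_pRo)
  interpret X: factorizable_monoid n "Ro n" by (rule factorizable_Ro)
  show ?thesis
    by unfold_locales (use pRo_sub Ro_inverse Ro_zero in auto)
qed

section \<open>Involution numbers and Stirling numbers\<close>

text \<open>The number of ways to partition a set into blocks of size at most two: the block of a
  chosen point is a singleton or one of \<open>m + 1\<close> pairs.\<close>

fun involutions :: "nat \<Rightarrow> nat" where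
  "involutions 0 = 1"
| "involutions (Suc 0) = 1"
| "involutions (Suc (Suc m)) = involutions (Suc m) + Suc m * involutions m"

lemma odd_double_fact_Suc: "odd_double_fact (Suc t) = (2 * t + 1) * odd_double_fact t"
  by (simp add: odd_double_fact_def)

lemma involutions_eq_sum: "involutions n = (\<Sum>t=0..n. (n choose (2 * t)) * odd_double_fact t)"
proof -
  define h where "h m = (\<Sum>t=0..m. (m choose (2 * t)) * odd_double_fact t)" for m
  have ext: "h m = (\<Sum>t=0..M. (m choose (2 * t)) * odd_double_fact t)" if "m \<le> M" for m M
    unfolding h_def using that by (intro sum.mono_neutral_left) (auto simp: binomial_eq_0)
  have rec: "h (Suc (Suc m)) = h (Suc m) + Suc m * h m" for m
  proof -
    have step: "(Suc (Suc m) choose (2 * Suc t)) * odd_double_fact (Suc t) =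
      (Suc m choose (2 * Suc t)) * odd_double_fact (Suc t) + Suc m * ((m choose (2 * t)) * odd_double_fact t)" for t
    proof -
      have "(Suc (Suc m) choose (2 * Suc t)) = (Suc m choose (2 * Suc t)) + (Suc m choose Suc (2 * t))"
        by simp
      moreover have "(Suc m choose Suc (2 * t)) * odd_double_fact (Suc t) = Suc m * ((m choose (2 * t)) * odd_double_fact t)"
      proof -
        have "(Suc m choose Suc (2 * t)) * odd_double_fact (Suc t) =
            (Suc (2 * t) * (Suc m choose Suc (2 * t))) * odd_double_fact t"
          unfolding odd_double_fact_Suc by (simp only: Suc_eq_plus1 mult.assoc mult.left_commute)
        also have "\<dots> = Suc m * (m choose (2 * t)) * odd_double_fact t" by (simp only: Suc_times_binomial)
        finally show ?thesis by (simp only: mult.assoc)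
      qed
      ultimately show ?thesis by (simp only: distrib_right)
    qed
    have "h (Suc (Suc m)) = (\<Sum>t=0..Suc (Suc m). (Suc (Suc m) choose (2 * t)) * odd_double_fact t)"
      by (simp add: h_def)
    also have "\<dots> = odd_double_fact 0 + (\<Sum>t=0..Suc m. (Suc (Suc m) choose (2 * Suc t)) * odd_double_fact (Suc t))"
      by (subst sum.atLeast0_atMost_Suc_shift) (simp add: comp_def)
    also have "\<dots> = odd_double_fact 0 + (\<Sum>t=0..Suc m. (Suc m choose (2 * Suc t)) * odd_double_fact (Suc t))
        + Suc m * (\<Sum>t=0..Suc m. (m choose (2 * t)) * odd_double_fact t)"
      unfolding step sum.distrib sum_distrib_left by (simp only: add.assoc)
    also have "odd_double_fact 0 + (\<Sum>t=0..Suc m. (Suc m choose (2 * Suc t)) * odd_double_fact (Suc t)) =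
        (\<Sum>t=0..Suc (Suc m). (Suc m choose (2 * t)) * odd_double_fact t)"
      by (subst sum.atLeast0_atMost_Suc_shift) (simp add: comp_def)
    also have "\<dots> = h (Suc m)" by (rule ext[symmetric]) simp
    also have "(\<Sum>t=0..Suc m. (m choose (2 * t)) * odd_double_fact t) = h m" by (rule ext[symmetric]) simp
    finally show ?thesis .
  qed
  have "involutions n = h n"
  proof (induction n rule: involutions.induct)
    case 1
    show ?case by (simp add: h_def odd_double_fact_def)
  next
    case 2
    show ?case by (simp add: h_def odd_double_fact_def)
  next
    case (3 m)
    then show ?case by (simp add: rec)
  qed
  then show ?thesis by (simp add: h_def)
qed

text \<open>Both bounds on the quotient of consecutive values are proved together, as each follows
  from the other one step before.\<close>

lemma involutions_ratio:
  "sqrt (real (Suc m)) * real (involutions m) \<le> real (involutions (Suc m)) \<and>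
   real (involutions (Suc m)) \<le> (1 + sqrt (real m)) * real (involutions m)"
proof (induction m)
  case (Suc m)
  let ?I = "real (involutions m)" and ?J = "real (involutions (Suc m))"
  have rec: "real (involutions (Suc (Suc m))) = ?J + real (Suc m) * ?I"
    by (simp only: involutions.simps of_nat_add of_nat_mult)
  have "real (Suc m) * ?I = sqrt (real (Suc m)) * (sqrt (real (Suc m)) * ?I)"
    by (simp only: mult.assoc[symmetric] real_sqrt_mult_self abs_of_nat)
  also have "\<dots> \<le> sqrt (real (Suc m)) * ?J" using Suc by (intro mult_left_mono) auto
  finally have up: "real (involutions (Suc (Suc m))) \<le> (1 + sqrt (real (Suc m))) * ?J"
    unfolding rec by (simp add: algebra_simps)
  let ?q = "sqrt (real (Suc (Suc m)))"
  have q1: "?q \<ge> 1" by simp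
  have "(?q - 1) * ?J \<le> (?q - 1) * ((1 + sqrt (real m)) * ?I)"
    using Suc q1 by (intro mult_left_mono) auto
  also have "\<dots> \<le> (?q - 1) * ((1 + ?q) * ?I)"
    using q1 by (intro mult_left_mono mult_right_mono) auto
  also have "\<dots> = (?q * ?q - 1) * ?I" by (simp add: algebra_simps)
  also have "?q * ?q - 1 = real (Suc m)" by simp
  finally have "?q * ?J \<le> real (involutions (Suc (Suc m)))" unfolding rec by (simp add: algebra_simps)
  then show ?case using up by blast
qed simp

lemma power_one_plus_ge: "(1 + x) ^ m \<ge> 1 + real m * x + real m * (real m - 1) / 2 * x\<^sup>2" if "x \<ge> (0::real)"
proof (induction m)
  case (Suc m)
  have "0 \<le> real m * (real m - 1) / 2 * x ^ 3" using that by (cases m) auto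
  then have "1 + real (Suc m) * x + real (Suc m) * (real (Suc m) - 1) / 2 * x\<^sup>2 \<le>
    (1 + x) * (1 + real m * x + real m * (real m - 1) / 2 * x\<^sup>2)"
    by (simp add: field_simps power2_eq_square power3_eq_cube)
  also have "\<dots> \<le> (1 + x) * (1 + x) ^ m" using Suc that by (intro mult_left_mono) auto
  finally show ?case by simp
qed simp

text \<open>Since \<open>(1 + 1/j) ^ j \<ge> 12/5\<close> for \<open>j \<ge> 5\<close>, the factorial grows by at most the factor by
  which the right-hand side does.\<close>

lemma fact_le: "5 \<le> j \<Longrightarrow> fact j \<le> 4 * (real j * 5 / 12) ^ j"
proof (induction j rule: nat_induct_at_least)
  case base
  show ?case by (simp add: fact_numeral power_divide) 
next
  case (Suc j)
  have j: "real j > 0" using Suc by simp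
  have "12 / 5 \<le> 1 + real j * (1 / real j) + real j * (real j - 1) / 2 * (1 / real j)\<^sup>2"
    using Suc(1) by (simp add: field_simps power2_eq_square)
  also have "\<dots> \<le> (1 + 1 / real j) ^ j" by (rule power_one_plus_ge) simp
  also have "1 + 1 / real j = real (Suc j) / real j" using j by (simp add: field_simps)
  finally have "12 / 5 * real j ^ j \<le> real (Suc j) ^ j"
    using j by (simp add: power_divide field_simps)
  then have step: "real j ^ j \<le> 5 / 12 * real (Suc j) ^ j" by simp
  have "fact (Suc j) = real (Suc j) * fact j" by simp
  also have "\<dots> \<le> real (Suc j) * (4 * (real j * 5 / 12) ^ j)" using Suc by (intro mult_left_mono) auto
  also have "\<dots> = real (Suc j) * (4 * (5 / 12) ^ j) * real j ^ j" by (simp add: power_mult_distrib power_divide)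
  also have "\<dots> \<le> real (Suc j) * (4 * (5 / 12) ^ j) * (5 / 12 * real (Suc j) ^ j)"
    by (rule mult_left_mono[OF step]) simp
  also have "\<dots> = 4 * (real (Suc j) * (5 / 12)) ^ Suc j"
    by (simp only: power_mult_distrib power_Suc mult_ac)
  also have "real (Suc j) * (5 / 12) = real (Suc j) * 5 / 12" by simp
  finally show ?case .
qed

text \<open>As \<open>12/5 > 2\<close>, the base \<open>5 j / 12\<close> stays below \<open>9/10 * a\<close>, and the remaining exponential
  factor beats the constant 4. This is where the bound \<open>2 * sqrt n\<close> on \<open>j\<close> comes from.\<close>

lemma fact_le_power_half:
  assumes a: "a \<ge> (38::real)" and j: "real j \<le> 2 * a + 6"
  shows "fact j \<le> a ^ j"
proof (cases "real j \<le> a")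
  case True
  have "fact j \<le> real (j ^ j)" by (rule fact_le_power)
  also have "\<dots> \<le> a ^ j" using True by (simp add: power_mono)
  finally show ?thesis .
next
  case False
  then have j38: "39 \<le> j" using a by linarith
  have "fact j \<le> 4 * (real j * 5 / 12) ^ j" using j38 by (intro fact_le) simp
  also have "\<dots> \<le> 4 * (9 / 10 * a) ^ j"
    using j a by (intro mult_left_mono power_mono) auto
  also have "\<dots> = (4 * (9 / 10) ^ j) * a ^ j" by (simp only: power_mult_distrib mult.assoc)
  also have "\<dots> \<le> 1 * a ^ j"
  proof (rule mult_right_mono)
    have "(9 / 10 :: real) ^ j \<le> (9 / 10) ^ 39" using j38 by (intro power_decreasing) auto
    also have "\<dots> \<le> 1 / 4" by (simp add: power_divide)
    finally show "4 * (9 / 10 :: real) ^ j \<le> 1" by simp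
  qed (use a in simp)
  finally show ?thesis by simp
qed

text \<open>Let \<open>g j\<close> be the right-hand side and \<open>s = sqrt n\<close>. The ratio bound for involution numbers
  gives \<open>(j + 1) * g (j + 1) \<ge> (s - 3) * g j\<close> in the given range, hence \<open>fact j * g j \<ge> (s - 3) ^
  j * g 0\<close>, and \<open>(s - 3) ^ j \<ge> fact j\<close>. The constant 1681 is \<open>41\<^sup>2\<close>.\<close>

theorem involutions_le:
  assumes n: "1681 \<le> n" and j: "real j \<le> 2 * sqrt (real n)"
  shows "involutions n \<le> (n choose j) * involutions (n - j)"
proof -
  let ?s = "sqrt (real n)"
  have "sqrt (41\<^sup>2) \<le> ?s" using n by (intro real_sqrt_le_mono) simp
  then have s: "41 \<le> ?s" by simp
  have ss: "?s * ?s = real n" by simp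
  define g where "g i = real (n choose i) * real (involutions (n - i))" for i
  have step: "(?s - 3) * g i \<le> real (Suc i) * g (Suc i)" if i: "real i \<le> 2 * ?s" "i < n" for i
  proof -
    define m where "m = n - Suc i"
    have m: "n - i = Suc m" using i(2) by (simp add: m_def)
    have rm: "real (Suc m) = real n - real i" using m i by linarith
    have "(?s - 2)\<^sup>2 \<le> real (Suc m)" unfolding rm using i(1) s ss by (simp add: power2_eq_square algebra_simps)
    then have sq: "?s - 2 \<le> sqrt (real (Suc m))" by (rule real_le_rsqrt)
    let ?q = "sqrt (real (Suc m))"
    have "real (involutions (Suc m)) \<le> (1 + sqrt (real m)) * real (involutions m)" using involutions_ratio by blast
    also have "\<dots> \<le> (1 + ?q) * real (involutions m)" by (intro mult_right_mono) auto
    finally have I: "real (involutions (Suc m)) \<le> (1 + ?q) * real (involutions m)" .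
    have "(?s - 3) * real (involutions (Suc m)) \<le> (?q - 1) * ((1 + ?q) * real (involutions m))"
      using I sq s by (intro mult_mono) auto
    also have "\<dots> = (?q * ?q - 1) * real (involutions m)" by (simp add: algebra_simps)
    also have "\<dots> \<le> real (Suc m) * real (involutions m)" by (intro mult_right_mono) auto
    finally have le: "real (n choose i) * ((?s - 3) * real (involutions (Suc m))) \<le>
      real (n choose i) * (real (Suc m) * real (involutions m))" by (rule mult_left_mono) simp
    have "Suc i * (n choose Suc i) = (n - i) * (n choose i)"
      by (metis binomial_absorb_comp mult.commute binomial_absorption)
    then have h: "real (n choose i) * real (Suc m) = real (Suc i) * real (n choose Suc i)"
      unfolding m by (metis mult.commute of_nat_mult)
    have eq1: "real (Suc i) * g (Suc i) = real (n choose i) * (real (Suc m) * real (involutions m))"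
      unfolding g_def m_def[symmetric] mult.assoc[symmetric] h ..
    have eq2: "(?s - 3) * g i = real (n choose i) * ((?s - 3) * real (involutions (Suc m)))"
      unfolding g_def m by (simp only: mult.left_commute)
    show ?thesis unfolding eq1 eq2 by (rule le)
  qed
  have "2 * ?s < ?s * ?s" by (rule mult_strict_right_mono) (use s in linarith)+
  then have jn: "j < n" using j ss by linarith
  have pow: "(?s - 3) ^ i * g 0 \<le> fact i * g i" if "i \<le> j" for i using that
  proof (induction i)
    case (Suc i)
    have i: "real i \<le> 2 * ?s" "i < n" using Suc.prems j jn by linarith+
    have "(?s - 3) ^ Suc i * g 0 = (?s - 3) * ((?s - 3) ^ i * g 0)" by simp
    also have "\<dots> \<le> (?s - 3) * (fact i * g i)" using Suc s by (intro mult_left_mono) auto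
    also have "\<dots> = fact i * ((?s - 3) * g i)" by simp
    also have "\<dots> \<le> fact i * (real (Suc i) * g (Suc i))" by (intro mult_left_mono step[OF i]) simp
    finally show ?case by (simp add: algebra_simps)
  qed simp
  have "fact j \<le> (?s - 3) ^ j" by (rule fact_le_power_half) (use s j in auto)
  then have "fact j * g 0 \<le> (?s - 3) ^ j * g 0" by (intro mult_right_mono) (simp_all add: g_def)
  also have "\<dots> \<le> fact j * g j" by (rule pow) simp
  finally have "g 0 \<le> g j" by simp
  then have "real (involutions n) \<le> real ((n choose j) * involutions (n - j))" by (simp add: g_def)
  then show ?thesis by (simp only: of_nat_le_iff)
qed

text \<open>Counting maps from an \<open>n\<close>-set to a \<open>t\<close>-set by their kernels.\<close>

lemma power_eq_sum_Stirling: "t ^ n = (\<Sum>i\<le>n. Stirling n i * (fact i * (t choose i)))"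
proof (induction n)
  case (Suc n)
  have absorb: "t * (fact i * (t choose i)) = i * (fact i * (t choose i)) + fact (Suc i) * (t choose Suc i)" for i
  proof (cases "i \<le> t")
    case True
    have h: "Suc i * (t choose Suc i) = (t - i) * (t choose i)"
      by (metis binomial_absorb_comp mult.commute binomial_absorption)
    have "fact (Suc i) * (t choose Suc i) = fact i * (Suc i * (t choose Suc i))"
      by (simp add: algebra_simps)
    also have "\<dots> = (t - i) * (fact i * (t choose i))" unfolding h by (rule mult.left_commute)
    finally have "i * (fact i * (t choose i)) + fact (Suc i) * (t choose Suc i) = (i + (t - i)) * (fact i * (t choose i))"
      by (simp only: distrib_right)
    then show ?thesis using True by simp
  qed (simp add: binomial_eq_0)
  let ?f = "\<lambda>i. fact i * (t choose i)"
  have "t ^ Suc n = (\<Sum>i\<le>n. Stirling n i * (t * ?f i))" unfolding power_Suc Suc sum_distrib_left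
    by (intro sum.cong) (simp_all add: algebra_simps)
  also have "\<dots> = (\<Sum>i\<le>n. i * Stirling n i * ?f i) + (\<Sum>i\<le>n. Stirling n i * ?f (Suc i))"
    unfolding absorb by (simp add: sum.distrib algebra_simps)
  also have "(\<Sum>i\<le>n. i * Stirling n i * ?f i) = (\<Sum>i\<le>Suc n. i * Stirling n i * ?f i)" by simp
  also have "\<dots> = (\<Sum>i\<le>n. Suc i * Stirling n (Suc i) * ?f (Suc i))"
    by (subst sum.atMost_Suc_shift) simp
  finally have "t ^ Suc n = (\<Sum>i\<le>n. Stirling (Suc n) (Suc i) * ?f (Suc i))"
    by (simp only: sum.distrib[symmetric] distrib_right[symmetric] Stirling.simps)
  also have "\<dots> = (\<Sum>i\<le>Suc n. Stirling (Suc n) i * ?f i)"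
    by (subst sum.atMost_Suc_shift) simp
  finally show ?case .
qed simp

lemma fact_Stirling_le: "fact t * Stirling n t \<le> t ^ n"
proof (cases "t \<le> n")
  case True
  have "Stirling n t * (fact t * (t choose t)) \<le> (\<Sum>i\<le>n. Stirling n i * (fact i * (t choose i)))"
    by (rule member_le_sum) (use True in auto)
  then show ?thesis by (simp add: power_eq_sum_Stirling mult.commute)
qed simp

text \<open>Maps to a set of size \<open>t + 1\<close> are surjective or miss one of the \<open>t + 1\<close> points.\<close>

lemma power_le_fact_Stirling: "Suc t ^ n \<le> fact (Suc t) * Stirling n (Suc t) + Suc t * t ^ n"
proof -
  have "Stirling n i * (fact i * (Suc t choose i)) \<le>
    (if i = Suc t then fact (Suc t) * Stirling n (Suc t) else 0) + Suc t * (Stirling n i * (fact i * (t choose i)))" for i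
  proof -
    consider "i \<le> t" | "i = Suc t" | "Suc t < i" by linarith
    then show ?thesis
    proof cases
      case 1
      have "(Suc t choose i) \<le> (Suc t - i) * (Suc t choose i)" using 1 by simp
      also have "\<dots> = Suc t * (t choose i)" using binomial_absorb_comp[of "Suc t" i] by simp
      finally have "Stirling n i * (fact i * (Suc t choose i)) \<le> Stirling n i * (fact i * (Suc t * (t choose i)))"
        by (intro mult_left_mono) auto
      then show ?thesis using 1 by (simp only: mult.left_commute)
    qed (simp_all add: binomial_eq_0 mult.commute)
  qed
  then have "(\<Sum>i\<le>n. Stirling n i * (fact i * (Suc t choose i))) \<le>
    (\<Sum>i\<le>n. (if i = Suc t then fact (Suc t) * Stirling n (Suc t) else 0) + Suc t * (Stirling n i * (fact i * (t choose i))))"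
    by (rule sum_mono)
  also have "\<dots> = (\<Sum>i\<le>n. if i = Suc t then fact (Suc t) * Stirling n (Suc t) else 0) + Suc t * t ^ n"
    by (simp only: sum.distrib power_eq_sum_Stirling[of t n] sum_distrib_left)
  also have "(\<Sum>i\<le>n. if i = Suc t then fact (Suc t) * Stirling n (Suc t) else 0) \<le> fact (Suc t) * Stirling n (Suc t)"
    by (simp add: sum.delta)
  finally show ?thesis using power_eq_sum_Stirling[of "Suc t" n] by simp
qed

lemma linear_le_power_2: "6 \<le> q \<Longrightarrow> 2 * (4 * q + 5) \<le> (2::nat) ^ q"
  by (induction q rule: nat_induct_at_least) auto

text \<open>For small \<open>t\<close> most maps to a set of size \<open>t + 1\<close> are surjective: with \<open>q = n div t\<close> one
  has \<open>(t + 1) ^ n \<ge> 2 ^ q * t ^ n\<close>, while \<open>t\<^sup>2 \<le> 4 n\<close> forces \<open>t < 4 (q + 1)\<close>.\<close>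

lemma Stirling_increasing:
  assumes n: "144 \<le> n" and t: "t * t \<le> 4 * n"
  shows "Stirling n t \<le> Stirling n (Suc t)"
proof (cases "t = 0")
  case True
  then show ?thesis using n by (cases n) auto
next
  case False
  define q where "q = n div t"
  have qt: "q * t \<le> n" "n < Suc q * t"
    using dividend_less_times_div[of t n] False by (simp_all add: q_def mult.commute)
  have "t * t < 4 * Suc q * t" using t qt(2) by linarith
  then have tq: "t < 4 * Suc q" by simp
  (* If q were at most 5, then t < 24, so n < 6 t < 144. *)
  have q6: "6 \<le> q"
  proof (rule ccontr)
    assume "\<not> 6 \<le> q"
    then have "Suc q \<le> 6" by simp
    then have "Suc q * t \<le> 6 * t" by (rule mult_le_mono1)
    moreover have "4 * Suc q \<le> 4 * 6" using \<open>Suc q \<le> 6\<close> by (rule mult_le_mono2)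
    then have "t < 24" using tq by linarith
    ultimately show False using qt(2) n by linarith
  qed
  have "2 * t ^ t \<le> Suc t ^ t"
  proof -
    have "-1 \<le> 1 / real t" by (rule order_trans[of _ 0]) simp_all
    then have "2 \<le> (1 + 1 / real t) ^ t" using Bernoulli_inequality[of "1 / real t" t] False by simp
    then have "real t ^ t * 2 \<le> real t ^ t * (1 + 1 / real t) ^ t" by (rule mult_left_mono) simp
    also have "\<dots> = real (Suc t) ^ t" using False by (simp add: power_mult_distrib[symmetric] field_simps)
    finally have "real (2 * t ^ t) \<le> real (Suc t ^ t)" by simp
    then show ?thesis by (simp only: of_nat_le_iff)
  qed
  then have "(2 * t ^ t) ^ q \<le> (Suc t ^ t) ^ q" by (rule power_mono) simp
  then have "2 ^ q * t ^ (q * t) \<le> Suc t ^ (q * t)"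
    by (simp only: power_mult_distrib power_mult[symmetric] mult.commute)
  then have "(2 ^ q * t ^ (q * t)) * t ^ (n - q * t) \<le> Suc t ^ (q * t) * Suc t ^ (n - q * t)"
    by (intro mult_mono power_mono) auto
  then have "2 ^ q * t ^ n \<le> Suc t ^ n"
    using qt(1) by (simp only: mult.assoc power_add[symmetric] le_add_diff_inverse)
  moreover have "2 * Suc t \<le> 2 * (4 * q + 5)" using tq by simp
  then have "2 * Suc t \<le> 2 ^ q" using linear_le_power_2[OF q6] by (rule le_trans)
  then have "2 * Suc t * t ^ n \<le> 2 ^ q * t ^ n" by (rule mult_le_mono1)
  ultimately have "2 * Suc t * t ^ n \<le> fact (Suc t) * Stirling n (Suc t) + Suc t * t ^ n"
    using power_le_fact_Stirling[of t n] by linarith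
  then have A: "Suc t * t ^ n \<le> fact (Suc t) * Stirling n (Suc t)" by linarith
  have B: "Suc t * (fact t * Stirling n t) \<le> Suc t * t ^ n" by (rule mult_le_mono2[OF fact_Stirling_le])
  have "fact (Suc t) * Stirling n t = Suc t * (fact t * Stirling n t)"
    by (simp only: fact_Suc of_nat_id mult.assoc)
  also have "\<dots> \<le> fact (Suc t) * Stirling n (Suc t)" by (rule le_trans[OF B A])
  finally show ?thesis by (simp only: mult_le_cancel1) (simp add: fact_gt_zero)
qed

text \<open>The terms with \<open>t < j\<close>, which vanish on the right, are each at most \<open>Stirling n (j + 1)\<close>,
  and the term for \<open>t = j + 1\<close> carries the factor \<open>j + 1\<close>.\<close>

theorem Stirling_sum_le:
  assumes n: "144 \<le> n" and j: "j * j \<le> 4 * n" "j < n"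
  shows "(\<Sum>t=0..n. Stirling n t) \<le> (\<Sum>t=0..n. Stirling n t * (t choose j))"
proof -
  have mono: "Stirling n t \<le> Stirling n (Suc j)" if "t \<le> Suc j" for t
    using that
  proof (induction t rule: inc_induct)
    case (step t)
    then have "t * t \<le> j * j" by (intro mult_le_mono) auto
    then have "Stirling n t \<le> Stirling n (Suc t)" using j(1) by (intro Stirling_increasing[OF n]) linarith
    then show ?case using step by linarith
  qed simp
  have "(\<Sum>t=0..n. Stirling n t) = (\<Sum>t=0..<j. Stirling n t) + (\<Sum>t=j..<Suc n. Stirling n t)"
    using sum.atLeastLessThan_concat[of 0 j "Suc n" "Stirling n"] j(2) by (simp add: atLeastLessThanSuc_atLeastAtMost)
  also have "(\<Sum>t=0..<j. Stirling n t) \<le> (\<Sum>t=0..<j. Stirling n (Suc j))"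
    using mono by (intro sum_mono) auto
  also have "\<dots> = (\<Sum>t=j..<Suc n. if t = Suc j then j * Stirling n (Suc j) else 0)"
    using j(2) by (simp add: sum.delta)
  finally have "(\<Sum>t=0..n. Stirling n t) \<le>
      (\<Sum>t=j..<Suc n. (if t = Suc j then j * Stirling n (Suc j) else 0) + Stirling n t)"
    by (simp add: sum.distrib)
  also have "\<dots> \<le> (\<Sum>t=j..<Suc n. Stirling n t * (t choose j))"
  proof (rule sum_mono)
    fix t assume t: "t \<in> {j..<Suc n}"
    show "(if t = Suc j then j * Stirling n (Suc j) else 0) + Stirling n t \<le> Stirling n t * (t choose j)"
    proof (cases "t = Suc j")
      case True
      then show ?thesis by (simp add: binomial_Suc_n)
    next
      case False
      have "1 \<le> (t choose j)" using t by (simp add: Suc_le_eq)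
      then show ?thesis using False by simp
    qed
  qed
  also have "\<dots> \<le> (\<Sum>t=0..<Suc n. Stirling n t * (t choose j))" by (intro sum_mono2) auto
  finally show ?thesis by (simp only: atLeastLessThanSuc_atLeastAtMost)
qed

section \<open>Counting half diagrams\<close>

lemma partition_eq_if_saturated:
  assumes P: "partition_on A P" and P': "partition_on A P'"
    and sat: "\<And>B. B \<in> P \<Longrightarrow> \<forall>C\<in>P'. C \<subseteq> B \<or> C \<inter> B = {}" "\<And>B. B \<in> P' \<Longrightarrow> \<forall>C\<in>P. C \<subseteq> B \<or> C \<inter> B = {}"
  shows "P = P'"
proof -
  have "Q \<subseteq> Q'" if Q: "partition_on A Q" and Q': "partition_on A Q'"
    and s: "\<And>B. B \<in> Q \<Longrightarrow> \<forall>C\<in>Q'. C \<subseteq> B \<or> C \<inter> B = {}" "\<And>B. B \<in> Q' \<Longrightarrow> \<forall>C\<in>Q. C \<subseteq> B \<or> C \<inter> B = {}" for Q Q'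
  proof
    fix B assume B: "B \<in> Q"
    then have "B \<noteq> {}" using partition_onD3[OF Q] by blast
    then obtain x where x: "x \<in> B" by blast
    then have "x \<in> A" using B partition_onD1[OF Q] by auto
    then obtain C where C: "C \<in> Q'" "x \<in> C" using partition_onD1[OF Q'] by auto
    have "C \<subseteq> B" using s(1)[OF B] C x by blast
    moreover have "B \<subseteq> C" using s(2)[OF C(1)] B x C by blast
    ultimately show "B \<in> Q'" using C by auto
  qed
  from this[OF P P' sat] this[OF P' P sat(2) sat(1)] show ?thesis by blast
qed

context factorizable_monoid
begin

text \<open>The right cell of a half diagram determines it up to the numbering of its marked blocks.
  Multiplication on the right can only shrink the set of top colourings that extend to some
  bottom colouring, and only enlarge the set of those that extend to the bottom colouring which
  is constantly false; so both sets depend on the right cell only. The first one determines the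
  partition of the top points, and the second one tells which blocks are marked.\<close>

theorem card_le_num_r_cells_eps:
  assumes k: "k < n" and j: "j \<le> k"
    and part: "\<And>N M. (N, M) \<in> F \<Longrightarrow> partition_on {1..n} (N \<union> M) \<and> N \<inter> M = {} \<and> card M = j \<and> finite M"
    and mem: "\<And>N M b. (N, M) \<in> F \<Longrightarrow> bij_betw b {1..j} M \<Longrightarrow>
      half n j b N \<in> carrier X \<and> flip (half n j b N) \<in> carrier X"
  shows "card F \<le> num_r_cells (trunc X k) (eps n j)"
proof -
  interpret T: fin_monoid "trunc X k" by (rule fin_monoid_trunc)
  have kn: "k \<le> n" "j \<le> n" using j k by auto
  have "\<exists>b. bij_betw b {1..j} M" if "(N, M) \<in> F" for N M
    using part[OF that] ex_bij_betw_nat_finite_1 by blast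
  then obtain b where b: "\<And>N M. (N, M) \<in> F \<Longrightarrow> bij_betw (b N M) {1..j} M" by metis
  define p where "p NM = half n j (b (fst NM) (snd NM)) (fst NM)" for NM
  have hd: "half_data n j (b N M) N" and bM: "b N M ` {1..j} = M" if "(N, M) \<in> F" for N M
    using part[OF that] b[OF that] kn unfolding half_data_def bij_betw_def by auto
  have p_cell: "p NM \<in> l_cell (trunc X k) (eps n j)" if NM: "NM \<in> F" for NM
  proof -
    obtain N M where [simp]: "NM = (N, M)" by (cases NM)
    have F: "(N, M) \<in> F" using NM by simp
    let ?p = "half n j (b N M) N"
    note h = hd[OF F] and m = mem[OF F b[OF F]]
    have e: "stack n (eps n j) (flip ?p) = flip ?p"
      using stack_flip[OF half_partition[OF h] eps_partition[OF kn(2)]] flip_eps[OF kn(2)] half_eps[OF h] by simp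
    have t: "?p \<in> carrier (trunc X k)" "flip ?p \<in> carrier (trunc X k)"
      using in_trunc_if_eps_right[OF _ half_eps[OF h] j kn(1)] in_trunc_if_eps_left[OF _ e j kn(1)] m by auto
    have "?p \<in> l_cell (trunc X k) (eps n j)"
      by (rule l_cellI[OF t(1) t(1) t(2)]) (simp_all add: mult_trunc half_eps[OF h] flip_half_half[OF h])
    then show ?thesis by (simp add: p_def)
  qed
  have dom: "(\<exists>u. compat (p (N, M)) v u) \<longleftrightarrow> (\<forall>B\<in>N \<union> M. \<forall>x\<in>B. \<forall>y\<in>B. v x = v y)" if F: "(N, M) \<in> F" for N M v
  proof -
    have "(\<exists>u. compat (p (N, M)) v u) \<longleftrightarrow>
      (\<forall>B\<in>N. \<forall>x\<in>B. \<forall>y\<in>B. v x = v y) \<and> (\<exists>u. \<forall>i\<in>{1..j}. \<forall>x\<in>b N M i. v x = u i)"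
      by (simp add: p_def compat_half)
    also have "(\<exists>u. \<forall>i\<in>{1..j}. \<forall>x\<in>b N M i. v x = u i) \<longleftrightarrow> (\<forall>i\<in>{1..j}. \<forall>x\<in>b N M i. \<forall>y\<in>b N M i. v x = v y)"
      (is "?L \<longleftrightarrow> ?R")
    proof
      assume ?R
      have "\<exists>c. \<forall>x\<in>b N M i. v x = c" if i: "i \<in> {1..j}" for i
      proof -
        obtain y where "y \<in> b N M i" using half_dataD(2)[OF hd[OF F] i] by blast
        then show ?thesis using \<open>?R\<close> i by blast
      qed
      then show ?L by metis
    next
      assume ?L
      then obtain u where u: "\<forall>i\<in>{1..j}. \<forall>x\<in>b N M i. v x = u i" by blast
      show ?R
      proof (intro ballI)
        fix i x y assume "i \<in> {1..j}" "x \<in> b N M i" "y \<in> b N M i"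
        then have "v x = u i" "v y = u i" using u by blast+
        then show "v x = v y" by simp
      qed
    qed
    also have "(\<forall>i\<in>{1..j}. \<forall>x\<in>b N M i. \<forall>y\<in>b N M i. v x = v y) \<longleftrightarrow> (\<forall>B\<in>M. \<forall>x\<in>B. \<forall>y\<in>B. v x = v y)"
      by (subst (3) bM[OF F, symmetric]) blast
    finally show ?thesis by blast
  qed
  have zer: "compat (p (N, M)) v (\<lambda>_. False) \<longleftrightarrow> (\<forall>B\<in>N. \<forall>x\<in>B. \<forall>y\<in>B. v x = v y) \<and> (\<forall>B\<in>M. \<forall>x\<in>B. \<not> v x)"
    if F: "(N, M) \<in> F" for N M v
  proof -
    have "(\<forall>i\<in>{1..j}. \<forall>x\<in>b N M i. \<not> v x) \<longleftrightarrow> (\<forall>B\<in>M. \<forall>x\<in>B. \<not> v x)"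
      by (subst (2) bM[OF F, symmetric]) blast
    then show ?thesis by (simp add: p_def compat_half)
  qed
  have inv: "(\<exists>u. compat p2 v u) \<longrightarrow> (\<exists>u. compat p1 v u)" "compat p1 v (\<lambda>_. False) \<longrightarrow> compat p2 v (\<lambda>_. False)"
    if p1: "p1 \<in> carrier (trunc X k)" and le: "le_r (trunc X k) p1 p2" for p1 p2 v
  proof -
    obtain s where s: "s \<in> carrier (trunc X k)" "p2 = stack n p1 s" using le by (auto simp: le_r_def mult_trunc)
    have C: "compat p2 v u \<longleftrightarrow> (\<exists>w. compat p1 v w \<and> compat s w u)" for u
      unfolding s(2) by (rule compat_stack[OF trunc_partition[OF p1] trunc_partition[OF s(1)]])
    show "(\<exists>u. compat p2 v u) \<longrightarrow> (\<exists>u. compat p1 v u)" using C by blast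
    have "colour (\<lambda>_. False) (\<lambda>_. False) x = False" for x by (cases x) auto
    then have "compat s (\<lambda>_. False) (\<lambda>_. False)" unfolding compat_def by simp
    then show "compat p1 v (\<lambda>_. False) \<longrightarrow> compat p2 v (\<lambda>_. False)" using C by blast
  qed
  have inj: "inj_on (\<lambda>NM. r_cell (trunc X k) (p NM)) F"
  proof (rule inj_onI, clarify)
    fix N M N' M' assume F: "(N, M) \<in> F" and F': "(N', M') \<in> F"
      and eq: "r_cell (trunc X k) (p (N, M)) = r_cell (trunc X k) (p (N', M'))"
    have c: "p (N, M) \<in> carrier (trunc X k)" "p (N', M') \<in> carrier (trunc X k)"
      using p_cell[OF F] p_cell[OF F'] by (auto simp: l_cell_def)
    have le: "le_r (trunc X k) (p (N, M)) (p (N', M'))" "le_r (trunc X k) (p (N', M')) (p (N, M))"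
      using eq T.r_cell_eq_iff[OF c] by auto
    have D: "(\<forall>B\<in>N \<union> M. \<forall>x\<in>B. \<forall>y\<in>B. v x = v y) = (\<forall>B\<in>N' \<union> M'. \<forall>x\<in>B. \<forall>y\<in>B. v x = v y)"
      for v :: "nat \<Rightarrow> bool" 
    proof (rule iffI)
      show "\<forall>B\<in>N' \<union> M'. \<forall>x\<in>B. \<forall>y\<in>B. v x = v y" if "\<forall>B\<in>N \<union> M. \<forall>x\<in>B. \<forall>y\<in>B. v x = v y"
        using inv(1)[OF c(2) le(2), of v, unfolded dom[OF F] dom[OF F']] that by (rule mp)
      show "\<forall>B\<in>N \<union> M. \<forall>x\<in>B. \<forall>y\<in>B. v x = v y" if "\<forall>B\<in>N' \<union> M'. \<forall>x\<in>B. \<forall>y\<in>B. v x = v y"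
        using inv(1)[OF c(1) le(1), of v, unfolded dom[OF F] dom[OF F']] that by (rule mp)
    qed
    have Z: "((\<forall>B\<in>N. \<forall>x\<in>B. \<forall>y\<in>B. v x = v y) \<and> (\<forall>B\<in>M. \<forall>x\<in>B. \<not> v x)) =
        ((\<forall>B\<in>N'. \<forall>x\<in>B. \<forall>y\<in>B. v x = v y) \<and> (\<forall>B\<in>M'. \<forall>x\<in>B. \<not> v x))" for v
      by (rule iffI)
        (erule mp[OF inv(2)[OF c(1) le(1), of v, unfolded zer[OF F] zer[OF F']]],
         erule mp[OF inv(2)[OF c(2) le(2), of v, unfolded zer[OF F] zer[OF F']]])
    have P: "partition_on {1..n} (N \<union> M)" "partition_on {1..n} (N' \<union> M')" using part F F' by auto
    have sat: "\<forall>C\<in>Q'. C \<subseteq> B \<or> C \<inter> B = {}"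
      if Q: "partition_on {1..n} Q" "B \<in> Q"
        and eqQ: "\<And>v. (\<forall>B\<in>Q. \<forall>x\<in>B. \<forall>y\<in>B. v x = v y) = (\<forall>B\<in>Q'. \<forall>x\<in>B. \<forall>y\<in>B. v x = (v y :: bool))" for Q Q' B
    proof -
      have "\<forall>C\<in>Q. \<forall>x\<in>C. \<forall>y\<in>C. (x \<in> B) = (y \<in> B)"
        using disjointD[OF partition_onD2[OF Q(1)] Q(2)] by blast
      then have "\<forall>C\<in>Q'. \<forall>x\<in>C. \<forall>y\<in>C. (x \<in> B) = (y \<in> B)" by (simp only: eqQ)
      then show ?thesis by blast
    qed
    have PP: "N \<union> M = N' \<union> M'"
      by (rule partition_eq_if_saturated[OF P])
        (rule sat[OF P(1)], assumption, rule D, rule sat[OF P(2)], assumption, rule D[symmetric])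
    have sub: "M \<subseteq> M'" if P: "partition_on {1..n} (N \<union> M)" and PP: "N \<union> M = N' \<union> M'"
      and Z: "\<And>v. ((\<forall>B\<in>N'. \<forall>x\<in>B. \<forall>y\<in>B. v x = v y) \<and> (\<forall>B\<in>M'. \<forall>x\<in>B. \<not> v x)) \<Longrightarrow> (\<forall>B\<in>M. \<forall>x\<in>B. \<not> v x)"
      and disj: "N' \<inter> M' = {}" for N M N' M' :: "nat set set"
    proof
      fix B assume B: "B \<in> M"
      show "B \<in> M'"
      proof (rule ccontr)
        assume nB: "B \<notin> M'"
        have d: "C = B \<or> C \<inter> B = {}" if "C \<in> N' \<union> M'" for C
          using disjointD[OF partition_onD2[OF P]] that B PP by blast
        have "(\<forall>C\<in>N'. \<forall>x\<in>C. \<forall>y\<in>C. (x \<in> B) = (y \<in> B))" using d by blast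
        moreover have "(\<forall>C\<in>M'. \<forall>x\<in>C. \<not> x \<in> B)" using d nB by blast
        ultimately have "\<forall>C\<in>M. \<forall>x\<in>C. \<not> x \<in> B" using Z[of "\<lambda>x. x \<in> B"] by blast
        then have "B = {}" using B by blast
        then show False using B partition_onD3[OF P] by blast
      qed
    qed
    have dj: "N \<inter> M = {}" "N' \<inter> M' = {}" using part F F' by auto
    have "M \<subseteq> M'" by (rule sub[OF P(1) PP _ dj(2)]) (drule iffD2[OF Z], erule conjunct2)
    moreover have "M' \<subseteq> M" by (rule sub[OF P(2) PP[symmetric] _ dj(1)]) (drule iffD1[OF Z], erule conjunct2)
    ultimately have "M = M'" by blast
    then show "N = N' \<and> M = M'" using PP dj by blast
  qed
  have "(\<lambda>NM. r_cell (trunc X k) (p NM)) ` F \<subseteq> r_cell (trunc X k) ` l_cell (trunc X k) (eps n j)"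
    using p_cell by auto
  then show ?thesis unfolding num_r_cells_def using inj by (intro card_inj_on_le) auto
qed

end

definition pairings :: "'a set \<Rightarrow> 'a set set set" where
  "pairings A = {P. partition_on A P \<and> (\<forall>B\<in>P. card B \<le> 2)}"

lemma finite_pairings: "finite A \<Longrightarrow> finite (pairings A)"
  unfolding pairings_def using finitely_many_partition_on by (rule finite_subset[rotated]) auto

lemma partition_on_add_block:
  assumes "partition_on A P" "B \<inter> A = {}" "B \<noteq> {}"
  shows "partition_on (B \<union> A) (insert B P)" "B \<notin> P"
proof -
  have "\<forall>C\<in>P. C \<subseteq> A" using assms(1) by (auto dest: partition_onD1)
  then show "B \<notin> P" using assms by blast
  show "partition_on (B \<union> A) (insert B P)"
    using assms \<open>\<forall>C\<in>P. C \<subseteq> A\<close> partition_onD2[OF assms(1)] partition_onD1[OF assms(1)] partition_onD3[OF assms(1)]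
    unfolding partition_on_def by (auto simp: pairwise_insert disjnt_def) 
qed

text \<open>Removing the block of a fixed point \<open>a\<close> gives the recursion; the sets \<open>F\<close> and \<open>G b\<close>
  collect the partitions in which this block is \<open>{a}\<close> and \<open>{a, b}\<close>.\<close>

lemma involutions_le_card_pairings: "finite A \<Longrightarrow> involutions (card A) \<le> card (pairings A)"
proof (induction "card A" arbitrary: A rule: involutions.induct)
  case 1
  then have "A = {}" by simp
  then have "pairings A = {{}}" by (auto simp: pairings_def partition_on_empty)
  then show ?case using \<open>A = {}\<close> by simp
next
  case 2
  then obtain a where a: "A = {a}" by (metis One_nat_def card_1_singletonE)
  have "{{a}} \<in> pairings A" using a partition_on_space[of A] by (simp add: pairings_def)
  then have "card (pairings A) > 0" using finite_pairings[OF 2(2)] card_gt_0_iff by blast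
  then show ?case using a by simp
next
  case (3 m)
  obtain a where a: "a \<in> A" using 3(3) by fastforce
  let ?A = "A - {a}"
  have fin: "finite ?A" and cA: "card ?A = Suc m" using 3(3,4) a by auto
  have ins: "insert a ?A = A" using a by auto
  define F where "F = (\<lambda>P. insert {a} P) ` pairings ?A"
  define G where "G b = (\<lambda>P. insert {a, b} P) ` pairings (?A - {b})" for b
  have cF: "card F = card (pairings ?A)" unfolding F_def
  proof (rule card_image, rule inj_onI)
    fix P Q assume PQ: "P \<in> pairings ?A" "Q \<in> pairings ?A" "insert {a} P = insert {a} Q"
    have "{a} \<notin> P" "{a} \<notin> Q" using PQ partition_on_add_block(2)[of ?A _ "{a}"] by (auto simp: pairings_def)
    then show "P = Q" using PQ(3) by (metis insert_ident)
  qed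
  have nG: "{a, b} \<notin> P" if "P \<in> pairings (?A - {b})" for P b
    using that partition_on_add_block(2)[of "?A - {b}" P "{a, b}"] by (auto simp: pairings_def)
  have cG: "card (G b) = card (pairings (?A - {b}))" for b unfolding G_def
  proof (rule card_image, rule inj_onI)
    fix P Q assume PQ: "P \<in> pairings (?A - {b})" "Q \<in> pairings (?A - {b})" "insert {a, b} P = insert {a, b} Q"
    then show "P = Q" using nG[OF PQ(1)] nG[OF PQ(2)] by (metis insert_ident)
  qed
  have ablock: "C = B" if "P \<in> pairings A" "B \<in> P" "C \<in> P" "a \<in> B" "a \<in> C" for P B C
    using that disjointD[OF partition_onD2[of A P] that(2,3)] by (auto simp: pairings_def)
  have F_sub: "F \<subseteq> pairings A"
    using partition_on_add_block(1)[of ?A _ "{a}"] ins by (auto simp: F_def pairings_def)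
  have G_sub: "G b \<subseteq> pairings A" if "b \<in> ?A" for b
  proof
    fix Q assume "Q \<in> G b"
    then obtain P where P: "P \<in> pairings (?A - {b})" "Q = insert {a, b} P" by (auto simp: G_def)
    have "{a, b} \<union> (?A - {b}) = A" using a that by auto
    then show "Q \<in> pairings A"
      using P partition_on_add_block(1)[of "?A - {b}" P "{a, b}"] by (auto simp: pairings_def card_insert_if)
  qed
  have G_mem: "{a, b} \<in> Q" if "Q \<in> G b" for Q b using that by (auto simp: G_def)
  have FG: "F \<inter> G b = {}" if "b \<in> ?A" for b
  proof (rule ccontr)
    assume "F \<inter> G b \<noteq> {}"
    then obtain Q where "Q \<in> F" "Q \<in> G b" by blast
    note Q = this
    have "{a} \<in> Q" using Q(1) by (auto simp: F_def)
    moreover have "{a, b} \<in> Q" by (rule G_mem[OF Q(2)])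
    moreover have "Q \<in> pairings A" using F_sub Q(1) by (rule subsetD)
    ultimately have "{a} = {a, b}" using ablock[of Q "{a, b}" "{a}"] by simp
    then show False using that by auto
  qed
  have GG: "G b \<inter> G c = {}" if "b \<in> ?A" "c \<in> ?A" "b \<noteq> c" for b c
  proof (rule ccontr)
    assume "G b \<inter> G c \<noteq> {}"
    then obtain Q where "Q \<in> G b" "Q \<in> G c" by blast
    note Q = this
    have "{a, b} \<in> Q" by (rule G_mem[OF Q(1)])
    moreover have "{a, c} \<in> Q" by (rule G_mem[OF Q(2)])
    moreover have "Q \<in> pairings A" using G_sub[OF that(1)] Q(1) by (rule subsetD)
    ultimately have "{a, c} = {a, b}" using ablock[of Q "{a, b}" "{a, c}"] by simp
    then show False using that by (auto simp: doubleton_eq_iff)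
  qed
  have finG: "finite (G b)" for b unfolding G_def by (intro finite_imageI finite_pairings finite_Diff fin)
  have "involutions (Suc (Suc m)) \<le> card F + (\<Sum>b\<in>?A. card (G b))"
  proof -
    have "involutions (Suc m) \<le> card F" using 3(1)[of ?A] cA fin cF by simp
    moreover have "involutions m \<le> card (G b)" if "b \<in> ?A" for b
      using 3(2)[of "?A - {b}"] that cA fin cG by simp
    then have "(\<Sum>b\<in>?A. involutions m) \<le> (\<Sum>b\<in>?A. card (G b))" by (rule sum_mono)
    then have "Suc m * involutions m \<le> (\<Sum>b\<in>?A. card (G b))" using cA by simp
    ultimately show ?thesis by simp
  qed
  also have "(\<Sum>b\<in>?A. card (G b)) = card (\<Union>b\<in>?A. G b)"
    using GG finG fin by (subst card_UN_disjoint) auto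
  also have "card F + card (\<Union>b\<in>?A. G b) = card (F \<union> (\<Union>b\<in>?A. G b))"
    using FG finG fin finite_pairings[OF fin] by (subst card_Un_disjoint) (auto simp: F_def)
  also have "\<dots> \<le> card (pairings A)"
    using F_sub G_sub finite_pairings[OF 3(4)] by (intro card_mono) auto
  finally show ?case using 3(3) by simp
qed

definition partitions_into :: "'a set \<Rightarrow> nat \<Rightarrow> 'a set set set" where
  "partitions_into A t = {P. partition_on A P \<and> card P = t}"

lemma finite_partitions_into: "finite A \<Longrightarrow> finite (partitions_into A t)"
  unfolding partitions_into_def using finitely_many_partition_on by (rule finite_subset[rotated]) auto

text \<open>A new point forms a block of its own (\<open>F\<close>) or joins one of the \<open>t\<close> blocks of a partition
  of the remaining points (\<open>G\<close>).\<close>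

lemma Stirling_le_card_partitions: "finite A \<Longrightarrow> Stirling (card A) t \<le> card (partitions_into A t)"
proof (induction A arbitrary: t rule: finite_induct)
  case empty
  have "partitions_into {} 0 = ({{}} :: 'a set set set)" by (auto simp: partitions_into_def partition_on_empty)
  then show ?case by (cases t) auto
next
  case (insert a A t)
  show ?case
  proof (cases t)
    case (Suc s)
    define F where "F = (\<lambda>P. insert {a} P) ` partitions_into A s"
    define G where "G = (\<lambda>(P, B). insert (insert a B) (P - {B})) ` (SIGMA P:partitions_into A t. P)"
    have sub: "C \<subseteq> A" if "P \<in> partitions_into A r" "C \<in> P" for P C r
      using that by (auto simp: partitions_into_def dest: partition_onD1)
    have finP: "finite P" if "P \<in> partitions_into A r" for P r
      using that insert(1) finite_elements by (auto simp: partitions_into_def)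
    have cF: "card F = card (partitions_into A s)" unfolding F_def
    proof (rule card_image, rule inj_onI)
      fix P Q assume PQ: "P \<in> partitions_into A s" "Q \<in> partitions_into A s" "insert {a} P = insert {a} Q"
      have "{a} \<notin> P" "{a} \<notin> Q" using PQ sub insert(2) by blast+
      then show "P = Q" using PQ(3) by (metis insert_ident)
    qed
    have recover: "B = C - {a} \<and> P = insert B (Q - {C})"
      if P: "P \<in> partitions_into A t" "B \<in> P" and Q: "Q = insert (insert a B) (P - {B})" and C: "C \<in> Q" "a \<in> C" for P B Q C
    proof -
      have aP: "a \<notin> D" if "D \<in> P" for D using sub[OF P(1) that] insert(2) by blast
      then have Ceq: "C = insert a B" using Q C by blast
      have "insert a B \<notin> P" using aP by blast
      then show ?thesis using Ceq Q P aP by blast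
    qed
    have cG: "card G = card (SIGMA P:partitions_into A t. P)" unfolding G_def
    proof (rule card_image, rule inj_onI, clarify)
      fix P B P' B' assume P: "P \<in> partitions_into A t" "B \<in> P" and P': "P' \<in> partitions_into A t" "B' \<in> P'"
        and eq: "insert (insert a B) (P - {B}) = insert (insert a B') (P' - {B'})"
      let ?Q = "insert (insert a B) (P - {B})"
      have "insert a B \<in> ?Q" "a \<in> insert a B" by auto
      from recover[OF P refl this] recover[OF P' eq this]
      show "P = P' \<and> B = B'" by metis
    qed
    have F_sub: "F \<subseteq> partitions_into (insert a A) t"
    proof
      fix Q assume "Q \<in> F"
      then obtain P where P: "P \<in> partitions_into A s" "Q = insert {a} P" by (auto simp: F_def)
      have "partition_on A P" "card P = s" using P(1) by (auto simp: partitions_into_def)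
      then show "Q \<in> partitions_into (insert a A) t"
        using partition_on_add_block[of A P "{a}"] insert(2) finP[OF P(1)] P(2) Suc
        by (simp add: partitions_into_def)
    qed
    have G_sub: "G \<subseteq> partitions_into (insert a A) t"
    proof
      fix Q assume "Q \<in> G"
      then obtain P B where P: "P \<in> partitions_into A t" "B \<in> P" "Q = insert (insert a B) (P - {B})"
        by (auto simp: G_def)
      have pA: "partition_on A P" and cP: "card P = t" using P(1) by (auto simp: partitions_into_def)
      have dis: "D \<inter> B = {}" if "D \<in> P" "D \<noteq> B" for D using disjointD[OF partition_onD2[OF pA]] that P(2) by blast
      have "partition_on (A - B) (P - {B})"
        using pA dis P(2) unfolding partition_on_def by (auto simp: pairwise_def)
      moreover have "insert a B \<inter> (A - B) = {}" using insert(2) by blast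
      moreover have "insert a B \<union> (A - B) = insert a A" using sub[OF P(1,2)] by blast
      ultimately have Q: "partition_on (insert a A) Q" "insert a B \<notin> P - {B}"
        using partition_on_add_block[of "A - B" "P - {B}" "insert a B"] P(3) by auto
      have "card Q = Suc (card (P - {B}))" unfolding P(3) using Q(2) finP[OF P(1)] by simp
      also have "\<dots> = card P" using P(2) finP[OF P(1)] by (metis card_Suc_Diff1)
      finally show "Q \<in> partitions_into (insert a A) t" using Q(1) cP by (simp add: partitions_into_def)
    qed
    have FG: "F \<inter> G = {}"
    proof (rule ccontr)
      assume "F \<inter> G \<noteq> {}"
      then obtain Q where Q: "Q \<in> F" "Q \<in> G" by blast
      have "{a} \<in> Q" using Q(1) by (auto simp: F_def)
      obtain P B where P: "P \<in> partitions_into A t" "B \<in> P" "Q = insert (insert a B) (P - {B})"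
        using Q(2) by (auto simp: G_def)
      from recover[OF P \<open>{a} \<in> Q\<close>] have "B = {}" by simp
      then show False using P by (auto simp: partitions_into_def dest: partition_onD3)
    qed
    have "card (SIGMA P:partitions_into A t. P) = (\<Sum>P\<in>partitions_into A t. card P)"
      using finite_partitions_into[OF insert(1)] finP by (intro card_SigmaI) auto
    also have "\<dots> = (\<Sum>P\<in>partitions_into A t. t)" by (intro sum.cong) (auto simp: partitions_into_def)
    finally have cS: "card G = t * card (partitions_into A t)" using cG by simp
    have finF: "finite F" "finite G"
      using F_sub G_sub finite_partitions_into[of "insert a A" t] insert(1) finite_subset by auto
    have "Stirling (card (insert a A)) t = t * Stirling (card A) t + Stirling (card A) s"
      using insert(1,2) Suc by simp
    also have "\<dots> \<le> t * card (partitions_into A t) + card (partitions_into A s)"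
      using insert(3)[of t] insert(3)[of s] by (intro add_mono mult_le_mono2)
    also have "\<dots> = card (F \<union> G)" using card_Un_disjoint[OF finF FG] cF cS by simp
    also have "\<dots> \<le> card (partitions_into (insert a A) t)"
      using F_sub G_sub finite_partitions_into[of "insert a A" t] insert(1) by (intro card_mono) auto
    finally show ?thesis .
  qed (use insert in simp)
qed

section \<open>The bounds for large n and the theorem\<close>

lemma partition_on_disjoint_Un:
  assumes P: "partition_on A P" and Q: "partition_on B Q" and AB: "A \<inter> B = {}"
  shows "partition_on (A \<union> B) (P \<union> Q)" "P \<inter> Q = {}"
proof -
  have sub: "\<And>C. C \<in> P \<Longrightarrow> C \<subseteq> A" "\<And>C. C \<in> Q \<Longrightarrow> C \<subseteq> B"
    using partition_onD1[OF P] partition_onD1[OF Q] by auto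
  have ne: "\<And>C. C \<in> P \<Longrightarrow> C \<noteq> {}" "\<And>C. C \<in> Q \<Longrightarrow> C \<noteq> {}"
    using partition_onD3[OF P] partition_onD3[OF Q] by auto
  show "P \<inter> Q = {}"
  proof (rule ccontr)
    assume "P \<inter> Q \<noteq> {}"
    then obtain C where C: "C \<in> P" "C \<in> Q" by blast
    then have "C \<subseteq> A \<inter> B" using sub by blast
    then show False using AB ne(1)[OF C(1)] by blast
  qed
  show "partition_on (A \<union> B) (P \<union> Q)"
  proof (rule partition_onI)
    show "\<Union> (P \<union> Q) = A \<union> B" using partition_onD1[OF P] partition_onD1[OF Q] by auto
    show "{} \<notin> P \<union> Q" using ne by blast
    fix C D assume CD: "C \<in> P \<union> Q" "D \<in> P \<union> Q" "C \<noteq> D"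
    have PQ: "C \<inter> D = {}" if "C \<in> P" "D \<in> Q" for C D using sub that AB by blast
    have "C \<inter> D = {}"
      using CD(1,2)
    proof (elim UnE)
      assume "C \<in> P" "D \<in> P"
      then show ?thesis using disjointD[OF partition_onD2[OF P]] CD(3) by blast
    next
      assume "C \<in> Q" "D \<in> Q"
      then show ?thesis using disjointD[OF partition_onD2[OF Q]] CD(3) by blast
    next
      assume "C \<in> P" "D \<in> Q"
      then show ?thesis by (rule PQ)
    next
      assume "C \<in> Q" "D \<in> P"
      then show ?thesis using PQ[of D C] by blast
    qed
    then show "disjnt C D" by (simp add: disjnt_def)
  qed
qed

lemma half_data_if_bij:
  assumes "partition_on {1..n} (N \<union> M)" "N \<inter> M = {}" "bij_betw b {1..j} M" "j \<le> n"
  shows "half_data n j b N"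
  using assms unfolding half_data_def bij_betw_def by simp

lemma less_if_le_two_sqrt:
  assumes "144 \<le> n" "real k \<le> 2 * sqrt (real n)"
  shows "k * k \<le> 4 * n" "k < n"
proof -
  have "real k * real k \<le> (2 * sqrt (real n)) * (2 * sqrt (real n))"
    by (rule mult_mono) (use assms in auto)
  also have "\<dots> = real (4 * n)" by simp
  finally have "real (k * k) \<le> real (4 * n)" by simp
  then show kk: "k * k \<le> 4 * n" by (simp only: of_nat_le_iff)
  show "k < n"
  proof (rule ccontr)
    assume "\<not> k < n"
    then have "n * n \<le> k * k" by (intro mult_le_mono) auto
    then have "n * n \<le> 4 * n" using kk by linarith
    then show False using assms(1) by simp
  qed
qed

text \<open>Half diagrams with \<open>j\<close> through strands: choose the \<open>j\<close> top points of the strands and a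
  partition of the others into blocks of size at most two.\<close>

theorem involutions_le_ssgap_RoBr:
  assumes n: "1681 \<le> n" and k: "real k \<le> 2 * sqrt (real n)"
  shows "ereal (real (involutions n)) \<le> ssgap (F :: 'f::field itself) (trunc (RoBr n) k)"
proof -
  interpret factorizable_monoid n "RoBr n" by (rule factorizable_RoBr)
  have kn: "k < n" using less_if_le_two_sqrt(2)[of n k] n k by simp
  show ?thesis
  proof (rule le_ssgap_trunc[OF kn])
    fix j assume j: "1 \<le> j" "j \<le> k"
    define U where "U = {A. A \<subseteq> {1..n} \<and> card A = j}"
    define W where "W = (SIGMA A:U. pairings ({1..n} - A))"
    define h :: "nat set \<times> nat set set \<Rightarrow> nat set set \<times> nat set set"
      where "h = (\<lambda>(A, N). (N, (\<lambda>x. {x}) ` A))"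
    have finU: "finite U" unfolding U_def by simp
    have "inj_on h W"
    proof (rule inj_onI)
      fix x y assume "h x = h y"
      then have "snd x = snd y" "(\<lambda>x. {x}) ` fst x = (\<lambda>x. {x}) ` fst y" by (auto simp: h_def split: prod.splits)
      moreover have "inj (\<lambda>x :: nat. {x})" by (simp add: inj_def)
      then have "fst x = fst y \<longleftrightarrow> (\<lambda>x. {x}) ` fst x = (\<lambda>x. {x}) ` fst y"
        by (simp add: inj_image_eq_iff)
      ultimately show "x = y" by (simp add: prod_eq_iff)
    qed
    then have "card (h ` W) = card W" by (rule card_image)
    also have "\<dots> = (\<Sum>A\<in>U. card (pairings ({1..n} - A)))"
      unfolding W_def using finU finite_pairings by (intro card_SigmaI) auto
    also have "\<dots> \<ge> (\<Sum>A\<in>U. involutions (n - j))"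
    proof (rule sum_mono)
      fix A assume "A \<in> U"
      then have "card ({1..n} - A) = n - j" by (auto simp: U_def card_Diff_subset finite_subset)
      then show "involutions (n - j) \<le> card (pairings ({1..n} - A))"
        using involutions_le_card_pairings[of "{1..n} - A"] by simp
    qed
    also have "(\<Sum>A\<in>U. involutions (n - j)) = (n choose j) * involutions (n - j)"
      using n_subsets[of "{1..n}" j] by (simp add: U_def)
    finally have card: "(n choose j) * involutions (n - j) \<le> card (h ` W)" .
    have W: "partition_on {1..n} (N \<union> M) \<and> N \<inter> M = {} \<and> card M = j \<and> finite M \<and>
        (\<forall>B\<in>N. card B \<le> 2) \<and> (\<forall>B\<in>M. card B = 1)" if NM: "(N, M) \<in> h ` W" for N M
    proof -
      obtain A where A: "A \<in> U" "N \<in> pairings ({1..n} - A)" and M: "M = (\<lambda>x. {x}) ` A"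
        using NM by (auto simp: h_def W_def)
      have sub: "A \<subseteq> {1..n}" "card A = j" using A(1) by (auto simp: U_def)
      have N: "partition_on ({1..n} - A) N" "\<forall>B\<in>N. card B \<le> 2" using A(2) by (auto simp: pairings_def)
      have Meq: "partition_on A M" unfolding M by (rule partition_on_singletons)
      have "({1..n} - A) \<union> A = {1..n}" using sub by blast
      then have "partition_on {1..n} (N \<union> M)" "N \<inter> M = {}"
        using partition_on_disjoint_Un[OF N(1) Meq] by auto
      moreover have "card M = j" unfolding M using sub by (simp add: card_image)
      moreover have "finite M" unfolding M using sub finite_subset by blast
      ultimately show ?thesis using N(2) M by auto
    qed
    have "card (h ` W) \<le> num_r_cells (trunc (RoBr n) k) (eps n j)"
    proof (rule card_le_num_r_cells_eps[OF kn j(2)])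
      fix N M assume F: "(N, M) \<in> h ` W"
      then show "partition_on {1..n} (N \<union> M) \<and> N \<inter> M = {} \<and> card M = j \<and> finite M" using W by blast
      fix b assume b: "bij_betw b {1..j} M"
      have hd: "half_data n j b N" using W[OF F] b j kn by (intro half_data_if_bij) auto
      have "card (b i) = 1" if "i \<in> {1..j}" for i using W[OF F] bij_betwE[OF b] that by blast
      then have "finite (b i) \<and> card (b i) \<le> 1" if "i \<in> {1..j}" for i
        using that by (metis card.infinite order_refl zero_neq_one)
      then have "\<forall>C\<in>half n j b N. card C \<le> 2" using W[OF F] card_half_block[of j b N] by blast
      then show "half n j b N \<in> carrier (RoBr n) \<and> flip (half n j b N) \<in> carrier (RoBr n)"
        using half_partition[OF hd] flip_partition card_flip_block by (simp add: RoBr_iff)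
    qed
    then have "involutions n \<le> num_r_cells (trunc (RoBr n) k) (eps n j)"
      using card involutions_le[OF n, of j] j k by simp
    then show "ereal (real (involutions n)) \<le> ereal (real (num_r_cells (trunc (RoBr n) k) (eps n j)))" by simp
  qed
qed

text \<open>Half diagrams with \<open>j\<close> through strands: choose a partition of the top points and \<open>j\<close> of
  its blocks.\<close>

theorem Bell_le_ssgap_Pa:
  assumes n: "144 \<le> n" and k: "real k \<le> 2 * sqrt (real n)"
  shows "ereal (real (\<Sum>t=0..n. Stirling n t)) \<le> ssgap (F :: 'f::field itself) (trunc (Pa n) k)"
proof -
  interpret factorizable_monoid n "Pa n" by (rule factorizable_Pa)
  note kn = less_if_le_two_sqrt[OF n k]
  show ?thesis
  proof (rule le_ssgap_trunc[OF kn(2)])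
    fix j assume j: "1 \<le> j" "j \<le> k"
    define U where "U = (\<Union>t\<in>{0..n}. partitions_into {1..n} t)"
    define W where "W = (SIGMA P:U. {M. M \<subseteq> P \<and> card M = j})"
    define h :: "nat set set \<times> nat set set \<Rightarrow> nat set set \<times> nat set set"
      where "h = (\<lambda>(P, M). (P - M, M))"
    have finU: "finite U" unfolding U_def using finite_partitions_into by auto
    have U: "partition_on {1..n} P \<and> finite P" if "P \<in> U" for P
      using that finite_elements[of "{1..n}" P] by (auto simp: U_def partitions_into_def)
    have "inj_on h W"
    proof (rule inj_onI)
      fix x y assume xy: "x \<in> W" "y \<in> W" "h x = h y"
      then have "fst x = (fst x - snd x) \<union> snd x" "fst y = (fst y - snd y) \<union> snd y" by (auto simp: W_def)
      moreover have "fst x - snd x = fst y - snd y" "snd x = snd y"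
        using xy(3) by (simp_all add: h_def split: prod.splits)
      ultimately show "x = y" by (metis prod_eqI)
    qed
    then have "card (h ` W) = card W" by (rule card_image)
    also have "\<dots> = (\<Sum>P\<in>U. card {M. M \<subseteq> P \<and> card M = j})"
      unfolding W_def using finU U by (intro card_SigmaI) auto
    also have "\<dots> = (\<Sum>P\<in>U. card P choose j)"
      using U by (intro sum.cong refl) (simp add: n_subsets)
    also have "\<dots> = (\<Sum>t\<in>{0..n}. \<Sum>P\<in>partitions_into {1..n} t. card P choose j)"
      unfolding U_def by (rule sum.UNION_disjoint) 
        (simp, simp add: finite_partitions_into, auto simp: partitions_into_def)
    also have "\<dots> \<ge> (\<Sum>t=0..n. Stirling n t * (t choose j))"
    proof (rule sum_mono)
      fix t
      have "(\<Sum>P\<in>partitions_into {1..n} t. card P choose j) = card (partitions_into {1..n} t) * (t choose j)"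
        by (simp add: partitions_into_def)
      then show "Stirling n t * (t choose j) \<le> (\<Sum>P\<in>partitions_into {1..n} t. card P choose j)"
        using Stirling_le_card_partitions[of "{1..n}" t] by simp
    qed
    finally have card: "(\<Sum>t=0..n. Stirling n t * (t choose j)) \<le> card (h ` W)" .
    have W: "partition_on {1..n} (N \<union> M) \<and> N \<inter> M = {} \<and> card M = j \<and> finite M" if NM: "(N, M) \<in> h ` W" for N M
    proof -
      obtain P where P: "P \<in> U" "M \<subseteq> P" "card M = j" "N = P - M" using NM by (auto simp: h_def W_def)
      have "N \<union> M = P" using P by blast
      moreover have "finite M" using U[OF P(1)] P(2) finite_subset by blast
      ultimately show ?thesis using P U[OF P(1)] by auto
    qed
    have "card (h ` W) \<le> num_r_cells (trunc (Pa n) k) (eps n j)"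
    proof (rule card_le_num_r_cells_eps[OF kn(2) j(2)])
      fix N M assume F: "(N, M) \<in> h ` W"
      then show "partition_on {1..n} (N \<union> M) \<and> N \<inter> M = {} \<and> card M = j \<and> finite M" by (rule W)
      fix b assume b: "bij_betw b {1..j} M"
      have "half_data n j b N" using W[OF F] b j kn(2) by (intro half_data_if_bij) auto
      then show "half n j b N \<in> carrier (Pa n) \<and> flip (half n j b N) \<in> carrier (Pa n)"
        using half_partition flip_partition by (simp add: carrier_Pa)
    qed
    moreover have "(\<Sum>t=0..n. Stirling n t) \<le> (\<Sum>t=0..n. Stirling n t * (t choose j))"
    proof (rule Stirling_sum_le[OF n])
      have "j * j \<le> k * k" using j(2) by (rule mult_le_mono) (rule j(2))
      then show "j * j \<le> 4 * n" using kn(1) by linarith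
      show "j < n" using j(2) kn(2) by linarith
    qed
    ultimately have "(\<Sum>t=0..n. Stirling n t) \<le> num_r_cells (trunc (Pa n) k) (eps n j)" using card by linarith
    then show "ereal (real (\<Sum>t=0..n. Stirling n t)) \<le> ereal (real (num_r_cells (trunc (Pa n) k) (eps n j)))"
      by (simp only: ereal_less_eq of_nat_le_iff)
  qed
qed

theorem theorem5p6p11:
  shows
    "(\<forall>n k l. k < n \<and> l \<le> n \<and> \<not> CHAR('k::field) dvd fact n \<longrightarrow>
        rep_gap TYPE('k) (trunc2 (Ro n) k l) \<ge> rep_gap TYPE('k) (trunc2 (pRo n) k l)) \<and>
     (\<forall>n k l. k < n \<and> l \<le> n \<longrightarrow>
        ssgap TYPE('l::field) (trunc2 (Ro n) k l) = ssgap TYPE('l) (trunc2 (pRo n) k l)) \<and>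
     (\<forall>n k l. k \<le> n \<and> l \<le> n \<longrightarrow>
        faith TYPE('l) (trunc2 (Ro n) k l) \<ge> faith TYPE('l) (trunc2 (pRo n) k l)) \<and>
     (\<forall>n k. k < n \<longrightarrow>
        ssgap TYPE('l) (trunc (RoBr n) k) \<ge> ssgap TYPE('l) (trunc (Mo n) k)) \<and>
     (\<exists>N. \<forall>n\<ge>N. \<forall>k. real k \<le> 2 * sqrt (real n) \<longrightarrow>
        ssgap TYPE('l) (trunc (RoBr n) k)
          \<ge> ereal (real (\<Sum>t=0..n. (n choose (2 * t)) * odd_double_fact t))) \<and>
     (\<forall>n k. k \<le> n \<longrightarrow>
        faith TYPE('l) (trunc (RoBr n) k) \<ge> faith TYPE('l) (trunc (Mo n) k)) \<and>
     (\<forall>n k. k < n \<longrightarrow>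
        ssgap TYPE('l) (trunc (Pa n) k) \<ge> ssgap TYPE('l) (trunc (pPa n) k)) \<and>
     (\<exists>N. \<forall>n\<ge>N. \<forall>k. real k \<le> 2 * sqrt (real n) \<longrightarrow>
        ssgap TYPE('l) (trunc (Pa n) k) \<ge> ereal (real (\<Sum>t=0..n. Stirling n t))) \<and>
     (\<forall>n k. k \<le> n \<longrightarrow>
        faith TYPE('l) (trunc (Pa n) k) \<ge> faith TYPE('l) (trunc (pPa n) k))"
proof (intro conjI allI impI)
  fix n k l :: nat
  interpret Ro: inverse_pair n "pRo n" "Ro n" by (rule inverse_pair_Ro)
  interpret RoBr: diagram_pair n "Mo n" "RoBr n" by (rule diagram_pair_Mo)
  interpret Pa: diagram_pair n "pPa n" "Pa n" by (rule diagram_pair_pPa)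
  show "rep_gap TYPE('k) (trunc2 (pRo n) k l) \<le> rep_gap TYPE('k) (trunc2 (Ro n) k l)"
    if "k < n \<and> l \<le> n \<and> \<not> CHAR('k::field) dvd fact n"
    using that by (intro Ro.rep_gap_trunc2) auto
  show "ssgap TYPE('l) (trunc2 (Ro n) k l) = ssgap TYPE('l) (trunc2 (pRo n) k l)" if "k < n \<and> l \<le> n"
    using that by (intro Ro.ssgap_trunc2_eq) auto
  show "faith TYPE('l) (trunc2 (pRo n) k l) \<le> faith TYPE('l) (trunc2 (Ro n) k l)" if "k \<le> n \<and> l \<le> n"
    using that by (intro Ro.faith_trunc2) auto
  show "ssgap TYPE('l) (trunc (Mo n) k) \<le> ssgap TYPE('l) (trunc (RoBr n) k)" if "k < n"
    by (rule RoBr.ssgap_trunc[OF that])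
  show "faith TYPE('l) (trunc (Mo n) k) \<le> faith TYPE('l) (trunc (RoBr n) k)"
    by (rule RoBr.faith_trunc)
  show "ssgap TYPE('l) (trunc (pPa n) k) \<le> ssgap TYPE('l) (trunc (Pa n) k)" if "k < n"
    by (rule Pa.ssgap_trunc[OF that])
  show "faith TYPE('l) (trunc (pPa n) k) \<le> faith TYPE('l) (trunc (Pa n) k)"
    by (rule Pa.faith_trunc)
next
  show "\<exists>N. \<forall>n\<ge>N. \<forall>k. real k \<le> 2 * sqrt (real n) \<longrightarrow>
      ereal (real (\<Sum>t=0..n. (n choose (2 * t)) * odd_double_fact t)) \<le> ssgap TYPE('l) (trunc (RoBr n) k)"
    using involutions_le_ssgap_RoBr unfolding involutions_eq_sum by blast
  show "\<exists>N. \<forall>n\<ge>N. \<forall>k. real k \<le> 2 * sqrt (real n) \<longrightarrow>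
      ereal (real (\<Sum>t=0..n. Stirling n t)) \<le> ssgap TYPE('l) (trunc (Pa n) k)"
    using Bell_le_ssgap_Pa by blast
qed

end
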